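(* Let $p\in(1,\infty]$ and let $\{X(s),\ s\in\mathbb{Z}\}$ be a simple max-stable process with $\ell^p$ norm based representation $$X(\cdot)=_d\frac{U^{(p)}(\cdot)}{\Gamma(1-p^{-1})}\,\|\mathbf{A}\circ\mathbf{W}^{(p)}(\cdot)\|_p,$$ where $\{U^{(p)}(s)\}_{s\in\mathbb{Z}}$ is a collection of independent $\Phi_p$ random variables, $\{A_i\}_{i\in\mathbb{N}}$ are the points of a Poisson point process on $(0,\infty)$ with intensity measure $a^{-2}\,\mathrm{d}a$, and $W^{(p)}_i$, $i\in\mathbb{N}$, are independent copies of a non-negative process $\{W^{(p)}(s),\ s\in\mathbb{Z}\}$ with $\mathbb{E}\{W^{(p)}(s)\}=1$ for all $s\in\mathbb{Z}$, all three families being independent of each other. Let $$\overline{X}(s)=\max_{i\in\mathbb{N}}A_iW^{(p)}_i(s),\qquad s\in\mathbb{Z},$$ be the denoised process associated to $X$. Then the following holds. 1. $X$ is stationary if and only if $\overline{X}$ is stationary. If $X$ is stationary, we further have: 2. $X$ is mixing if and only if $\overline{X}$ is mixing. 3. $X$ is ergodic if and only if $\overline{X}$ is ergodic.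
   Context: For $\alpha\in(0,\infty)$, $\Phi_\alpha(x)=\exp(-x^{-\alpha})$, $x>0$, is the $\alpha$-Fréchet distribution function; $\Phi_\infty(x)=\mathbf{1}_{[1,\infty)}(x)$, i.e. a $\Phi_\infty$ random variable equals $1$ almost surely. For $p=\infty$ we set $p^{-1}=0$. The symbol $=_d$ between processes means equality of all finite-dimensional distributions. For sequences $\mathbf{A}=\{A_i\}_{i\in\mathbb{N}}$ and $\mathbf{W}^{(p)}(s)=\{W^{(p)}_i(s)\}_{i\in\mathbb{N}}$ of non-negative numbers, $\|\mathbf{A}\circ\mathbf{W}^{(p)}(s)\|_p=[\sum_{i\in\mathbb{N}}(A_iW^{(p)}_i(s))^p]^{1/p}$ for $p<\infty$ and $\max_{i\in\mathbb{N}}A_iW^{(p)}_i(s)$ for $p=\infty$. A stochastic process $X=\{X(s),\ s\in S\}$ on a countable set $S$ (here $S=\mathbb{Z}$) is called max-stable if there exist functions $a_n:S\to(0,\infty)$ and $b_n:S\to\mathbb{R}$, $n\in\mathbb{N}$, such that for every $n\in\mathbb{N}$ the process $\max_{i=1}^n (X_i-b_n)/a_n$ (pointwise maximum; $X_1,X_2,\ldots$ independent copies of $X$) has the same law as $X$. It is called simple max-stable if in addition $X(s)$ has distribution function $\Phi_1$ for every $s\in S$. Stationarity, ergodicity and mixing are understood in the usual sense, with respect to the shift on $\mathbb{Z}$ acting on the law of the process. *)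

theory Defs
  imports "HOL-Probability.Probability"
begin

text \<open>A stochastic process on an index set is a function \<open>Z :: 's \<Rightarrow> 'a \<Rightarrow> real\<close> on a probability
  space \<open>M\<close>. Processes living on different probability spaces are compared through their
  finite-dimensional distributions.\<close>

definition same_fdd :: "'a measure \<Rightarrow> ('s \<Rightarrow> 'a \<Rightarrow> real) \<Rightarrow> 'b measure \<Rightarrow> ('s \<Rightarrow> 'b \<Rightarrow> real) \<Rightarrow> bool"
  where "same_fdd M X N Y \<longleftrightarrow>
    (\<forall>J. finite J \<longrightarrow>
      distr M (\<Pi>\<^sub>M s\<in>J. borel) (\<lambda>\<omega>. \<lambda>s\<in>J. X s \<omega>) =
      distr N (\<Pi>\<^sub>M s\<in>J. borel) (\<lambda>\<omega>. \<lambda>s\<in>J. Y s \<omega>))"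

definition frechet_cdf :: "ereal \<Rightarrow> real \<Rightarrow> real"
  where "frechet_cdf \<alpha> x =
    (if \<alpha> = \<infinity> then indicator {1..} x
     else if x > 0 then exp (- (x powr (- real_of_ereal \<alpha>))) else 0)"

definition has_frechet_distribution :: "'a measure \<Rightarrow> ('a \<Rightarrow> real) \<Rightarrow> ereal \<Rightarrow> bool"
  where "has_frechet_distribution M Z \<alpha> \<longleftrightarrow> (\<forall>x. cdf (distr M borel Z) x = frechet_cdf \<alpha> x)"

text \<open>For \<open>p = \<infinity>\<close> the supremum replaces the maximum. Both the supremum and the series are taken in
  the reals, so that they have an unspecified value on unbounded sequences and divergent series;
  for the sequences considered here this concerns a null event only.\<close>

definition lp_norm :: "ereal \<Rightarrow> (nat \<Rightarrow> real) \<Rightarrow> real"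
  where "lp_norm p x =
    (if p = \<infinity> then (SUP i. x i)
     else (\<Sum>i. x i powr real_of_ereal p) powr (1 / real_of_ereal p))"

definition has_poisson_distribution :: "'a measure \<Rightarrow> ('a \<Rightarrow> ennreal) \<Rightarrow> ennreal \<Rightarrow> bool"
  where "has_poisson_distribution M N r \<longleftrightarrow>
    (if r = \<infinity> then (AE \<omega> in M. N \<omega> = \<infinity>)
     else (\<forall>k::nat. measure M {\<omega> \<in> space M. N \<omega> = of_nat k} =
             exp (- enn2real r) * enn2real r ^ k / fact k))"

text \<open>Number of points in \<open>B\<close>, counted with multiplicity.\<close>

definition point_count :: "(nat \<Rightarrow> 'a \<Rightarrow> 'b) \<Rightarrow> 'b set \<Rightarrow> 'a \<Rightarrow> ennreal"
  where "point_count A B \<omega> = emeasure (count_space UNIV) {i. A i \<omega> \<in> B}"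

definition poisson_process_points :: "'a measure \<Rightarrow> 'b measure \<Rightarrow> (nat \<Rightarrow> 'a \<Rightarrow> 'b) \<Rightarrow> bool"
  where "poisson_process_points M \<mu> A \<longleftrightarrow>
    (\<forall>i. A i \<in> measurable M \<mu>) \<and>
    (\<forall>B\<in>sets \<mu>. has_poisson_distribution M (point_count A B) (emeasure \<mu> B)) \<and>
    (\<forall>\<B>. finite \<B> \<and> \<B> \<subseteq> sets \<mu> \<and> disjoint \<B> \<longrightarrow>
       prob_space.indep_vars M (\<lambda>_. borel) (point_count A) \<B>)"

text \<open>The measure \<open>a\<^sup>-\<^sup>2 da\<close> on \<open>(0,\<infinity>)\<close>; the space of this measure is \<open>(0,\<infinity>)\<close> itself, so that points
  of a Poisson process with this intensity are positive.\<close>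

definition inverse_square_measure :: "real measure"
  where "inverse_square_measure =
    density (restrict_space lborel {0<..}) (\<lambda>a. ennreal (1 / a\<^sup>2))"

definition generated_events :: "'a measure \<Rightarrow> 'b measure \<Rightarrow> ('a \<Rightarrow> 'b) \<Rightarrow> 'a set set"
  where "generated_events M N Z = {Z -` B \<inter> space M | B. B \<in> sets N}"

text \<open>Mutual independence of three random elements with possibly different value spaces.
  (The library's \<open>indep_vars\<close> requires values of one type.)\<close>

definition indep_three ::
  "'a measure \<Rightarrow> 'b measure \<Rightarrow> ('a \<Rightarrow> 'b) \<Rightarrow> 'c measure \<Rightarrow> ('a \<Rightarrow> 'c) \<Rightarrow> 'd measure \<Rightarrow> ('a \<Rightarrow> 'd) \<Rightarrow> bool"
  where "indep_three M N1 Z1 N2 Z2 N3 Z3 \<longleftrightarrow>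
    Z1 \<in> measurable M N1 \<and> Z2 \<in> measurable M N2 \<and> Z3 \<in> measurable M N3 \<and>
    prob_space.indep_sets M
      (\<lambda>k. [generated_events M N1 Z1, generated_events M N2 Z2, generated_events M N3 Z3] ! k)
      {..<3::nat}"

text \<open>The independent copies \<open>X\<^sub>1, X\<^sub>2, \<dots>\<close> are realised as the coordinates of the infinite product of
  the underlying probability space with itself.\<close>

definition max_stable :: "'a measure \<Rightarrow> ('s \<Rightarrow> 'a \<Rightarrow> real) \<Rightarrow> bool"
  where "max_stable M X \<longleftrightarrow>
    (\<exists>a b :: nat \<Rightarrow> 's \<Rightarrow> real. (\<forall>n s. a n s > 0) \<and>
      (\<forall>n\<ge>1. same_fdd
         (\<Pi>\<^sub>M i\<in>(UNIV::nat set). M)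
         (\<lambda>s \<omega>. MAX i\<in>{1..n}. (X s (\<omega> i) - b n s) / a n s)
         M X))"

definition simple_max_stable :: "'a measure \<Rightarrow> ('s \<Rightarrow> 'a \<Rightarrow> real) \<Rightarrow> bool"
  where "simple_max_stable M X \<longleftrightarrow>
    max_stable M X \<and> (\<forall>s. has_frechet_distribution M (X s) 1)"

definition denoised :: "(nat \<Rightarrow> 'a \<Rightarrow> real) \<Rightarrow> (nat \<Rightarrow> 's \<Rightarrow> 'a \<Rightarrow> real) \<Rightarrow> 's \<Rightarrow> 'a \<Rightarrow> real"
  where "denoised A W s \<omega> = lp_norm \<infinity> (\<lambda>i. A i \<omega> * W i s \<omega>)"

definition path_space :: "('s \<Rightarrow> real) measure"
  where "path_space = (\<Pi>\<^sub>M s\<in>UNIV. borel)"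

definition path_law :: "'a measure \<Rightarrow> ('s \<Rightarrow> 'a \<Rightarrow> real) \<Rightarrow> ('s \<Rightarrow> real) measure"
  where "path_law M Z = distr M path_space (\<lambda>\<omega> s. Z s \<omega>)"

definition shift_path :: "int \<Rightarrow> (int \<Rightarrow> real) \<Rightarrow> (int \<Rightarrow> real)"
  where "shift_path h x = (\<lambda>s. x (s + h))"

definition stationary_process :: "'a measure \<Rightarrow> (int \<Rightarrow> 'a \<Rightarrow> real) \<Rightarrow> bool"
  where "stationary_process M Z \<longleftrightarrow>
    (\<forall>h. distr (path_law M Z) path_space (shift_path h) = path_law M Z)"

text \<open>Ergodicity and mixing are notions for stationary processes; stationarity is not included in the
  following two predicates.\<close>

definition ergodic_process :: "'a measure \<Rightarrow> (int \<Rightarrow> 'a \<Rightarrow> real) \<Rightarrow> bool"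
  where "ergodic_process M Z \<longleftrightarrow>
    (\<forall>E\<in>sets path_space. shift_path 1 -` E = E \<longrightarrow>
       measure (path_law M Z) E = 0 \<or> measure (path_law M Z) E = 1)"

definition mixing_process :: "'a measure \<Rightarrow> (int \<Rightarrow> 'a \<Rightarrow> real) \<Rightarrow> bool"
  where "mixing_process M Z \<longleftrightarrow>
    (\<forall>E\<in>sets path_space. \<forall>F\<in>sets path_space.
       (\<lambda>n::nat. measure (path_law M Z) (E \<inter> shift_path (int n) -` F))
         \<longlonglongrightarrow> measure (path_law M Z) E * measure (path_law M Z) F)"

end

theory Submission
  imports Defs
begin

text \<open>Both \<open>X\<close> and its denoised process have finite-dimensional distributions of one shape,
  \<open>P (Z(s) \<le> x(s) for all s in J) = exp (- E of the q-norm of (W_0(s) / x(s)) over s in J)\<close>,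
  with \<open>q = \<infinity>\<close> for the denoised process and \<open>q = p\<close> for \<open>X\<close>. For the denoised process this is the
  void probability of a marked Poisson process (\<open>denoised_law\<close>). For \<open>p = \<infinity>\<close>
  the factors \<open>U(s)\<close> equal \<open>1\<close> and both processes have the same law; for finite \<open>p\<close>, conditioning on the
  points and marks turns the independent Frechet factors into \<open>exp\<close> of minus a sum over the points, and the
  Laplace functional of the Poisson process gives the formula (\<open>frechet_mixture_law\<close>). The theorem is
  a statement about the two families of exponents, for \<open>q = p\<close> and \<open>q = \<infinity>\<close>.

  Stationarity says that the exponents of \<open>W_0\<close> and of its shifts agree, so it suffices that the
  exponents of order \<open>\<infinity>\<close> and those of order \<open>p\<close> determine each other. In one direction, the
  \<open>p\<close>-norm of \<open>y\<close> is, up to a constant, the expectation of the largest \<open>U(s) y(s)\<close> for independent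
  \<open>p\<close>-Frechet variables \<open>U(s)\<close>, so the exponents of order \<open>p\<close> are averages of exponents of order
  \<open>\<infinity>\<close> (\<open>max_exponents_determine_power_exponents\<close>). In the other direction, let \<open>\<Lambda>\<close> be the image of
  \<open>a\<^sup>-\<^sup>2 da \<otimes> P\<close> under \<open>(a, \<omega>) \<mapsto> (a W_0(s, \<omega>))_s\<close>. Up to a constant, the exponents of order \<open>p\<close> are the
  integrals of \<open>1 - exp (- \<Sum>\<lambda>(s) z(s)^p)\<close> with respect to \<open>\<Lambda>\<close>, hence they give the moments of the
  variables \<open>exp (- z(s)^p)\<close> under a finite measure with an explicit density relative to \<open>\<Lambda>\<close>. These
  moments determine \<open>\<Lambda>\<close> away from \<open>0\<close>, and the exponents of order \<open>\<infinity>\<close> are the \<open>\<Lambda>\<close>-masses of the sets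
  where some \<open>z(s)\<close> exceeds \<open>x(s)\<close> (\<open>power_exponents_determine_max_exponents\<close>).

  For mixing and ergodicity, compare the joint probability of two events as above, over disjoint
  index sets, with the product of their probabilities. The quotient is \<open>exp\<close> of the expectation of
  the triangle defect \<open>\<alpha> + \<beta> - (\<alpha>^q + \<beta>^q)^(1/q)\<close> of the two norms, and this defect lies between
  \<open>\<kappa> min \<alpha> \<beta>\<close> and \<open>min \<alpha> \<beta>\<close> for a constant \<open>\<kappa> > 0\<close>. Hence for every \<open>q\<close> the correlations are
  controlled from both sides by \<open>E min (W_0(0)) (W_0(n))\<close>, in which \<open>q\<close> does not occur: a stationary
  process of this kind is mixing iff this sequence tends to \<open>0\<close> (\<open>mixing_iff\<close>), and ergodic iff it
  tends to \<open>0\<close> in the mean (\<open>ergodic_iff\<close>). Both criteria are proved together, for an abstract notion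
  of negligible sequence. Only the step from ergodicity to averaged correlations needs an ergodic
  theorem; one half of it, obtained from the maximal ergodic inequality, is enough, because the
  correlations of the events in question are non-negative.\<close>

section \<open>Norms over finitely many coordinates\<close>

text \<open>The element \<open>0\<close> gives the maximum over the empty set the value \<open>0\<close>, in agreement with the empty
  sum.\<close>

definition coordinate_norm :: "ereal \<Rightarrow> 's set \<Rightarrow> ('s \<Rightarrow> real) \<Rightarrow> real"
  where "coordinate_norm p J y =
    (if p = \<infinity> then Max (insert 0 (y ` J))
     else (\<Sum>s\<in>J. y s powr real_of_ereal p) powr (1 / real_of_ereal p))"

text \<open>The \<open>p\<close>-norm of a pair, by which the norms over two disjoint sets combine.\<close>

definition norm_join :: "ereal \<Rightarrow> real \<Rightarrow> real \<Rightarrow> real"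
  where "norm_join p a b =
    (if p = \<infinity> then max a b
     else (a powr real_of_ereal p + b powr real_of_ereal p) powr (1 / real_of_ereal p))"

text \<open>The triangle defect at \<open>(1, 1)\<close>, which is the best constant in \<open>norm_join_bounds\<close>.\<close>

definition defect_factor :: "ereal \<Rightarrow> real"
  where "defect_factor p = (if p = \<infinity> then 1 else 2 - 2 powr (1 / real_of_ereal p))"

lemma exponent_cases [consumes 1]:
  fixes p :: ereal
  assumes "1 < p"
  obtains "p = \<infinity>" | q where "p = ereal q" "1 < q"
  using assms by (cases p) auto

lemma defect_factor_pos:
  assumes "1 < p" shows "0 < defect_factor p"
  using assms
proof (cases rule: exponent_cases)
  case (2 q)
  then have "2 powr (1 / q) < 2 powr (1::real)" by (intro powr_less_mono) auto
  then show ?thesis using 2 by (simp add: defect_factor_def)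
qed (simp add: defect_factor_def)

text \<open>The increments of a convex function over intervals of length \<open>c\<close> increase.\<close>

lemma powr_increment_mono:
  assumes "0 < b" "b \<le> a" "0 \<le> c" "1 \<le> q"
  shows "(b + c) powr q - b powr q \<le> (a + c) powr q - a powr (q::real)"
proof (rule DERIV_nonneg_imp_nondecreasing[OF \<open>b \<le> a\<close>])
  fix x assume x: "b \<le> x" "x \<le> a"
  then have "0 < x" using assms by simp
  have "((\<lambda>x. (x + c) powr q - x powr q) has_real_derivative (q * (x + c) powr (q - 1) - q * x powr (q - 1))) (at x)"
    using \<open>0 < x\<close> assms by (auto intro!: derivative_eq_intros)
  moreover have "x powr (q - 1) \<le> (x + c) powr (q - 1)"
    using \<open>0 < x\<close> assms by (intro powr_mono2) auto
  then have "0 \<le> q * (x + c) powr (q - 1) - q * x powr (q - 1)"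
    using assms by (simp add: mult_left_mono)
  ultimately show "\<exists>y. ((\<lambda>x. (x + c) powr q - x powr q) has_real_derivative y) (at x) \<and> 0 \<le> y" by blast
qed

lemma powr_inverse_cancel:
  assumes "0 \<le> a" "0 < (q::real)" shows "(a powr q) powr (1 / q) = a" "(a powr (1 / q)) powr q = a"
  using assms by (simp_all add: powr_powr)

text \<open>The triangle defect \<open>a + b - norm_join p a b\<close> is comparable to \<open>min a b\<close>. For finite \<open>p\<close>, equality
  in the last bound holds at \<open>a = b\<close>, and convexity of \<open>t \<mapsto> t powr p\<close> carries it to \<open>a \<noteq> b\<close>.\<close>

lemma norm_join_bounds:
  assumes p: "1 < p" and ab: "0 \<le> a" "0 \<le> b"
  shows "a \<le> norm_join p a b" "b \<le> norm_join p a b"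
    and "norm_join p a b \<le> a + b - defect_factor p * min a b"
proof -
  have le: "a \<le> (a powr q + b powr q) powr (1 / q)" if "0 \<le> a" "1 < q" for a b q :: real
  proof -
    have "(a powr q) powr (1 / q) \<le> (a powr q + b powr q) powr (1 / q)"
      using that by (intro powr_mono2) auto
    then show ?thesis using that by (simp add: powr_inverse_cancel)
  qed
  have ge: "(a powr q + b powr q) powr (1 / q) \<le> a + b - (2 - 2 powr (1 / q)) * b"
    if "0 \<le> b" "b \<le> a" "1 < q" for a b q :: real
  proof (cases "b = 0")
    case True
    then show ?thesis using that by (simp add: powr_inverse_cancel)
  next
    case False
    then have b: "0 < b" using that by simp
    (* with this t, the claim (a powr q + b powr q) powr (1 / q) \<le> a + t * b is an equality for a = b *)
    define t where "t = 2 powr (1 / q) - 1"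
    have t: "0 \<le> t" using that by (simp add: t_def ge_one_powr_ge_zero)
    have "(1 + t) powr q = 2" using that by (simp add: t_def powr_inverse_cancel)
    then have "(b + t * b) powr q = 2 * b powr q"
      using b t powr_mult[of "1 + t" b q] by (simp add: algebra_simps)
    moreover have "(b + t * b) powr q - b powr q \<le> (a + t * b) powr q - a powr q"
      using b t that by (intro powr_increment_mono) auto
    ultimately have "a powr q + b powr q \<le> (a + t * b) powr q" by simp
    then have "(a powr q + b powr q) powr (1 / q) \<le> ((a + t * b) powr q) powr (1 / q)"
      using that by (intro powr_mono2) auto
    also have "\<dots> = a + t * b" using that t b by (simp add: powr_inverse_cancel)
    finally show ?thesis by (simp add: t_def algebra_simps)
  qed
  have "a \<le> norm_join p a b \<and> b \<le> norm_join p a b \<and> norm_join p a b \<le> a + b - defect_factor p * min a b"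
    using p
  proof (cases rule: exponent_cases)
    case (2 q)
    then have "a \<le> norm_join p a b" "b \<le> norm_join p a b"
      using le[of a q b] le[of b q a] ab by (auto simp: norm_join_def add.commute)
    moreover have "norm_join p a b \<le> a + b - defect_factor p * min a b"
      using ge[of b a q] ge[of a b q] ab 2
      by (cases "a \<le> b") (auto simp: norm_join_def defect_factor_def min_def add.commute)
    ultimately show ?thesis by simp
  qed (use ab in \<open>auto simp: norm_join_def defect_factor_def min_def max_def\<close>)
  then show "a \<le> norm_join p a b" "b \<le> norm_join p a b"
    "norm_join p a b \<le> a + b - defect_factor p * min a b" by auto
qed

lemma coordinate_norm_Un:
  assumes p: "1 < p" and "finite J" "finite K" "J \<inter> K = {}"
  shows "coordinate_norm p (J \<union> K) y = norm_join p (coordinate_norm p J y) (coordinate_norm p K y)"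
  using p
proof (cases rule: exponent_cases)
  case 1
  have "Max (insert 0 (y ` J) \<union> insert 0 (y ` K)) = max (Max (insert 0 (y ` J))) (Max (insert 0 (y ` K)))"
    using assms by (intro Max_Un) auto
  moreover have "insert 0 (y ` J) \<union> insert 0 (y ` K) = insert 0 (y ` (J \<union> K))" by auto
  ultimately show ?thesis using 1 by (simp add: coordinate_norm_def norm_join_def)
next
  case (2 q)
  then show ?thesis using assms
    by (simp add: coordinate_norm_def norm_join_def powr_inverse_cancel sum_nonneg sum.union_disjoint)
qed

lemma coordinate_norm_nonneg: "finite J \<Longrightarrow> 0 \<le> coordinate_norm p J y"
  by (simp add: coordinate_norm_def)

lemma coordinate_norm_empty [simp]: "1 < p \<Longrightarrow> coordinate_norm p {} y = 0"
  by (auto simp: coordinate_norm_def)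

lemma coordinate_norm_singleton:
  assumes "1 < p" "0 \<le> y s" shows "coordinate_norm p {s} y = y s"
  using assms(1)
proof (cases rule: exponent_cases)
  case 1 then show ?thesis using assms by (simp add: coordinate_norm_def)
next
  case 2 then show ?thesis using assms by (simp add: coordinate_norm_def powr_inverse_cancel)
qed

lemma coordinate_norm_insert:
  assumes "1 < p" "finite J" "s \<notin> J" "0 \<le> y s"
  shows "coordinate_norm p (insert s J) y = norm_join p (y s) (coordinate_norm p J y)"
  using coordinate_norm_Un[of p "{s}" J y] assms by (simp add: coordinate_norm_singleton)

lemma coordinate_norm_le_sum:
  assumes "1 < p" "finite J" "\<And>s. s \<in> J \<Longrightarrow> 0 \<le> y s"
  shows "coordinate_norm p J y \<le> (\<Sum>s\<in>J. y s)"
  using assms(2,3)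
proof (induction J rule: finite_induct)
  case (insert s J)
  have "norm_join p (y s) (coordinate_norm p J y) \<le> y s + coordinate_norm p J y - defect_factor p * min (y s) (coordinate_norm p J y)"
    using insert assms(1) by (intro norm_join_bounds coordinate_norm_nonneg) auto
  also have "\<dots> \<le> y s + coordinate_norm p J y"
    using insert defect_factor_pos[OF assms(1)] coordinate_norm_nonneg[of J p y] by simp
  finally show ?case using insert assms(1) by (simp add: coordinate_norm_insert)
qed (use assms(1) in simp)

lemma coordinate_norm_image:
  assumes "inj_on f J" shows "coordinate_norm p (f ` J) y = coordinate_norm p J (\<lambda>s. y (f s))"
  by (simp add: coordinate_norm_def sum.reindex[OF assms] image_image)

lemma coordinate_norm_cong:
  "J = K \<Longrightarrow> (\<And>s. s \<in> K \<Longrightarrow> y s = z s) \<Longrightarrow> coordinate_norm p J y = coordinate_norm p K z"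
  by (simp add: coordinate_norm_def cong: image_cong)

lemma coordinate_norm_scale:
  assumes "1 < p" "finite J" "0 \<le> c" "\<And>s. s \<in> J \<Longrightarrow> 0 \<le> y s"
  shows "coordinate_norm p J (\<lambda>s. c * y s) = c * coordinate_norm p J y"
  using assms(1)
proof (cases rule: exponent_cases)
  case 1
  have "Max (insert 0 ((\<lambda>s. c * y s) ` J)) = Max ((\<lambda>t. c * t) ` insert 0 (y ` J))"
    by (simp add: image_image)
  also have "\<dots> = c * Max (insert 0 (y ` J))"
    using assms by (intro mono_Max_commute[symmetric]) (auto simp: mono_def mult_left_mono)
  finally show ?thesis using 1 by (simp add: coordinate_norm_def)
next
  case (2 q)
  then show ?thesis using assms
    by (simp add: coordinate_norm_def powr_mult sum_distrib_left[symmetric] sum_nonneg powr_inverse_cancel)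
qed

lemma borel_measurable_coordinate_norm [measurable (raw)]:
  assumes "finite J" "\<And>s. s \<in> J \<Longrightarrow> y s \<in> borel_measurable M"
  shows "(\<lambda>\<omega>. coordinate_norm p J (\<lambda>s. y s \<omega>)) \<in> borel_measurable M"
proof -
  have eq: "Max (insert 0 ((\<lambda>s. y s \<omega>) ` J)) = (MAX t\<in>insert None (Some ` J). case t of None \<Rightarrow> 0 | Some s \<Rightarrow> y s \<omega>)" for \<omega>
    by (simp add: image_image)
  have "(\<lambda>\<omega>. MAX t\<in>insert None (Some ` J). case t of None \<Rightarrow> 0 | Some s \<Rightarrow> y s \<omega>) \<in> borel_measurable M"
    using assms by (intro borel_measurable_Max) auto
  moreover have "(\<lambda>\<omega>. (\<Sum>s\<in>J. y s \<omega> powr real_of_ereal p) powr (1 / real_of_ereal p)) \<in> borel_measurable M"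
    using assms by measurable
  ultimately show ?thesis
    unfolding coordinate_norm_def eq by (cases "p = \<infinity>") (simp_all only: refl if_True if_False)
qed

section \<open>Laws on path space\<close>

text \<open>The events by which laws on path space are compared: they form a \<open>\<pi>\<close>-system that generates the
  \<open>\<sigma>\<close>-algebra, and their probabilities are explicit for all processes considered here.\<close>

definition lower_orthant :: "'s set \<Rightarrow> ('s \<Rightarrow> real) \<Rightarrow> ('s \<Rightarrow> real) set"
  where "lower_orthant J x = {z. \<forall>s\<in>J. z s \<le> x s}"

lemma space_path_space [simp]: "space path_space = UNIV"
  by (simp add: path_space_def space_PiM)

lemma measurable_path_coordinate [measurable]: "(\<lambda>z. z s) \<in> borel_measurable path_space"
  unfolding path_space_def by simp

lemma measurable_path_spaceI:
  assumes "\<And>s. (\<lambda>\<omega>. f \<omega> s) \<in> borel_measurable M"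
  shows "f \<in> measurable M path_space"
  unfolding path_space_def by (rule measurable_PiM_single') (use assms in \<open>auto\<close>)

lemma sets_lower_orthant [measurable]:
  assumes "finite J" shows "lower_orthant J x \<in> sets path_space"
proof -
  have "{z\<in>space path_space. \<forall>s\<in>J. z s \<le> x s} \<in> sets path_space"
    using assms by measurable
  then show ?thesis by (simp add: lower_orthant_def)
qed

lemma sets_path_space_eq:
  "sets path_space = sigma_sets UNIV {lower_orthant J x |J x. finite J}"
proof (rule antisym)
  let ?G = "{lower_orthant J x |J (x :: 's \<Rightarrow> real). finite J}"
  let ?N = "sigma UNIV ?G"
  have "(\<lambda>z. z s) \<in> borel_measurable ?N" for s
  proof (subst borel_measurable_iff_le, intro allI)
    fix a :: real
    have "{w \<in> space ?N. w s \<le> a} = lower_orthant {s} (\<lambda>_. a)"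
      by (auto simp: lower_orthant_def)
    also have "\<dots> \<in> ?G" by blast
    finally show "{w \<in> space ?N. w s \<le> a} \<in> sets ?N" by (simp add: sigma_sets.Basic)
  qed
  then have "(\<lambda>z. z) \<in> measurable ?N path_space"
    by (rule measurable_path_spaceI)
  then have "A \<in> sets ?N" if "A \<in> sets path_space" for A
    using measurable_sets[OF _ that, of "\<lambda>z. z" ?N] by simp
  then show "sets path_space \<subseteq> sigma_sets UNIV ?G" by auto
next
  show "sigma_sets UNIV {lower_orthant J x |J (x :: 's \<Rightarrow> real). finite J} \<subseteq> sets path_space"
    using sets.sigma_sets_subset[of "{lower_orthant J x |J (x :: 's \<Rightarrow> real). finite J}" path_space]
      sets_lower_orthant by fastforce
qed

lemma lower_orthant_Int:
  "lower_orthant J x \<inter> lower_orthant K y =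
   lower_orthant (J \<union> K) (\<lambda>s. if s \<in> J \<inter> K then min (x s) (y s) else if s \<in> J then x s else y s)"
  by (auto simp: lower_orthant_def split: if_splits)

lemma Int_stable_lower_orthants: "Int_stable {lower_orthant J x |J x. finite J}"
  by (auto simp: Int_stable_def lower_orthant_Int) (metis finite_UnI)

lemma finite_path_measure_eqI:
  assumes "finite_measure L" "finite_measure L'" "sets L = sets path_space" "sets L' = sets path_space"
    and "\<And>J x. finite J \<Longrightarrow> measure L (lower_orthant J x) = measure L' (lower_orthant J x)"
  shows "L = L'"
proof -
  interpret L: finite_measure L by fact
  interpret L': finite_measure L' by fact
  show ?thesis
  proof (rule measure_eqI_generator_eq[OF Int_stable_lower_orthants, of UNIV _ _ "\<lambda>_. UNIV"])
    show "range (\<lambda>_. UNIV) \<subseteq> {lower_orthant J x |J (x :: 'a \<Rightarrow> real). finite J}"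
      by (auto simp: lower_orthant_def intro!: exI[of _ "{}"])
  qed (use assms in \<open>auto simp: sets_path_space_eq L.emeasure_eq_measure L'.emeasure_eq_measure\<close>)
qed

lemma sets_path_law [simp]: "sets (path_law M Z) = sets path_space"
  by (simp add: path_law_def)

lemma space_path_law [simp]: "space (path_law M Z) = UNIV"
  by (simp add: path_law_def)

lemma measurable_path:
  assumes "\<And>s. Z s \<in> borel_measurable M" shows "(\<lambda>\<omega> s. Z s \<omega>) \<in> measurable M path_space"
  using assms by (rule measurable_path_spaceI)

lemma prob_space_path_law:
  assumes "prob_space M" "\<And>s. Z s \<in> borel_measurable M"
  shows "prob_space (path_law M Z)"
  unfolding path_law_def by (rule prob_space.prob_space_distr[OF assms(1) measurable_path[OF assms(2)]])

lemma measure_path_law_orthant: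
  assumes "\<And>s. Z s \<in> borel_measurable M" "finite J"
  shows "measure (path_law M Z) (lower_orthant J x) = measure M {\<omega> \<in> space M. \<forall>s\<in>J. Z s \<omega> \<le> x s}"
  unfolding path_law_def
  by (subst measure_distr[OF measurable_path[OF assms(1)] sets_lower_orthant[OF assms(2)]])
     (auto simp: lower_orthant_def intro!: arg_cong[where f="measure M"])

lemma same_fdd_orthant:
  assumes "same_fdd M X N Y" "\<And>s. X s \<in> borel_measurable M" "\<And>s. Y s \<in> borel_measurable N" "finite J"
  shows "measure M {\<omega> \<in> space M. \<forall>s\<in>J. X s \<omega> \<le> x s} = measure N {\<omega> \<in> space N. \<forall>s\<in>J. Y s \<omega> \<le> x s}"
proof -
  let ?B = "Pi\<^sub>E J (\<lambda>s. {..x s})"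
  have B: "?B \<in> sets (\<Pi>\<^sub>M s\<in>J. borel)" using assms(4) by (intro sets_PiM_I_finite) auto
  have "measure (distr K (\<Pi>\<^sub>M s\<in>J. borel) (\<lambda>\<omega>. \<lambda>s\<in>J. V s \<omega>)) ?B
      = measure K {\<omega> \<in> space K. \<forall>s\<in>J. V s \<omega> \<le> x s}"
    if V: "\<And>s. V s \<in> borel_measurable K" for K :: "'z measure" and V
  proof (subst measure_distr[OF _ B])
    show "(\<lambda>\<omega>. \<lambda>s\<in>J. V s \<omega>) \<in> measurable K (\<Pi>\<^sub>M s\<in>J. borel)"
      using V by measurable
  qed (auto intro!: arg_cong[where f="measure K"])
  from this[of X M] this[of Y N] show ?thesis
    using assms by (simp add: same_fdd_def)
qed

lemma same_fdd_path_law: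
  assumes "same_fdd M X N Y" "prob_space M" "prob_space N"
    "\<And>s. X s \<in> borel_measurable M" "\<And>s. Y s \<in> borel_measurable N"
  shows "path_law M X = path_law N Y"
  by (rule finite_path_measure_eqI)
     (use assms in \<open>auto simp: prob_space.finite_measure[OF prob_space_path_law] measure_path_law_orthant
        same_fdd_orthant[OF assms(1)]\<close>)

section \<open>The Laplace functional of a Poisson process\<close>

definition natural_part :: "ennreal \<Rightarrow> nat"
  where "natural_part y = nat \<lfloor>enn2real y\<rfloor>"

lemma natural_part_of_nat [simp]: "natural_part (of_nat k) = k"
  by (simp add: natural_part_def)

lemma measurable_natural_part [measurable]: "natural_part \<in> measurable borel (count_space UNIV)"
  unfolding natural_part_def by measurable

lemma point_count_cases: "point_count A B \<omega> = \<infinity> \<or> (\<exists>k. point_count A B \<omega> = of_nat k)"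
  unfolding point_count_def by (cases "finite {i. A i \<omega> \<in> B}") auto

lemma poisson_generating_function:
  fixes N :: "'a \<Rightarrow> ennreal"
  assumes "prob_space M" and N: "has_poisson_distribution M N r" and [measurable]: "N \<in> borel_measurable M"
    and cases: "\<And>\<omega>. N \<omega> = \<infinity> \<or> (\<exists>k. N \<omega> = of_nat k)"
    and r: "r < \<infinity>" and g: "0 \<le> g" "g \<le> 1"
  shows "AE \<omega> in M. N \<omega> < \<infinity>"
    and "(\<integral>\<omega>. g ^ natural_part (N \<omega>) \<partial>M) = exp (- (enn2real r * (1 - g)))"
proof -
  interpret prob_space M by fact
  let ?B = "\<lambda>k::nat. {\<omega>\<in>space M. N \<omega> = of_nat k}"
  have B [measurable]: "?B k \<in> sets M" for k by measurable
  have pB: "measure M (?B k) = exp (- enn2real r) * enn2real r ^ k / fact k" for k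
    using N r by (simp add: has_poisson_distribution_def)
  have exp_sums: "(\<lambda>k. c ^ k / fact k) sums exp c" for c :: real
    using exp_converges[of c] by (simp add: field_simps)
  have "(\<lambda>k. measure M (?B k)) sums measure M (\<Union>k. ?B k)"
    by (rule finite_measure_UNION) (auto simp: disjoint_family_on_def)
  moreover have "(\<lambda>k. measure M (?B k)) sums (exp (- enn2real r) * exp (enn2real r))"
    unfolding pB using sums_mult[OF exp_sums] by (simp add: mult.assoc)
  ultimately have "measure M (\<Union>k. ?B k) = 1"
    using sums_unique2 by (fastforce simp: exp_minus)
  then have AE: "AE \<omega> in M. \<exists>k. N \<omega> = of_nat k"
    by (subst (asm) prob_eq_1) auto
  then show "AE \<omega> in M. N \<omega> < \<infinity>"
    by eventually_elim (auto simp: of_nat_less_top)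
  let ?f = "\<lambda>k \<omega>. g ^ k * indicator (?B k) \<omega>"
  have single: "?f k \<omega> = (if k = natural_part (N \<omega>) then g ^ k else 0)"
    if "N \<omega> = of_nat j" "\<omega> \<in> space M" for \<omega> j k
    using that by (auto simp: indicator_def)
  have sum1: "(\<lambda>k. ?f k \<omega>) sums g ^ natural_part (N \<omega>)" if "N \<omega> = of_nat j" "\<omega> \<in> space M" for \<omega> j
    unfolding single[OF that]
    using sums_single[of "natural_part (N \<omega>)" "\<lambda>k. g ^ k"] by simp
  have int: "(\<integral>\<omega>. ?f k \<omega> \<partial>M) = exp (- enn2real r) * ((g * enn2real r) ^ k / fact k)" for k
    by (simp add: pB power_mult_distrib)
  have "(\<lambda>k. \<integral>\<omega>. ?f k \<omega> \<partial>M) sums (\<integral>\<omega>. (\<Sum>k. ?f k \<omega>) \<partial>M)"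
  proof (rule sums_integral)
    show "integrable M (?f k)" for k by (auto intro!: integrable_real_indicator simp: less_top[symmetric])
    show "AE \<omega> in M. summable (\<lambda>k. norm (?f k \<omega>))"
      using AE AE_space
    proof eventually_elim
      case (elim \<omega>)
      then obtain j where "N \<omega> = of_nat j" by auto
      from sums_summable[OF sum1[OF this \<open>\<omega> \<in> space M\<close>]] show ?case using g by (simp add: abs_mult)
    qed
    have "(\<integral>\<omega>. norm (?f k \<omega>) \<partial>M) = (\<integral>\<omega>. ?f k \<omega> \<partial>M)" for k
      using g by (intro Bochner_Integration.integral_cong) auto
    then show "summable (\<lambda>k. \<integral>\<omega>. norm (?f k \<omega>) \<partial>M)"
      using sums_summable[OF sums_mult[OF exp_sums, of "exp (- enn2real r)" "g * enn2real r"]]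
      unfolding int by simp
  qed
  moreover have "(\<lambda>k. \<integral>\<omega>. ?f k \<omega> \<partial>M) sums (exp (- enn2real r) * exp (g * enn2real r))"
    unfolding int by (intro sums_mult exp_sums)
  ultimately have "(\<integral>\<omega>. (\<Sum>k. ?f k \<omega>) \<partial>M) = exp (- enn2real r) * exp (g * enn2real r)"
    by (rule sums_unique2)
  also have "\<dots> = exp (- (enn2real r * (1 - g)))"
    by (simp add: exp_add[symmetric] algebra_simps)
  also have "(\<integral>\<omega>. (\<Sum>k. ?f k \<omega>) \<partial>M) = (\<integral>\<omega>. g ^ natural_part (N \<omega>) \<partial>M)"
  proof (rule integral_cong_AE)
    show "AE \<omega> in M. (\<Sum>k. ?f k \<omega>) = g ^ natural_part (N \<omega>)"
      using AE AE_space
    proof eventually_elim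
      case (elim \<omega>)
      then obtain j where "N \<omega> = of_nat j" by auto
      from sums_unique[OF sum1[OF this \<open>\<omega> \<in> space M\<close>]] show ?case by simp
    qed
  qed measurable
  finally show "(\<integral>\<omega>. g ^ natural_part (N \<omega>) \<partial>M) = exp (- (enn2real r * (1 - g)))" .
qed

lemma norm_prod_le_one:
  fixes f :: "'i \<Rightarrow> real"
  assumes "\<And>i. 0 \<le> f i \<and> f i \<le> 1"
  shows "norm (\<Prod>i\<in>I. f i) \<le> 1"
  using assms by (simp add: prod_nonneg prod_le_1)

text \<open>The level sets of \<open>u\<close> outside \<open>0\<close> have finite intensity, hence almost surely only finitely many
  points lie in them and the product is eventually a finite product of powers, one for each level,
  with independent Poisson exponents.\<close>

lemma poisson_functional_simple:
  assumes "prob_space M" and pp: "poisson_process_points M \<mu> A"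
    and u: "simple_function \<mu> u" and u01: "\<And>a. a \<in> space \<mu> \<Longrightarrow> 0 \<le> u a \<and> u a \<le> 1"
    and fin: "(\<integral>\<^sup>+a. ennreal (u a) \<partial>\<mu>) < \<infinity>"
  shows "(\<lambda>n. \<integral>\<omega>. (\<Prod>i<n. 1 - u (A i \<omega>)) \<partial>M) \<longlonglongrightarrow> exp (- enn2real (\<integral>\<^sup>+a. ennreal (u a) \<partial>\<mu>))"
proof -
  interpret prob_space M by fact
  have A [measurable]: "A i \<in> measurable M \<mu>" for i
    using pp by (simp add: poisson_process_points_def)
  have [measurable]: "u \<in> borel_measurable \<mu>" using u by (rule borel_measurable_simple_function)
  define V where "V = u ` space \<mu> - {0}"
  define B where "B v = u -` {v} \<inter> space \<mu>" for v
  have V: "finite V" using u by (auto simp: V_def simple_function_def)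
  have V01: "0 < v" "v \<le> 1" if "v \<in> V" for v
    using that u01 by (force simp: V_def)+
  have B [measurable]: "B v \<in> sets \<mu>" for v
    unfolding B_def by measurable
  have ind: "indep_vars (\<lambda>_. borel) (point_count A) \<B>" if "finite \<B>" "\<B> \<subseteq> sets \<mu>" "disjoint \<B>" for \<B>
    using pp that by (simp add: poisson_process_points_def)
  have cnt [measurable]: "point_count A (B v) \<in> borel_measurable M" for v
    using ind[of "{B v}"] by (auto simp: indep_vars_def)
  have inj: "inj_on B V" by (auto simp: inj_on_def B_def V_def)
  have dis: "disjoint_family_on B V" by (auto simp: disjoint_family_on_def B_def)
  have usum: "ennreal (u a) = (\<Sum>v\<in>V. ennreal v * indicator (B v) a)" if "a \<in> space \<mu>" for a
  proof (cases "u a = 0")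
    case True
    then have "indicator (B v) a = (0::ennreal)" if "v \<in> V" for v
      using that by (auto simp: B_def V_def)
    then show ?thesis using True by simp
  next
    case False
    then have "u a \<in> V" using that by (auto simp: V_def)
    have "(\<Sum>v\<in>V. ennreal v * indicator (B v) a) = (\<Sum>v\<in>{u a}. ennreal v * indicator (B v) a)"
      using \<open>u a \<in> V\<close> V by (intro sum.mono_neutral_right) (auto simp: B_def)
    then show ?thesis using that by (simp add: B_def)
  qed
  have I: "(\<integral>\<^sup>+a. ennreal (u a) \<partial>\<mu>) = (\<Sum>v\<in>V. ennreal v * emeasure \<mu> (B v))"
    by (subst nn_integral_cong[OF usum]) (simp_all add: nn_integral_sum nn_integral_cmult_indicator)
  have finB: "emeasure \<mu> (B v) < \<infinity>" if "v \<in> V" for v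
  proof -
    have "ennreal v * emeasure \<mu> (B v) \<le> (\<Sum>v\<in>V. ennreal v * emeasure \<mu> (B v))"
      using V that by (intro member_le_sum) auto
    then have "ennreal v * emeasure \<mu> (B v) < \<infinity>"
      using fin unfolding I by (rule le_less_trans)
    then show ?thesis using V01[OF that] by (auto simp: ennreal_mult_less_top)
  qed
  have po: "has_poisson_distribution M (point_count A (B v)) (emeasure \<mu> (B v))" for v
    using pp B by (simp add: poisson_process_points_def)
  note gf = poisson_generating_function[OF \<open>prob_space M\<close> po cnt point_count_cases finB]
  have AEfin: "AE \<omega> in M. \<forall>v\<in>V. point_count A (B v) \<omega> < \<infinity>"
    using V gf(1)[of _ 0] by (simp add: AE_finite_all)
  let ?Y = "\<lambda>v \<omega>. (1 - v) ^ natural_part (point_count A (B v) \<omega>)"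
  have "(\<lambda>n. \<integral>\<omega>. (\<Prod>i<n. 1 - u (A i \<omega>)) \<partial>M) \<longlonglongrightarrow> (\<integral>\<omega>. (\<Prod>v\<in>V. ?Y v \<omega>) \<partial>M)"
  proof (rule integral_dominated_convergence[where w="\<lambda>_. 1"])
    show "AE \<omega> in M. (\<lambda>n. \<Prod>i<n. 1 - u (A i \<omega>)) \<longlonglongrightarrow> (\<Prod>v\<in>V. ?Y v \<omega>)"
      using AEfin AE_space
    proof eventually_elim
      case (elim \<omega>)
      define S where "S v = {i. A i \<omega> \<in> B v}" for v
      have S: "finite (S v)" if "v \<in> V" for v
      proof (rule ccontr)
        assume "infinite (S v)"
        then have "point_count A (B v) \<omega> = \<infinity>" by (simp add: point_count_def S_def)
        with elim(1) that show False by auto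
      qed
      have ct: "natural_part (point_count A (B v) \<omega>) = card (S v)" if "v \<in> V" for v
      proof -
        have "point_count A (B v) \<omega> = of_nat (card (S v))"
          using S[OF that] unfolding point_count_def S_def[symmetric]
          by (subst emeasure_count_space_finite) auto
        then show ?thesis by simp
      qed
      have Asp: "A i \<omega> \<in> space \<mu>" for i using measurable_space[OF A elim(2)] .
      have "(\<Prod>i<n. 1 - u (A i \<omega>)) = (\<Prod>v\<in>V. ?Y v \<omega>)" if n: "(\<Union>v\<in>V. S v) \<subseteq> {..<n}" for n
      proof -
        have "(\<Prod>i<n. 1 - u (A i \<omega>)) = (\<Prod>i\<in>(\<Union>v\<in>V. S v). 1 - u (A i \<omega>))"
          using n Asp by (intro prod.mono_neutral_right) (auto simp: S_def B_def V_def)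
        also have "\<dots> = (\<Prod>v\<in>V. \<Prod>i\<in>S v. 1 - u (A i \<omega>))"
          using V S by (intro prod.UNION_disjoint) (auto simp: S_def B_def)
        also have "\<dots> = (\<Prod>v\<in>V. \<Prod>i\<in>S v. 1 - v)"
          by (intro prod.cong refl) (auto simp: S_def B_def)
        also have "\<dots> = (\<Prod>v\<in>V. ?Y v \<omega>)"
          by (intro prod.cong refl) (simp add: ct)
        finally show ?thesis .
      qed
      moreover have "\<forall>\<^sub>F n in sequentially. (\<Union>v\<in>V. S v) \<subseteq> {..<n}"
      proof -
        obtain m where "(\<Union>v\<in>V. S v) \<subseteq> {..<m}"
          using V S by (meson finite_UN_I finite_nat_iff_bounded)
        then show ?thesis by (auto simp: eventually_sequentially intro!: exI[of _ m])
      qed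
      ultimately show ?case
        by (intro tendsto_eventually) (auto elim!: eventually_mono)
    qed
    show "AE \<omega> in M. norm (\<Prod>i<n. 1 - u (A i \<omega>)) \<le> 1" for n
      using AE_space
    proof eventually_elim
      case (elim \<omega>)
      have "0 \<le> u (A i \<omega>) \<and> u (A i \<omega>) \<le> 1" for i
        using u01 measurable_space[OF A elim] by blast
      then show ?case by (intro norm_prod_le_one) auto
    qed
  qed (use V in measurable)
  also have "(\<integral>\<omega>. (\<Prod>v\<in>V. ?Y v \<omega>) \<partial>M) = (\<Prod>v\<in>V. \<integral>\<omega>. ?Y v \<omega> \<partial>M)"
  proof -
    define val where "val = the_inv_into V B"
    have val: "val (B v) = v" if "v \<in> V" for v
      unfolding val_def by (rule the_inv_into_f_f[OF inj that])
    let ?Z = "\<lambda>b \<omega>. (1 - val b) ^ natural_part (point_count A b \<omega>)"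
    have "(\<integral>\<omega>. (\<Prod>b\<in>B ` V. ?Z b \<omega>) \<partial>M) = (\<Prod>b\<in>B ` V. \<integral>\<omega>. ?Z b \<omega> \<partial>M)"
    proof (rule indep_vars_lebesgue_integral)
      have "indep_vars (\<lambda>_. borel) (point_count A) (B ` V)"
        using V dis by (intro ind) (auto intro: disjoint_family_on_disjoint_image)
      then show "indep_vars (\<lambda>_. borel) ?Z (B ` V)"
        by (rule indep_vars_compose2[where Y="\<lambda>b y. (1 - val b) ^ natural_part y"]) measurable
      show "integrable M (?Z b)" if b: "b \<in> B ` V" for b
      proof -
        from b obtain v where v: "v \<in> V" "b = B v" by auto
        show ?thesis using V01[OF v(1)] unfolding v(2) val[OF v(1)]
          by (intro integrable_const_bound[of _ 1]) (auto simp: power_le_one power_abs)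
      qed
    qed (use V in simp)
    then show ?thesis by (simp add: prod.reindex[OF inj] val)
  qed
  also have "\<dots> = (\<Prod>v\<in>V. exp (- (enn2real (emeasure \<mu> (B v)) * (1 - (1 - v)))))"
    using V01 by (intro prod.cong refl gf(2)) (auto simp: less_imp_le)
  also have "\<dots> = exp (- (\<Sum>v\<in>V. enn2real (emeasure \<mu> (B v)) * v))"
    using V by (simp add: exp_sum[symmetric] sum_negf)
  also have "(\<Sum>v\<in>V. enn2real (emeasure \<mu> (B v)) * v) = enn2real (\<integral>\<^sup>+a. ennreal (u a) \<partial>\<mu>)"
    unfolding I using V01 finB
    by (subst enn2real_sum) (auto simp: enn2real_mult ennreal_mult_less_top less_imp_le mult.commute intro!: sum.cong)
  finally show ?thesis .
qed

text \<open>The expectations decrease in \<open>n\<close>. Simple functions \<open>u k\<close> increasing to \<open>1 - G\<close> squeeze them: for fixed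
  \<open>n\<close> the limit \<open>k \<longrightarrow> \<infinity>\<close> gives the lower bound, for fixed \<open>k\<close> the limit \<open>n \<longrightarrow> \<infinity>\<close> gives the upper one.\<close>

lemma poisson_functional:
  assumes "prob_space M" and pp: "poisson_process_points M \<mu> A"
    and [measurable]: "G \<in> borel_measurable \<mu>" and G01: "\<And>a. a \<in> space \<mu> \<Longrightarrow> 0 \<le> G a \<and> G a \<le> 1"
    and fin: "(\<integral>\<^sup>+a. ennreal (1 - G a) \<partial>\<mu>) < \<infinity>"
  shows "(\<lambda>n. \<integral>\<omega>. (\<Prod>i<n. G (A i \<omega>)) \<partial>M) \<longlonglongrightarrow> exp (- enn2real (\<integral>\<^sup>+a. ennreal (1 - G a) \<partial>\<mu>))"
proof -
  interpret prob_space M by fact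
  have A [measurable]: "A i \<in> measurable M \<mu>" for i
    using pp by (simp add: poisson_process_points_def)
  let ?I = "enn2real (\<integral>\<^sup>+a. ennreal (1 - G a) \<partial>\<mu>)"
  have "(\<lambda>a. max 0 (1 - G a)) \<in> borel_measurable \<mu>" by measurable
  from borel_measurable_implies_simple_function_sequence_real[OF this]
  obtain u where u: "incseq u" "\<And>k. simple_function \<mu> (u k)" "\<And>a. bdd_above (range (\<lambda>k. u k a))"
    "\<And>k a. 0 \<le> u k a" "(\<lambda>a. max 0 (1 - G a)) = (SUP k. u k)"
    by auto
  have [measurable]: "u k \<in> borel_measurable \<mu>" for k using u(2) by (rule borel_measurable_simple_function)
  have usup: "max 0 (1 - G a) = (SUP k. u k a)" for a
    using fun_cong[OF u(5), of a] by (simp add: image_comp)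
  have ulim: "(\<lambda>k. u k a) \<longlonglongrightarrow> 1 - G a" if "a \<in> space \<mu>" for a
  proof -
    have "(\<lambda>k. u k a) \<longlonglongrightarrow> (SUP k. u k a)"
      using u(1,3) by (intro LIMSEQ_incseq_SUP) (auto simp: mono_def le_fun_def)
    then show ?thesis using G01[OF that] by (simp add: usup[symmetric] max_def split: if_splits)
  qed
  have ule: "u k a \<le> 1 - G a" if "a \<in> space \<mu>" for k a
    using incseq_le[OF _ ulim[OF that]] u(1) by (auto simp: mono_def le_fun_def)
  have u01: "0 \<le> u k a \<and> u k a \<le> 1" if "a \<in> space \<mu>" for k a
    using ule[OF that, of k] G01[OF that] u(4)[of k a] by auto
  define I where "I k = enn2real (\<integral>\<^sup>+a. ennreal (u k a) \<partial>\<mu>)" for k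
  have nle: "(\<integral>\<^sup>+a. ennreal (u k a) \<partial>\<mu>) \<le> (\<integral>\<^sup>+a. ennreal (1 - G a) \<partial>\<mu>)" for k
    by (intro nn_integral_mono ennreal_leI ule)
  then have fink: "(\<integral>\<^sup>+a. ennreal (u k a) \<partial>\<mu>) < \<infinity>" for k using fin by (metis le_less_trans)
  have "(\<lambda>k. \<integral>\<^sup>+a. ennreal (u k a) \<partial>\<mu>) \<longlonglongrightarrow> (\<integral>\<^sup>+a. ennreal (max 0 (1 - G a)) \<partial>\<mu>)"
  proof (rule nn_integral_LIMSEQ)
    show "incseq (\<lambda>k a. ennreal (u k a))"
      using u(1) by (auto simp: mono_def le_fun_def intro!: ennreal_leI)
    show "(\<lambda>k. ennreal (u k a)) \<longlonglongrightarrow> ennreal (max 0 (1 - G a))" for a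
      using LIMSEQ_incseq_SUP[of "\<lambda>k. u k a"] u(1,3)
      by (intro tendsto_ennrealI) (auto simp: usup mono_def le_fun_def)
  qed measurable
  also have "(\<integral>\<^sup>+a. ennreal (max 0 (1 - G a)) \<partial>\<mu>) = (\<integral>\<^sup>+a. ennreal (1 - G a) \<partial>\<mu>)"
    by (simp add: ennreal_max_0)
  finally have Ilim: "I \<longlonglongrightarrow> ?I" unfolding I_def using fin by (intro tendsto_enn2real) auto
  have Asp: "A i \<omega> \<in> space \<mu>" if "\<omega> \<in> space M" for i \<omega> using measurable_space[OF A that] .
  define b where "b k n = (\<integral>\<omega>. (\<Prod>i<n. 1 - u k (A i \<omega>)) \<partial>M)" for k n
  define a where "a n = (\<integral>\<omega>. (\<Prod>i<n. G (A i \<omega>)) \<partial>M)" for n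
  have intb: "integrable M (\<lambda>\<omega>. \<Prod>i<n. 1 - u k (A i \<omega>))" for k n
    using u01 Asp by (intro integrable_const_bound[of _ 1] AE_I2 norm_prod_le_one) auto
  have inta: "integrable M (\<lambda>\<omega>. \<Prod>i<n. G (A i \<omega>))" for n
    using G01 Asp by (intro integrable_const_bound[of _ 1] AE_I2 norm_prod_le_one) auto
  have blim: "b k \<longlonglongrightarrow> exp (- I k)" for k
    unfolding b_def I_def by (rule poisson_functional_simple[OF \<open>prob_space M\<close> pp u(2) u01 fink])
  have "decseq (b k)" for k
    unfolding b_def
  proof (intro decseq_SucI integral_mono intb)
    fix n \<omega> assume "\<omega> \<in> space M"
    then have "0 \<le> u k (A i \<omega>) \<and> u k (A i \<omega>) \<le> 1" for i by (intro u01 Asp)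
    then have "0 \<le> (\<Prod>i<n. 1 - u k (A i \<omega>))" "1 - u k (A n \<omega>) \<le> 1" by (auto intro!: prod_nonneg)
    from mult_left_le[OF this(2,1)] show "(\<Prod>i<Suc n. 1 - u k (A i \<omega>)) \<le> (\<Prod>i<n. 1 - u k (A i \<omega>))"
      by simp
  qed
  then have "exp (- I k) \<le> b k n" for k n using blim by (rule decseq_ge)
  moreover have "(\<lambda>k. b k n) \<longlonglongrightarrow> a n" for n
    unfolding a_def b_def
  proof (rule integral_dominated_convergence[where w="\<lambda>_. 1"])
    show "AE \<omega> in M. (\<lambda>k. \<Prod>i<n. 1 - u k (A i \<omega>)) \<longlonglongrightarrow> (\<Prod>i<n. G (A i \<omega>))"
      using AE_space
    proof eventually_elim
      case (elim \<omega>)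
      have "(\<lambda>k. \<Prod>i<n. 1 - u k (A i \<omega>)) \<longlonglongrightarrow> (\<Prod>i<n. 1 - (1 - G (A i \<omega>)))"
        using elim by (intro tendsto_intros ulim Asp)
      then show ?case by simp
    qed
    show "AE \<omega> in M. norm (\<Prod>i<n. 1 - u k (A i \<omega>)) \<le> 1" for k
      using u01 Asp by (intro AE_I2 norm_prod_le_one) auto
  qed measurable
  moreover have "(\<lambda>k. exp (- I k)) \<longlonglongrightarrow> exp (- ?I)" by (intro tendsto_intros Ilim)
  ultimately have lower: "exp (- ?I) \<le> a n" for n
    by (intro LIMSEQ_le[of "\<lambda>k. exp (- I k)" _ "\<lambda>k. b k n"]) auto
  have upper: "a n \<le> b k n" for k n
    unfolding a_def b_def
    by (intro integral_mono inta intb prod_mono) (use G01 Asp ule in \<open>auto simp: field_simps\<close>)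
  show ?thesis unfolding a_def[symmetric]
  proof (rule LIMSEQ_I)
    fix e :: real assume "0 < e"
    then have "0 < e / 2" by simp
    from LIMSEQ_D[OF \<open>(\<lambda>k. exp (- I k)) \<longlonglongrightarrow> exp (- ?I)\<close> this]
    obtain k where k: "\<bar>exp (- I k) - exp (- ?I)\<bar> < e / 2" by auto
    from LIMSEQ_D[OF blim \<open>0 < e / 2\<close>] obtain n0 where n0: "\<And>n. n \<ge> n0 \<Longrightarrow> \<bar>b k n - exp (- I k)\<bar> < e / 2"
      by auto
    have "norm (a n - exp (- ?I)) < e" if "n \<ge> n0" for n
      using n0[OF that] k lower[of n] upper[of n k] unfolding real_norm_def by linarith
    then show "\<exists>no. \<forall>n\<ge>no. norm (a n - exp (- ?I)) < e" by blast
  qed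
qed

section \<open>Marked Poisson processes with intensity inverse-square\<close>

lemma measurable_inverse_square_measure [measurable_cong]:
  "sets inverse_square_measure = sets (restrict_space borel {0<..})"
  by (simp add: inverse_square_measure_def sets_restrict_space)

lemma space_inverse_square_measure [simp]: "space inverse_square_measure = {0<..}"
  by (simp add: inverse_square_measure_def space_restrict_space)

lemma borel_measurable_inverse_square:
  "f \<in> borel_measurable borel \<Longrightarrow> f \<in> borel_measurable inverse_square_measure"
  by (simp add: measurable_cong_sets[OF measurable_inverse_square_measure refl] measurable_restrict_space1)

lemma nn_integral_inverse_square:
  assumes [measurable]: "f \<in> borel_measurable borel"
  shows "(\<integral>\<^sup>+a. f a \<partial>inverse_square_measure) = (\<integral>\<^sup>+a. ennreal (1 / a\<^sup>2) * f a * indicator {0<..} a \<partial>lborel)"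
  unfolding inverse_square_measure_def
  by (subst nn_integral_density) (auto simp: nn_integral_restrict_space intro!: measurable_restrict_space1)

lemma inverse_square_tail:
  "emeasure inverse_square_measure {a. 0 < a \<and> 1 < a * v} = ennreal v"
proof (cases "0 < v")
  case False
  then have "a * v \<le> 0" if "0 < a" for a using that by (simp add: mult_nonneg_nonpos)
  then have empty: "{a. 0 < a \<and> 1 < a * v} = {}" by (force simp: not_less)
  show ?thesis unfolding empty using False by (simp add: ennreal_neg)
next
  case True
  have pos: "0 < 1 / v" using True by simp
  have "1 < a * v \<longleftrightarrow> 1 / v < a" for a using pos_divide_less_eq[OF True] by simp
  then have eq: "{a. 0 < a \<and> 1 < a * v} = {1/v<..}"
    using pos by (auto intro: less_trans[OF pos])
  have "emeasure inverse_square_measure {1/v<..} = (\<integral>\<^sup>+a. indicator {1/v<..} a \<partial>inverse_square_measure)"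
  proof (rule nn_integral_indicator[symmetric])
    have "{1/v<..} = {0<..} \<inter> {1/v<..}" using pos by (auto intro: less_trans[OF pos])
    then show "{1/v<..} \<in> sets inverse_square_measure"
      unfolding measurable_inverse_square_measure sets_restrict_space by (intro image_eqI[of _ _ "{1/v<..}"]) auto
  qed
  also have "\<dots> = (\<integral>\<^sup>+a. ennreal (1 / a\<^sup>2) * indicator {1/v<..} a * indicator {0<..} a \<partial>lborel)"
    by (rule nn_integral_inverse_square) simp
  also have "\<dots> = (\<integral>\<^sup>+a. ennreal (1 / a\<^sup>2) * indicator {1/v..} a \<partial>lborel)"
  proof (rule nn_integral_cong_AE)
    show "AE a in lborel. ennreal (1 / a\<^sup>2) * indicator {1/v<..} a * indicator {0<..} a
        = ennreal (1 / a\<^sup>2) * indicator {1/v..} a"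
      using AE_lborel_singleton[of "1/v"]
    proof eventually_elim
      case (elim a)
      have "1 / v < a \<Longrightarrow> 0 < a" using pos by linarith
      with elim show ?case by (auto simp: indicator_def simp del: divide_less_eq less_divide_eq)
    qed
  qed
  also have "\<dots> = ennreal (0 - (- 1 / (1/v)))"
  proof (rule nn_integral_FTC_atLeast)
    show "DERIV (\<lambda>x. - 1 / x) a :> 1 / a\<^sup>2" if "1/v \<le> a" for a
    proof -
      have "a \<noteq> 0" using that pos by linarith
      then show ?thesis by (auto intro!: derivative_eq_intros simp: power2_eq_square)
    qed
    show "((\<lambda>x. - 1 / x) \<longlongrightarrow> (0::real)) at_top"
      by (rule tendsto_divide_0[OF tendsto_const]) (simp add: filterlim_at_top_imp_at_infinity filterlim_ident)
  qed auto
  finally show ?thesis unfolding eq by simp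
qed

lemma sigma_finite_inverse_square: "sigma_finite_measure inverse_square_measure"
proof
  let ?T = "\<lambda>n::nat. {a::real. 0 < a \<and> 1 < a * real n}"
  have "?T n \<in> sets inverse_square_measure" for n
    unfolding measurable_inverse_square_measure sets_restrict_space
    by (rule image_eqI[of _ _ "{a. 1 < a * real n}"]) auto
  moreover have "\<exists>n::nat. 1 < a * real n" if "0 < a" for a :: real
    using reals_Archimedean3[OF that] by (auto simp: mult.commute)
  ultimately show "\<exists>\<A>. countable \<A> \<and> \<A> \<subseteq> sets inverse_square_measure \<and>
      \<Union>\<A> = space inverse_square_measure \<and> (\<forall>a\<in>\<A>. emeasure inverse_square_measure a \<noteq> \<infinity>)"
    by (intro exI[of _ "range ?T"]) (auto simp: inverse_square_tail)
qed

text \<open>Fubini's theorem for the tail \<open>inverse_square_tail\<close>. It says that rescaling by the points of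
  intensity \<open>a\<^sup>-\<^sup>2 da\<close> turns the mass above level \<open>1\<close> into an expectation.\<close>

lemma nn_integral_layers:
  assumes "sigma_finite_measure N" and [measurable]: "Y \<in> borel_measurable N"
  shows "(\<integral>\<^sup>+a. (\<integral>\<^sup>+\<omega>. indicator {1<..} (a * Y \<omega>) \<partial>N) \<partial>inverse_square_measure) = (\<integral>\<^sup>+\<omega>. ennreal (Y \<omega>) \<partial>N)"
proof -
  interpret N: sigma_finite_measure N by fact
  interpret I: sigma_finite_measure inverse_square_measure by (rule sigma_finite_inverse_square)
  interpret IN: pair_sigma_finite inverse_square_measure N ..
  have [measurable]: "(\<lambda>a. a) \<in> borel_measurable inverse_square_measure"
    by (rule borel_measurable_inverse_square) simp
  have "(\<integral>\<^sup>+a. (\<integral>\<^sup>+\<omega>. indicator {1<..} (a * Y \<omega>) \<partial>N) \<partial>inverse_square_measure)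
      = (\<integral>\<^sup>+\<omega>. (\<integral>\<^sup>+a. indicator {1<..} (a * Y \<omega>) \<partial>inverse_square_measure) \<partial>N)"
    by (rule IN.Fubini'[symmetric]) measurable
  also have "\<dots> = (\<integral>\<^sup>+\<omega>. ennreal (Y \<omega>) \<partial>N)"
  proof (rule nn_integral_cong)
    fix \<omega>
    have "{a. 0 < a \<and> 1 < a * Y \<omega>} \<in> sets inverse_square_measure"
      unfolding measurable_inverse_square_measure sets_restrict_space
      by (rule image_eqI[of _ _ "{a. 1 < a * Y \<omega>}"]) auto
    then have "(\<integral>\<^sup>+a. indicator {a. 0 < a \<and> 1 < a * Y \<omega>} a \<partial>inverse_square_measure) = ennreal (Y \<omega>)"
      by (simp add: inverse_square_tail)
    also have "(\<integral>\<^sup>+a. indicator {a. 0 < a \<and> 1 < a * Y \<omega>} a \<partial>inverse_square_measure)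
        = (\<integral>\<^sup>+a. indicator {1<..} (a * Y \<omega>) \<partial>inverse_square_measure)"
      by (rule nn_integral_cong) (auto simp: indicator_def)
    finally show "(\<integral>\<^sup>+a. indicator {1<..} (a * Y \<omega>) \<partial>inverse_square_measure) = ennreal (Y \<omega>)" .
  qed
  finally show ?thesis .
qed

text \<open>The joint law of points and marks is required to be a product in the form that Fubini's theorem
  uses.\<close>

locale marked_poisson_process = prob_space M
  for M :: "'a measure" and A :: "nat \<Rightarrow> 'a \<Rightarrow> real" and W :: "nat \<Rightarrow> 's \<Rightarrow> 'a \<Rightarrow> real"
    and L :: "('s \<Rightarrow> real) measure" +
  assumes poisson: "poisson_process_points M inverse_square_measure A"
    and marks_indep: "indep_vars (\<lambda>_. path_space) (\<lambda>i \<omega> s. W i s \<omega>) UNIV"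
    and marks_law: "path_law M (W i) = L"
    and points_marks_indep:
      "distr M path_space (\<lambda>\<omega> i. A i \<omega>) \<Otimes>\<^sub>M distr M (\<Pi>\<^sub>M i\<in>UNIV. path_space) (\<lambda>\<omega> i s. W i s \<omega>)
       = distr M (path_space \<Otimes>\<^sub>M (\<Pi>\<^sub>M i\<in>UNIV. path_space)) (\<lambda>\<omega>. (\<lambda>i. A i \<omega>, \<lambda>i s. W i s \<omega>))"
begin

lemma measurable_mark [measurable]: "(\<lambda>\<omega> s. W i s \<omega>) \<in> measurable M path_space"
  using marks_indep by (auto simp: indep_vars_def)

lemma measurable_mark_coordinate [measurable]: "W i s \<in> borel_measurable M"
  using measurable_compose[OF measurable_mark measurable_path_coordinate] by simp

lemma measurable_marks [measurable]: "(\<lambda>\<omega> i s. W i s \<omega>) \<in> measurable M (\<Pi>\<^sub>M i\<in>UNIV. path_space)"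
  by (rule measurable_PiM_single') (auto simp: measurable_mark)

lemma measurable_point': "A i \<in> measurable M inverse_square_measure"
  using poisson by (simp add: poisson_process_points_def)

lemma measurable_point [measurable]: "A i \<in> borel_measurable M"
  using measurable_point'[of i]
  by (simp add: measurable_cong_sets[OF refl measurable_inverse_square_measure] measurable_restrict_space2_iff)

lemma measurable_points [measurable]: "(\<lambda>\<omega> i. A i \<omega>) \<in> measurable M path_space"
  by (rule measurable_path) measurable

lemma point_pos: "\<omega> \<in> space M \<Longrightarrow> 0 < A i \<omega>"
  using measurable_space[OF measurable_point'] by auto

lemma sets_L [measurable_cong]: "sets L = sets path_space"
  by (simp add: marks_law[of 0, symmetric])

lemma prob_space_L: "prob_space L"
  unfolding marks_law[of 0, symmetric] by (rule prob_space_path_law[OF prob_space_axioms]) measurable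

lemma integral_mark:
  fixes f :: "('s \<Rightarrow> real) \<Rightarrow> real"
  assumes "f \<in> borel_measurable path_space"
  shows "(\<integral>\<omega>. f (\<lambda>s. W i s \<omega>) \<partial>M) = (\<integral>z. f z \<partial>L)"
  unfolding marks_law[of i, symmetric] path_law_def
  by (rule integral_distr[symmetric]) (use assms in measurable)

text \<open>Integrating out the marks, which are independent of the points and of each other, replaces \<open>g\<close> by
  its mean over the mark and reduces the claim to the points alone.\<close>

lemma marked_poisson_functional:
  assumes g [measurable]: "case_prod g \<in> borel_measurable (borel \<Otimes>\<^sub>M path_space)"
    and g01: "\<And>a z. 0 \<le> g a z \<and> g a z \<le> 1"
    and fin: "(\<integral>\<^sup>+a. (\<integral>\<^sup>+z. ennreal (1 - g a z) \<partial>L) \<partial>inverse_square_measure) < \<infinity>"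
  shows "(\<lambda>n. \<integral>\<omega>. (\<Prod>i<n. g (A i \<omega>) (\<lambda>s. W i s \<omega>)) \<partial>M)
     \<longlonglongrightarrow> exp (- enn2real (\<integral>\<^sup>+a. (\<integral>\<^sup>+z. ennreal (1 - g a z) \<partial>L) \<partial>inverse_square_measure))"
proof -
  interpret L: prob_space L by (rule prob_space_L)
  define G where "G a = (\<integral>z. g a z \<partial>L)" for a
  have gm [measurable]: "g a \<in> borel_measurable path_space" for a
    using measurable_compose[OF measurable_Pair1' g, of a] by simp
  have intg: "integrable L (g a)" for a
    using g01 by (intro L.integrable_const_bound[of _ 1]) auto
  have [measurable]: "G \<in> borel_measurable borel"
    unfolding G_def by measurable
  have G01: "0 \<le> G a \<and> G a \<le> 1" for a
    unfolding G_def using g01 L.integral_le_const[OF intg, of a 1] by (auto intro!: integral_nonneg)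
  have eq: "(\<integral>\<^sup>+z. ennreal (1 - g a z) \<partial>L) = ennreal (1 - G a)" for a
    using intg g01 unfolding G_def by (subst nn_integral_eq_integral) (auto simp: L.prob_space)
  have Gm: "G \<in> borel_measurable inverse_square_measure"
    by (rule borel_measurable_inverse_square) measurable
  have lim: "(\<lambda>n. \<integral>\<omega>. (\<Prod>i<n. G (A i \<omega>)) \<partial>M)
      \<longlonglongrightarrow> exp (- enn2real (\<integral>\<^sup>+a. ennreal (1 - G a) \<partial>inverse_square_measure))"
    using fin G01 unfolding eq
    by (intro poisson_functional[OF prob_space_axioms poisson Gm]) auto
  have "(\<integral>\<omega>. (\<Prod>i<n. g (A i \<omega>) (\<lambda>s. W i s \<omega>)) \<partial>M) = (\<integral>\<omega>. (\<Prod>i<n. G (A i \<omega>)) \<partial>M)" for n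
  proof -
    let ?A = "\<lambda>\<omega> i. A i \<omega>" and ?W = "\<lambda>\<omega> i s. W i s \<omega>"
    let ?NA = "path_space :: (nat \<Rightarrow> real) measure" and ?NW = "(\<Pi>\<^sub>M i\<in>UNIV. path_space) :: (nat \<Rightarrow> 's \<Rightarrow> real) measure"
    let ?DA = "distr M ?NA ?A" and ?DW = "distr M ?NW ?W"
    let ?f = "\<lambda>(a, w). \<Prod>i<n. g (a i) (w i)"
    have fm [measurable]: "?f \<in> borel_measurable (?NA \<Otimes>\<^sub>M ?NW)"
    proof -
      have "(\<lambda>x. g (fst x i) (snd x i)) \<in> borel_measurable (?NA \<Otimes>\<^sub>M ?NW)" for i
      proof -
        have "(\<lambda>x. (fst x i, snd x i)) \<in> measurable (?NA \<Otimes>\<^sub>M ?NW) (borel \<Otimes>\<^sub>M path_space)"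
          by (intro measurable_Pair measurable_compose[OF measurable_fst measurable_path_coordinate]
              measurable_compose[OF measurable_snd measurable_component_singleton]) auto
        from measurable_compose[OF this g] show ?thesis by simp
      qed
      then show ?thesis by (simp add: case_prod_beta)
    qed
    have pDA: "prob_space ?DA" and pDW: "prob_space ?DW"
      by (auto intro!: prob_space_distr)
    interpret DA: prob_space ?DA by fact
    interpret DW: prob_space ?DW by fact
    interpret DAW: pair_prob_space ?DA ?DW ..
    have joint: "?DA \<Otimes>\<^sub>M ?DW = distr M (?NA \<Otimes>\<^sub>M ?NW) (\<lambda>\<omega>. (?A \<omega>, ?W \<omega>))"
      by (rule points_marks_indep)
    have "(\<integral>\<omega>. (\<Prod>i<n. g (A i \<omega>) (\<lambda>s. W i s \<omega>)) \<partial>M) = (\<integral>\<omega>. ?f (?A \<omega>, ?W \<omega>) \<partial>M)" by simp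
    also have "\<dots> = integral\<^sup>L (?DA \<Otimes>\<^sub>M ?DW) ?f"
      unfolding joint by (subst integral_distr) auto
    also have "\<dots> = (\<integral>a. (\<integral>w. ?f (a, w) \<partial>?DW) \<partial>?DA)"
    proof (rule DAW.integral_fst'[symmetric])
      have "?f \<in> borel_measurable (?DA \<Otimes>\<^sub>M ?DW)" by measurable
      then show "integrable (?DA \<Otimes>\<^sub>M ?DW) ?f"
        using g01 by (intro DAW.integrable_const_bound[of _ 1] AE_I2)
          (auto intro!: prod_le_1 simp: prod_nonneg)
    qed
    also have "(\<lambda>a. \<integral>w. ?f (a, w) \<partial>?DW) = (\<lambda>a. \<Prod>i<n. G (a i))"
    proof
      fix a :: "nat \<Rightarrow> real"
      have "(\<lambda>w. ?f (a, w)) \<in> borel_measurable ?NW"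
        using measurable_compose[OF measurable_Pair1' fm, of a] by simp
      then have "(\<integral>w. ?f (a, w) \<partial>?DW) = (\<integral>\<omega>. (\<Prod>i<n. g (a i) (\<lambda>s. W i s \<omega>)) \<partial>M)"
        by (subst integral_distr) auto
      also have "\<dots> = (\<Prod>i<n. \<integral>\<omega>. g (a i) (\<lambda>s. W i s \<omega>) \<partial>M)"
      proof (rule indep_vars_lebesgue_integral)
        show "indep_vars (\<lambda>_. borel) (\<lambda>i \<omega>. g (a i) (\<lambda>s. W i s \<omega>)) {..<n}"
          by (rule indep_vars_compose2[where Y="\<lambda>i. g (a i)", OF indep_vars_subset[OF marks_indep]]) auto
        show "integrable M (\<lambda>\<omega>. g (a i) (\<lambda>s. W i s \<omega>))" for i
          using g01 by (intro integrable_const_bound[of _ 1] AE_I2) auto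
      qed auto
      also have "\<dots> = (\<Prod>i<n. G (a i))"
        unfolding G_def by (intro prod.cong refl integral_mark) measurable
      finally show "(\<integral>w. ?f (a, w) \<partial>?DW) = (\<Prod>i<n. G (a i))" .
    qed
    also have "(\<integral>a. (\<Prod>i<n. G (a i)) \<partial>?DA) = (\<integral>\<omega>. (\<Prod>i<n. G (A i \<omega>)) \<partial>M)"
      by (subst integral_distr) auto
    finally show ?thesis .
  qed
  then show ?thesis using lim unfolding eq by simp
qed

text \<open>The void probability of the set of marked points with \<open>1 < a * h z\<close>.\<close>

lemma prob_no_point_above:
  assumes h [measurable]: "h \<in> borel_measurable path_space"
    and fin: "(\<integral>\<^sup>+z. ennreal (h z) \<partial>L) < \<infinity>"
  shows "prob {\<omega>\<in>space M. \<forall>i. A i \<omega> * h (\<lambda>s. W i s \<omega>) \<le> 1} = exp (- enn2real (\<integral>\<^sup>+z. ennreal (h z) \<partial>L))"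
proof -
  interpret L: prob_space L by (rule prob_space_L)
  let ?g = "\<lambda>a z. indicator {..1} (a * h z) :: real"
  have [measurable]: "case_prod ?g \<in> borel_measurable (borel \<Otimes>\<^sub>M path_space)"
    unfolding case_prod_beta by measurable
  have "ennreal (1 - ?g a z) = indicator {1<..} (a * h z)" for a z
    by (auto simp: indicator_def)
  then have int: "(\<integral>\<^sup>+a. (\<integral>\<^sup>+z. ennreal (1 - ?g a z) \<partial>L) \<partial>inverse_square_measure) = (\<integral>\<^sup>+z. ennreal (h z) \<partial>L)"
    by (simp add: nn_integral_layers[OF L.sigma_finite_measure_axioms])
  let ?E = "{\<omega>\<in>space M. \<forall>i. A i \<omega> * h (\<lambda>s. W i s \<omega>) \<le> 1}"
  have "(\<lambda>n. \<integral>\<omega>. (\<Prod>i<n. ?g (A i \<omega>) (\<lambda>s. W i s \<omega>)) \<partial>M) \<longlonglongrightarrow> (\<integral>\<omega>. indicator ?E \<omega> \<partial>M)"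
  proof (rule integral_dominated_convergence[where w="\<lambda>_. 1"])
    show "AE \<omega> in M. (\<lambda>n. \<Prod>i<n. ?g (A i \<omega>) (\<lambda>s. W i s \<omega>)) \<longlonglongrightarrow> indicator ?E \<omega>"
    proof (rule AE_I2)
      fix \<omega> assume \<omega>: "\<omega> \<in> space M"
      show "(\<lambda>n. \<Prod>i<n. ?g (A i \<omega>) (\<lambda>s. W i s \<omega>)) \<longlonglongrightarrow> indicator ?E \<omega>"
      proof (cases "\<omega> \<in> ?E")
        case False
        then obtain j where "\<not> A j \<omega> * h (\<lambda>s. W j s \<omega>) \<le> 1" using \<omega> by auto
        then have "(\<Prod>i<n. ?g (A i \<omega>) (\<lambda>s. W i s \<omega>)) = 0" if "n > j" for n
          using that by (intro prod_zero) (auto intro!: bexI[of _ j])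
        then have "\<forall>\<^sub>F n in sequentially. (\<Prod>i<n. ?g (A i \<omega>) (\<lambda>s. W i s \<omega>)) = indicator ?E \<omega>"
          using False by (intro eventually_mono[OF eventually_gt_at_top[of j]]) auto
        then show ?thesis by (rule tendsto_eventually)
      qed simp
    qed
    show "AE \<omega> in M. norm (\<Prod>i<n. ?g (A i \<omega>) (\<lambda>s. W i s \<omega>)) \<le> 1" for n
      by (intro AE_I2 norm_prod_le_one) auto
  qed measurable
  moreover have "(\<lambda>n. \<integral>\<omega>. (\<Prod>i<n. ?g (A i \<omega>) (\<lambda>s. W i s \<omega>)) \<partial>M) \<longlonglongrightarrow> exp (- enn2real (\<integral>\<^sup>+z. ennreal (h z) \<partial>L))"
    unfolding int[symmetric] by (rule marked_poisson_functional) (use fin int in auto)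
  ultimately have "(\<integral>\<omega>. indicator ?E \<omega> \<partial>M) = exp (- enn2real (\<integral>\<^sup>+z. ennreal (h z) \<partial>L))"
    by (rule LIMSEQ_unique)
  moreover have "?E \<in> sets M" by measurable
  ultimately show ?thesis by simp
qed

end

section \<open>Frechet variables\<close>

lemma frechet_cdf_real:
  assumes "has_frechet_distribution N U (ereal q)" and [measurable]: "U \<in> borel_measurable N"
  shows "measure N {\<omega>\<in>space N. U \<omega> \<le> x} = (if 0 < x then exp (- (x powr - q)) else 0)"
proof -
  have "measure N {\<omega>\<in>space N. U \<omega> \<le> x} = cdf (distr N borel U) x"
    unfolding cdf_def by (subst measure_distr) (auto intro!: arg_cong[where f="measure N"])
  then show ?thesis
    using assms(1) by (simp add: has_frechet_distribution_def frechet_cdf_def)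
qed

lemma frechet_tail:
  assumes "prob_space N" and U: "has_frechet_distribution N U (ereal q)" and [measurable]: "U \<in> borel_measurable N"
    and "0 \<le> c"
  shows "measure N {\<omega>\<in>space N. 1 < c * U \<omega>} = 1 - exp (- (c powr q))"
proof (cases "c = 0")
  case False
  interpret prob_space N by fact
  have c: "0 < c" using False \<open>0 \<le> c\<close> by simp
  have "measure N {\<omega>\<in>space N. \<not> U \<omega> \<le> 1 / c} = 1 - measure N {\<omega>\<in>space N. U \<omega> \<le> 1 / c}"
    by (rule prob_neg) simp
  also have "{\<omega>\<in>space N. \<not> U \<omega> \<le> 1 / c} = {\<omega>\<in>space N. 1 < c * U \<omega>}"
    using c by (auto simp: field_simps)
  also have "(1 / c) powr - q = c powr q"
    using c by (simp add: powr_minus powr_divide)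
  then have "measure N {\<omega>\<in>space N. U \<omega> \<le> 1 / c} = exp (- (c powr q))"
    using c by (simp add: frechet_cdf_real[OF U])
  finally show ?thesis .
qed simp

text \<open>The tail at \<open>n\<close> is at most \<open>n powr - q\<close>, which is summable because \<open>1 < q\<close>.\<close>

lemma frechet_mean_finite:
  assumes "prob_space N" and U: "has_frechet_distribution N U (ereal q)" and [measurable]: "U \<in> borel_measurable N"
    and q: "1 < q"
  shows "(\<integral>\<^sup>+\<omega>. ennreal (U \<omega>) \<partial>N) < \<infinity>"
proof -
  interpret prob_space N by fact
  have le: "ennreal (U \<omega>) \<le> 1 + (\<Sum>n. indicator {\<omega>\<in>space N. real (Suc n) < U \<omega>} \<omega>)" if "\<omega> \<in> space N" for \<omega>
  proof -
    (* the number of positive integers strictly below U \<omega> *)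
    define k where "k = nat (\<lceil>U \<omega>\<rceil> - 1)"
    have k: "real k < U \<omega>" if "0 < k" using that unfolding k_def by linarith
    have "U \<omega> \<le> 1 + real k" unfolding k_def by linarith
    then have "ennreal (U \<omega>) \<le> ennreal (1 + real k)" by (rule ennreal_leI)
    also have "\<dots> = 1 + (\<Sum>n<k. (1::ennreal))"
      by (simp add: ennreal_of_nat_eq_real_of_nat[symmetric] ennreal_plus[symmetric] del: ennreal_plus)
         (simp add: ennreal_of_nat_eq_real_of_nat)
    also have "(\<Sum>n<k. (1::ennreal)) = (\<Sum>n<k. indicator {\<omega>\<in>space N. real (Suc n) < U \<omega>} \<omega>)"
    proof (intro sum.cong refl)
      fix n assume "n \<in> {..<k}"
      then have "real (Suc n) \<le> real k" "0 < k" by auto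
      with k show "1 = (indicator {\<omega>\<in>space N. real (Suc n) < U \<omega>} \<omega> :: ennreal)" using that by auto
    qed
    also have "\<dots> \<le> (\<Sum>n. indicator {\<omega>\<in>space N. real (Suc n) < U \<omega>} \<omega>)"
      by (rule sum_le_suminf) auto
    finally show ?thesis by (simp add: add_left_mono)
  qed
  have tail: "emeasure N {\<omega>\<in>space N. real (Suc n) < U \<omega>} \<le> ennreal (real (Suc n) powr - q)" for n
  proof -
    have "{\<omega>\<in>space N. real (Suc n) < U \<omega>} = {\<omega>\<in>space N. 1 < 1 / real (Suc n) * U \<omega>}"
      by (auto simp: field_simps)
    then have "measure N {\<omega>\<in>space N. real (Suc n) < U \<omega>} = 1 - exp (- ((1 / real (Suc n)) powr q))"
      using frechet_tail[OF \<open>prob_space N\<close> U, of "1 / real (Suc n)"] by simp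
    also have "\<dots> \<le> (1 / real (Suc n)) powr q"
      using exp_ge_add_one_self[of "- ((1 / real (Suc n)) powr q)"] by linarith
    also have "\<dots> = real (Suc n) powr - q" by (simp add: powr_minus powr_divide field_simps)
    finally show ?thesis by (simp add: emeasure_eq_measure ennreal_leI)
  qed
  have "(\<integral>\<^sup>+\<omega>. ennreal (U \<omega>) \<partial>N) \<le> (\<integral>\<^sup>+\<omega>. 1 + (\<Sum>n. indicator {\<omega>\<in>space N. real (Suc n) < U \<omega>} \<omega>) \<partial>N)"
    by (intro nn_integral_mono le)
  also have "\<dots> = 1 + (\<Sum>n. emeasure N {\<omega>\<in>space N. real (Suc n) < U \<omega>})"
    by (simp add: nn_integral_add nn_integral_suminf emeasure_space_1)
  also have "\<dots> \<le> 1 + (\<Sum>n. ennreal (real (Suc n) powr - q))"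
    by (intro add_left_mono suminf_le tail) auto
  also have "\<dots> = 1 + ennreal (\<Sum>n. real (Suc n) powr - q)"
  proof -
    have "summable (\<lambda>n. real n powr - q)" using q by (simp add: summable_real_powr_iff)
    then have "summable (\<lambda>n. real (Suc n) powr - q)" by (subst summable_Suc_iff)
    then show ?thesis by (subst suminf_ennreal2) auto
  qed
  also have "\<dots> < \<infinity>" by simp
  finally show ?thesis .
qed

lemma frechet_AE_pos:
  assumes "prob_space N" and U: "has_frechet_distribution N U (ereal q)" and [measurable]: "U \<in> borel_measurable N"
  shows "AE \<omega> in N. 0 < U \<omega>"
proof -
  interpret prob_space N by fact
  have "measure N {\<omega>\<in>space N. U \<omega> \<le> 0} = 0" by (simp add: frechet_cdf_real[OF U])
  then have "AE \<omega> in N. \<omega> \<notin> {\<omega>\<in>space N. U \<omega> \<le> 0}"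
    by (intro AE_not_in) (simp add: null_sets_def emeasure_eq_measure)
  with AE_space show ?thesis by eventually_elim auto
qed

lemma frechet_mean_pos:
  assumes "prob_space N" and U: "has_frechet_distribution N U (ereal q)" and [measurable]: "U \<in> borel_measurable N"
  shows "0 < (\<integral>\<^sup>+\<omega>. ennreal (U \<omega>) \<partial>N)"
proof -
  interpret prob_space N by fact
  have "\<not> (AE \<omega> in N. ennreal (U \<omega>) = 0)"
  proof
    assume "AE \<omega> in N. ennreal (U \<omega>) = 0"
    with frechet_AE_pos[OF assms] have "AE \<omega> in N. False" by eventually_elim (auto simp: ennreal_eq_0_iff)
    then show False by simp
  qed
  then show ?thesis by (simp add: nn_integral_0_iff_AE zero_less_iff_neq_zero)
qed

text \<open>Max-stability: the right-hand side depends on the scales \<open>c\<close> only through their \<open>q\<close>-norm.\<close>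

lemma (in prob_space) frechet_family_below:
  assumes U: "indep_vars (\<lambda>_. borel) U UNIV" and U_frechet: "\<And>s. has_frechet_distribution M (U s) (ereal q)"
    and J: "finite J" and c: "\<And>s. s \<in> J \<Longrightarrow> 0 \<le> c s"
  shows "prob {\<omega>\<in>space M. \<forall>s\<in>J. \<not> 1 < c s * U s \<omega>} = exp (- (\<Sum>s\<in>J. c s powr q))"
proof -
  have [measurable]: "U s \<in> borel_measurable M" for s using U by (auto simp: indep_vars_def)
  have "(\<integral>\<omega>. (\<Prod>s\<in>J. indicat_real {..1} (c s * U s \<omega>)) \<partial>M)
      = (\<integral>\<omega>. indicat_real {\<omega>\<in>space M. \<forall>s\<in>J. \<not> 1 < c s * U s \<omega>} \<omega> \<partial>M)"
    using J by (intro Bochner_Integration.integral_cong refl) (auto simp: indicator_def prod_zero_iff not_less)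
  then have "prob {\<omega>\<in>space M. \<forall>s\<in>J. \<not> 1 < c s * U s \<omega>}
      = (\<integral>\<omega>. (\<Prod>s\<in>J. indicat_real {..1} (c s * U s \<omega>)) \<partial>M)"
    using J by simp
  also have "\<dots> = (\<Prod>s\<in>J. \<integral>\<omega>. indicat_real {..1} (c s * U s \<omega>) \<partial>M)"
  proof (rule indep_vars_lebesgue_integral[OF J])
    show "indep_vars (\<lambda>_. borel) (\<lambda>s \<omega>. indicat_real {..1} (c s * U s \<omega>)) J"
      by (rule indep_vars_compose2[where Y="\<lambda>s u. indicat_real {..1} (c s * u)", OF indep_vars_subset[OF U]]) auto
  qed (auto intro!: integrable_const_bound[of _ 1])
  also have "\<dots> = (\<Prod>s\<in>J. exp (- (c s powr q)))"
  proof (intro prod.cong refl)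
    fix s assume s: "s \<in> J"
    have "(\<integral>\<omega>. indicat_real {..1} (c s * U s \<omega>) \<partial>M) = (\<integral>\<omega>. indicat_real {\<omega>\<in>space M. \<not> 1 < c s * U s \<omega>} \<omega> \<partial>M)"
      by (intro Bochner_Integration.integral_cong refl) (auto simp: indicator_def)
    also have "\<dots> = 1 - prob {\<omega>\<in>space M. 1 < c s * U s \<omega>}"
      by (simp add: prob_neg del: not_less)
    also have "\<dots> = exp (- (c s powr q))"
      using c[OF s] by (subst frechet_tail[OF prob_space_axioms U_frechet]) auto
    finally show "(\<integral>\<omega>. indicat_real {..1} (c s * U s \<omega>) \<partial>M) = exp (- (c s powr q))" .
  qed
  also have "\<dots> = exp (- (\<Sum>s\<in>J. c s powr q))"
    using J by (simp add: exp_sum[symmetric] sum_negf)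
  finally show ?thesis .
qed

text \<open>The integrand is the probability that \<open>a * t * U\<close> exceeds \<open>1\<close>, so \<open>nn_integral_layers\<close> evaluates the
  integral.\<close>

lemma frechet_layers:
  assumes N: "prob_space N" and U: "has_frechet_distribution N U (ereal q)" and [measurable]: "U \<in> borel_measurable N"
    and t: "0 \<le> t"
  shows "(\<integral>\<^sup>+a. ennreal (1 - exp (- ((a * t) powr q))) \<partial>inverse_square_measure) = (\<integral>\<^sup>+\<omega>. ennreal (U \<omega>) \<partial>N) * ennreal t"
proof -
  interpret N: prob_space N by fact
  have "(\<integral>\<^sup>+a. ennreal (1 - exp (- ((a * t) powr q))) \<partial>inverse_square_measure)
      = (\<integral>\<^sup>+a. (\<integral>\<^sup>+\<omega>. indicator {1<..} (a * (t * U \<omega>)) \<partial>N) \<partial>inverse_square_measure)"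
  proof (rule nn_integral_cong)
    fix a assume "a \<in> space inverse_square_measure"
    then have a: "0 \<le> a * t" using t by simp
    have "(\<integral>\<^sup>+\<omega>. indicator {1<..} (a * (t * U \<omega>)) \<partial>N) = (\<integral>\<^sup>+\<omega>. indicator {\<omega>\<in>space N. 1 < a * t * U \<omega>} \<omega> \<partial>N)"
      by (intro nn_integral_cong) (auto simp: indicator_def mult.assoc)
    also have "\<dots> = emeasure N {\<omega>\<in>space N. 1 < a * t * U \<omega>}" by simp
    also have "\<dots> = ennreal (1 - exp (- ((a * t) powr q)))"
      using a by (subst N.emeasure_eq_measure, subst frechet_tail[OF N U]) auto
    finally show "ennreal (1 - exp (- ((a * t) powr q))) = (\<integral>\<^sup>+\<omega>. indicator {1<..} (a * (t * U \<omega>)) \<partial>N)" by simp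
  qed
  also have "\<dots> = (\<integral>\<^sup>+\<omega>. ennreal (t * U \<omega>) \<partial>N)"
    by (rule nn_integral_layers[OF N.sigma_finite_measure_axioms]) measurable
  also have "\<dots> = (\<integral>\<^sup>+\<omega>. ennreal t * ennreal (U \<omega>) \<partial>N)"
    using t by (simp add: ennreal_mult')
  finally show ?thesis by (simp add: nn_integral_cmult mult.commute)
qed

lemma (in marked_poisson_process) exp_power_series_functional:
  assumes N: "prob_space N" and U: "has_frechet_distribution N U (ereal q)" and [measurable]: "U \<in> borel_measurable N"
    and q: "1 < q"
    and h [measurable]: "h \<in> borel_measurable path_space" and h0: "\<And>z. 0 \<le> h z"
    and fin: "(\<integral>\<^sup>+z. ennreal (h z) \<partial>L) < \<infinity>"
  shows "(\<lambda>n. \<integral>\<omega>. exp (- (\<Sum>i<n. (A i \<omega> * h (\<lambda>s. W i s \<omega>)) powr q)) \<partial>M)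
     \<longlonglongrightarrow> exp (- enn2real ((\<integral>\<^sup>+\<omega>. ennreal (U \<omega>) \<partial>N) * (\<integral>\<^sup>+z. ennreal (h z) \<partial>L)))"
proof -
  interpret L: prob_space L by (rule prob_space_L)
  interpret I: sigma_finite_measure inverse_square_measure by (rule sigma_finite_inverse_square)
  interpret IL: pair_sigma_finite inverse_square_measure L ..
  let ?g = "\<lambda>a z. exp (- ((max 0 a * h z) powr q))"
  let ?K = "\<integral>\<^sup>+\<omega>. ennreal (U \<omega>) \<partial>N"
  have [measurable]: "(\<lambda>a. a) \<in> borel_measurable inverse_square_measure"
    by (rule borel_measurable_inverse_square) simp
  have gm: "case_prod ?g \<in> borel_measurable (borel \<Otimes>\<^sub>M path_space)"
    unfolding case_prod_beta by measurable
  have "(\<integral>\<^sup>+a. (\<integral>\<^sup>+z. ennreal (1 - ?g a z) \<partial>L) \<partial>inverse_square_measure)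
      = (\<integral>\<^sup>+z. (\<integral>\<^sup>+a. ennreal (1 - ?g a z) \<partial>inverse_square_measure) \<partial>L)"
    by (rule IL.Fubini'[symmetric]) measurable
  also have "\<dots> = (\<integral>\<^sup>+z. (\<integral>\<^sup>+a. ennreal (1 - exp (- ((a * h z) powr q))) \<partial>inverse_square_measure) \<partial>L)"
    by (intro nn_integral_cong) (simp add: max.absorb2)
  also have "\<dots> = (\<integral>\<^sup>+z. ?K * ennreal (h z) \<partial>L)"
    by (intro nn_integral_cong frechet_layers[OF N U _ h0]) measurable
  finally have int: "(\<integral>\<^sup>+a. (\<integral>\<^sup>+z. ennreal (1 - ?g a z) \<partial>L) \<partial>inverse_square_measure) = ?K * (\<integral>\<^sup>+z. ennreal (h z) \<partial>L)"
    by (simp add: nn_integral_cmult)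
  have "?K * (\<integral>\<^sup>+z. ennreal (h z) \<partial>L) < \<infinity>"
    using frechet_mean_finite[OF N U _ q] fin by (simp add: ennreal_mult_less_top)
  then have "(\<lambda>n. \<integral>\<omega>. (\<Prod>i<n. ?g (A i \<omega>) (\<lambda>s. W i s \<omega>)) \<partial>M) \<longlonglongrightarrow> exp (- enn2real (?K * (\<integral>\<^sup>+z. ennreal (h z) \<partial>L)))"
    unfolding int[symmetric] by (intro marked_poisson_functional gm) auto
  moreover have "(\<integral>\<omega>. (\<Prod>i<n. ?g (A i \<omega>) (\<lambda>s. W i s \<omega>)) \<partial>M)
      = (\<integral>\<omega>. exp (- (\<Sum>i<n. (A i \<omega> * h (\<lambda>s. W i s \<omega>)) powr q)) \<partial>M)" for n
    using point_pos by (intro Bochner_Integration.integral_cong refl)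
      (simp add: exp_sum[symmetric] sum_negf max.absorb2 less_imp_le)
  ultimately show ?thesis by simp
qed

section \<open>The law of the denoised process\<close>

locale spectral_process =
  fixes P :: "'w measure" and V :: "int \<Rightarrow> 'w \<Rightarrow> real"
  assumes prob_space_P: "prob_space P"
    and spectral_measurable [measurable]: "\<And>s. V s \<in> borel_measurable P"
    and spectral_nonneg: "\<And>s \<omega>. \<omega> \<in> space P \<Longrightarrow> 0 \<le> V s \<omega>"
    and spectral_mean: "\<And>s. has_bochner_integral P (V s) 1"
begin

definition exponent :: "ereal \<Rightarrow> int set \<Rightarrow> (int \<Rightarrow> real) \<Rightarrow> real"
  where "exponent p J x = (\<integral>\<omega>. coordinate_norm p J (\<lambda>s. V s \<omega> / x s) \<partial>P)"

lemma integrable_spectral [simp, intro]: "integrable P (V s)"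
  using spectral_mean by (auto simp: has_bochner_integral_iff)

lemma integral_spectral [simp]: "(\<integral>\<omega>. V s \<omega> \<partial>P) = 1"
  using spectral_mean by (auto simp: has_bochner_integral_iff)

lemma integrable_coordinate_norm:
  assumes "1 < p" "finite J" "\<And>s. s \<in> J \<Longrightarrow> 0 < x s"
  shows "integrable P (\<lambda>\<omega>. coordinate_norm p J (\<lambda>s. V s \<omega> / x s))"
proof (rule Bochner_Integration.integrable_bound)
  show "integrable P (\<lambda>\<omega>. \<Sum>s\<in>J. V s \<omega> / x s)" by simp
  show "AE \<omega> in P. norm (coordinate_norm p J (\<lambda>s. V s \<omega> / x s)) \<le> norm (\<Sum>s\<in>J. V s \<omega> / x s)"
  proof (rule AE_I2)
    fix \<omega> assume "\<omega> \<in> space P"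
    then have nn: "0 \<le> V s \<omega> / x s" if "s \<in> J" for s
      using that assms(3)[OF that] spectral_nonneg by simp
    then show "norm (coordinate_norm p J (\<lambda>s. V s \<omega> / x s)) \<le> norm (\<Sum>s\<in>J. V s \<omega> / x s)"
      using coordinate_norm_le_sum[OF assms(1,2) nn] coordinate_norm_nonneg[OF assms(2)]
      by (simp add: sum_nonneg)
  qed
qed (use assms in measurable)

lemma nn_integral_exponent:
  assumes "1 < p" "finite J" "\<And>s. s \<in> J \<Longrightarrow> 0 < x s"
  shows "(\<integral>\<^sup>+\<omega>. ennreal (coordinate_norm p J (\<lambda>s. V s \<omega> / x s)) \<partial>P) = ennreal (exponent p J x)"
  unfolding exponent_def
  by (rule nn_integral_eq_integral) (use assms in \<open>auto intro: integrable_coordinate_norm coordinate_norm_nonneg\<close>)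

lemma exponent_nonneg: "finite J \<Longrightarrow> 0 \<le> exponent p J x"
  unfolding exponent_def by (intro Bochner_Integration.integral_nonneg) (simp add: coordinate_norm_nonneg)

lemma exponent_singleton:
  assumes "1 < p" "0 < x s" shows "exponent p {s} x = 1 / x s"
proof -
  have "exponent p {s} x = (\<integral>\<omega>. V s \<omega> / x s \<partial>P)"
    unfolding exponent_def using assms spectral_nonneg
    by (intro Bochner_Integration.integral_cong refl coordinate_norm_singleton) (auto simp: less_imp_le)
  then show ?thesis by simp
qed

end

text \<open>Only positive thresholds are prescribed. They determine the finite-dimensional distributions,
  since such a process is almost surely positive (\<open>orthant_prob\<close>).\<close>

definition has_exponent_law :: "ereal \<Rightarrow> 'w measure \<Rightarrow> (int \<Rightarrow> 'w \<Rightarrow> real) \<Rightarrow> 'a measure \<Rightarrow> (int \<Rightarrow> 'a \<Rightarrow> real) \<Rightarrow> bool"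
  where "has_exponent_law p P V M Z \<longleftrightarrow>
    (\<forall>J x. finite J \<longrightarrow> (\<forall>s\<in>J. 0 < x s) \<longrightarrow>
      measure M {\<omega>\<in>space M. \<forall>s\<in>J. Z s \<omega> \<le> x s} = exp (- spectral_process.exponent P V p J x))"

locale poisson_representation = spectral_process P V + marked_poisson_process M A W "path_law P V"
  for P :: "'w measure" and V :: "int \<Rightarrow> 'w \<Rightarrow> real"
    and M :: "'a measure" and A :: "nat \<Rightarrow> 'a \<Rightarrow> real" and W :: "nat \<Rightarrow> int \<Rightarrow> 'a \<Rightarrow> real"
begin

lemma AE_marks_nonneg: "AE \<omega> in M. \<forall>i s. 0 \<le> W i s \<omega>"
proof -
  have "AE \<omega> in M. 0 \<le> W i s \<omega>" for i s
  proof -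
    have "{z\<in>space path_space. 0 \<le> z s} \<in> sets path_space" by measurable
    then have [measurable]: "{z. 0 \<le> z s} \<in> sets path_space" by simp
    have "AE z in path_law P V. 0 \<le> z s"
      unfolding path_law_def using spectral_nonneg
      by (subst AE_distr_iff[OF measurable_path]) auto
    then have "AE z in path_law M (W i). 0 \<le> z s" unfolding marks_law .
    then show ?thesis
      unfolding path_law_def by (subst (asm) AE_distr_iff[OF measurable_mark]) auto
  qed
  then show ?thesis by (simp add: AE_all_countable)
qed

text \<open>The positive part makes this non-negative on every path; on the paths of the spectral process,
  which are non-negative, it is the norm of the scaled path.\<close>

definition norm_of_path :: "ereal \<Rightarrow> int set \<Rightarrow> (int \<Rightarrow> real) \<Rightarrow> (int \<Rightarrow> real) \<Rightarrow> real"
  where "norm_of_path p J x z = coordinate_norm p J (\<lambda>s. max 0 (z s) / x s)"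

lemma measurable_norm_of_path:
  assumes "finite J" shows "norm_of_path p J x \<in> borel_measurable path_space"
  unfolding norm_of_path_def[abs_def] using assms by measurable

lemma nn_integral_norm_of_path:
  assumes "1 < p" "finite J" "\<And>s. s \<in> J \<Longrightarrow> 0 < x s"
  shows "(\<integral>\<^sup>+z. ennreal (norm_of_path p J x z) \<partial>path_law P V) = ennreal (exponent p J x)"
proof -
  have m: "(\<lambda>z. ennreal (norm_of_path p J x z)) \<in> borel_measurable path_space"
    using measurable_norm_of_path[OF assms(2)] by measurable
  have "(\<integral>\<^sup>+z. ennreal (norm_of_path p J x z) \<partial>path_law P V)
      = (\<integral>\<^sup>+\<omega>. ennreal (norm_of_path p J x (\<lambda>s. V s \<omega>)) \<partial>P)"
    unfolding path_law_def by (subst nn_integral_distr[OF measurable_path]) (auto simp: m)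
  also have "\<dots> = (\<integral>\<^sup>+\<omega>. ennreal (coordinate_norm p J (\<lambda>s. V s \<omega> / x s)) \<partial>P)"
    by (intro nn_integral_cong) (simp add: norm_of_path_def spectral_nonneg max.absorb2)
  also have "\<dots> = ennreal (exponent p J x)"
    by (rule nn_integral_exponent[OF assms])
  finally show ?thesis .
qed

lemma prob_points_below:
  assumes J: "finite J" and x: "\<And>s. s \<in> J \<Longrightarrow> 0 < x s"
  shows "measure M {\<omega>\<in>space M. \<forall>i. \<forall>s\<in>J. A i \<omega> * W i s \<omega> \<le> x s} = exp (- exponent \<infinity> J x)"
proof -
  let ?h = "norm_of_path \<infinity> J x"
  note hm [measurable] = measurable_norm_of_path[OF J, of \<infinity> x]
  have int: "(\<integral>\<^sup>+z. ennreal (?h z) \<partial>path_law P V) = ennreal (exponent \<infinity> J x)"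
    using x by (intro nn_integral_norm_of_path[OF _ J]) auto
  have iff: "A i \<omega> * ?h (\<lambda>s. W i s \<omega>) \<le> 1 \<longleftrightarrow> (\<forall>s\<in>J. A i \<omega> * W i s \<omega> \<le> x s)"
    if "\<omega> \<in> space M" "\<forall>s. 0 \<le> W i s \<omega>" for i \<omega>
  proof -
    have "?h (\<lambda>s. W i s \<omega>) = Max (insert 0 ((\<lambda>s. W i s \<omega> / x s) ` J))"
      using that(2) by (simp add: norm_of_path_def coordinate_norm_def max.absorb2)
    moreover have "A i \<omega> * t \<le> 1 \<longleftrightarrow> t \<le> 1 / A i \<omega>" for t
      using point_pos[OF that(1)] by (simp add: field_simps)
    ultimately have "A i \<omega> * ?h (\<lambda>s. W i s \<omega>) \<le> 1 \<longleftrightarrow> (\<forall>s\<in>J. W i s \<omega> / x s \<le> 1 / A i \<omega>)"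
      using J point_pos[OF that(1), of i] by simp
    also have "\<dots> \<longleftrightarrow> (\<forall>s\<in>J. A i \<omega> * W i s \<omega> \<le> x s)"
      using x point_pos[OF that(1), of i] by (intro ball_cong refl) (simp add: field_simps)
    finally show ?thesis .
  qed
  have "measure M {\<omega>\<in>space M. \<forall>i. \<forall>s\<in>J. A i \<omega> * W i s \<omega> \<le> x s}
      = measure M {\<omega>\<in>space M. \<forall>i. A i \<omega> * ?h (\<lambda>s. W i s \<omega>) \<le> 1}"
  proof (rule finite_measure_eq_AE)
    show "AE \<omega> in M. (\<omega> \<in> {\<omega>\<in>space M. \<forall>i. \<forall>s\<in>J. A i \<omega> * W i s \<omega> \<le> x s})
        = (\<omega> \<in> {\<omega>\<in>space M. \<forall>i. A i \<omega> * ?h (\<lambda>s. W i s \<omega>) \<le> 1})"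
      using AE_marks_nonneg AE_space by eventually_elim (auto simp: iff)
  qed (use J in measurable)
  also have "\<dots> = exp (- exponent \<infinity> J x)"
    using prob_no_point_above[OF hm] int exponent_nonneg[OF J] by simp
  finally show ?thesis .
qed

text \<open>The supremum is at most \<open>m\<close> with probability \<open>exp (- 1 / m)\<close>.\<close>

lemma AE_points_bounded: "AE \<omega> in M. \<forall>s. bdd_above (range (\<lambda>i. A i \<omega> * W i s \<omega>))"
proof -
  have "AE \<omega> in M. bdd_above (range (\<lambda>i. A i \<omega> * W i s \<omega>))" for s
  proof -
    let ?E = "\<lambda>m::nat. {\<omega>\<in>space M. \<forall>i. A i \<omega> * W i s \<omega> \<le> real (Suc m)}"
    have [measurable]: "?E m \<in> sets M" for m by measurable
    have "measure M (?E m) = exp (- (1 / real (Suc m)))" for m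
      using prob_points_below[of "{s}" "\<lambda>_. real (Suc m)"] by (simp add: exponent_singleton)
    then have "(\<lambda>m. measure M (?E m)) \<longlonglongrightarrow> exp (- 0)"
      by (simp only:) (intro tendsto_intros LIMSEQ_inverse_real_of_nat[unfolded inverse_eq_divide])
    moreover have "measure M (?E m) \<le> measure M (\<Union>m. ?E m)" for m
      by (intro finite_measure_mono) auto
    ultimately have "1 \<le> measure M (\<Union>m. ?E m)"
      by (intro LIMSEQ_le_const2[of _ 1]) auto
    then have "measure M (\<Union>m. ?E m) = 1" using prob_le_1 by (intro antisym) auto
    then have "AE \<omega> in M. \<omega> \<in> (\<Union>m. ?E m)"
      by (subst (asm) prob_eq_1) auto
    then show ?thesis by eventually_elim (auto simp: bdd_above_def)
  qed
  then show ?thesis by (simp add: AE_all_countable)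
qed

lemma denoised_eq_SUP: "denoised A W s \<omega> = (SUP i. A i \<omega> * W i s \<omega>)"
  by (simp add: denoised_def lp_norm_def)

text \<open>On an unbounded sequence the real supremum has one fixed default value, and boundedness is a
  measurable event.\<close>

lemma measurable_denoised [measurable]: "denoised A W s \<in> borel_measurable M"
proof -
  let ?b = "\<lambda>\<omega>. bdd_above (range (\<lambda>i. A i \<omega> * W i s \<omega>))"
  have "?b \<omega> \<longleftrightarrow> (\<exists>m::nat. \<forall>i. A i \<omega> * W i s \<omega> \<le> real m)" for \<omega>
    by (auto simp: bdd_above_def) (meson order_trans real_arch_simple)
  then have b [measurable]: "Measurable.pred M ?b" by simp
  have eq: "denoised A W s \<omega> = (if ?b \<omega> then SUP i. (if ?b \<omega> then A i \<omega> * W i s \<omega> else 0) else (LEAST z::real. False))" for \<omega>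
  proof (cases "?b \<omega>")
    case False
    then have "(\<lambda>z. \<forall>x\<in>range (\<lambda>i. A i \<omega> * W i s \<omega>). x \<le> z) = (\<lambda>_. False)"
      by (auto simp: bdd_above_def fun_eq_iff)
    then show ?thesis using False by (simp only: denoised_eq_SUP Sup_real_def if_False)
  qed (simp add: denoised_eq_SUP)
  have "(\<lambda>\<omega>. SUP i. (if ?b \<omega> then A i \<omega> * W i s \<omega> else 0)) \<in> borel_measurable M"
    by (intro borel_measurable_cSUP) (auto simp: image_constant_conv cong: if_cong split: if_splits)
  then show ?thesis
    by (subst measurable_cong[OF eq]) measurable
qed

lemma denoised_law: "has_exponent_law \<infinity> P V M (denoised A W)"
  unfolding has_exponent_law_def
proof (intro allI impI)
  fix J :: "int set" and x :: "int \<Rightarrow> real" assume J: "finite J" and x: "\<forall>s\<in>J. 0 < x s"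
  have "measure M {\<omega>\<in>space M. \<forall>s\<in>J. denoised A W s \<omega> \<le> x s}
      = measure M {\<omega>\<in>space M. \<forall>i. \<forall>s\<in>J. A i \<omega> * W i s \<omega> \<le> x s}"
  proof (rule finite_measure_eq_AE)
    show "AE \<omega> in M. (\<omega> \<in> {\<omega>\<in>space M. \<forall>s\<in>J. denoised A W s \<omega> \<le> x s})
        = (\<omega> \<in> {\<omega>\<in>space M. \<forall>i. \<forall>s\<in>J. A i \<omega> * W i s \<omega> \<le> x s})"
      using AE_points_bounded by eventually_elim (auto simp: denoised_eq_SUP cSUP_le_iff)
  qed (use J in measurable)
  then show "measure M {\<omega>\<in>space M. \<forall>s\<in>J. denoised A W s \<omega> \<le> x s} = exp (- exponent \<infinity> J x)"
    using prob_points_below[OF J] x by simp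
qed

end

section \<open>The law of the Frechet mixture\<close>

lemma exp_neg_partial_sums:
  fixes c :: "nat \<Rightarrow> real"
  assumes c: "\<And>i. 0 \<le> c i"
  shows "(\<lambda>n. exp (- (\<Sum>i<n. c i))) \<longlonglongrightarrow> (if summable c then exp (- suminf c) else 0)"
proof (cases "summable c")
  case True
  then show ?thesis by (auto intro!: tendsto_intros summable_LIMSEQ)
next
  case False
  have "filterlim (\<lambda>n. \<Sum>i<n. c i) at_top sequentially"
    unfolding filterlim_at_top
  proof
    fix B :: real
    from False obtain N where "\<not> (\<Sum>i<N. c i) \<le> B" using summableI_nonneg_bounded[of c B] c by blast
    moreover have "(\<Sum>i<N. c i) \<le> (\<Sum>i<n. c i)" if "N \<le> n" for n
      using c that by (intro sum_mono2) auto
    ultimately have "B \<le> (\<Sum>i<n. c i)" if "N \<le> n" for n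
      using that by (meson linear order_trans)
    then show "\<forall>\<^sub>F n in sequentially. B \<le> (\<Sum>i<n. c i)" by (auto simp: eventually_sequentially)
  qed
  then have "(\<lambda>n. exp (- (\<Sum>i<n. c i))) \<longlonglongrightarrow> 0"
    by (intro filterlim_compose[OF exp_at_bot] filterlim_compose[OF filterlim_uminus_at_bot_at_top])
  then show ?thesis using False by simp
qed

context prob_space
begin

lemma indep_set_imp_product_distr:
  assumes Z: "Z1 \<in> measurable M N1" "Z2 \<in> measurable M N2"
    and ind: "indep_set (generated_events M N1 Z1) (generated_events M N2 Z2)"
  shows "distr M N1 Z1 \<Otimes>\<^sub>M distr M N2 Z2 = distr M (N1 \<Otimes>\<^sub>M N2) (\<lambda>\<omega>. (Z1 \<omega>, Z2 \<omega>))"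
proof (rule pair_measure_eqI)
  show "sigma_finite_measure (distr M N1 Z1)" "sigma_finite_measure (distr M N2 Z2)"
    using Z by (auto intro!: prob_space_imp_sigma_finite prob_space_distr)
  show "sets (distr M N1 Z1 \<Otimes>\<^sub>M distr M N2 Z2) = sets (distr M (N1 \<Otimes>\<^sub>M N2) (\<lambda>\<omega>. (Z1 \<omega>, Z2 \<omega>)))"
    by simp
  fix B C assume "B \<in> sets (distr M N1 Z1)" "C \<in> sets (distr M N2 Z2)"
  then have B: "B \<in> sets N1" and C: "C \<in> sets N2" by auto
  have "prob ((Z1 -` B \<inter> space M) \<inter> (Z2 -` C \<inter> space M)) = prob (Z1 -` B \<inter> space M) * prob (Z2 -` C \<inter> space M)"
    using B C by (intro indep_setD[OF ind]) (auto simp: generated_events_def)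
  moreover have "(Z1 -` B \<inter> space M) \<inter> (Z2 -` C \<inter> space M) = (\<lambda>\<omega>. (Z1 \<omega>, Z2 \<omega>)) -` (B \<times> C) \<inter> space M"
    by auto
  ultimately show "emeasure (distr M N1 Z1) B * emeasure (distr M N2 Z2) C
      = emeasure (distr M (N1 \<Otimes>\<^sub>M N2) (\<lambda>\<omega>. (Z1 \<omega>, Z2 \<omega>))) (B \<times> C)"
    using Z B C by (simp add: emeasure_distr emeasure_eq_measure ennreal_mult'[symmetric])
qed

lemma Int_stable_generated_events: "Int_stable (generated_events M N Z)"
proof (rule Int_stableI)
  fix a b assume "a \<in> generated_events M N Z" "b \<in> generated_events M N Z"
  then obtain B C where "B \<in> sets N" "C \<in> sets N" "a = Z -` B \<inter> space M" "b = Z -` C \<inter> space M"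
    by (auto simp: generated_events_def)
  then show "a \<inter> b \<in> generated_events M N Z"
    unfolding generated_events_def by (auto intro!: exI[of _ "B \<inter> C"])
qed

text \<open>Grouping the second and the third family into one keeps independence of the first, since their
  joint events lie in the \<open>\<sigma>\<close>-algebra generated by the separate ones.\<close>

lemma indep_three_product_distr:
  assumes "indep_three M N1 Z1 N2 Z2 N3 Z3"
  shows "distr M N2 Z2 \<Otimes>\<^sub>M distr M N3 Z3 = distr M (N2 \<Otimes>\<^sub>M N3) (\<lambda>\<omega>. (Z2 \<omega>, Z3 \<omega>))"
    and "distr M N1 Z1 \<Otimes>\<^sub>M distr M (N2 \<Otimes>\<^sub>M N3) (\<lambda>\<omega>. (Z2 \<omega>, Z3 \<omega>))
       = distr M (N1 \<Otimes>\<^sub>M (N2 \<Otimes>\<^sub>M N3)) (\<lambda>\<omega>. (Z1 \<omega>, Z2 \<omega>, Z3 \<omega>))"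
proof -
  let ?E = "\<lambda>k. [generated_events M N1 Z1, generated_events M N2 Z2, generated_events M N3 Z3] ! k"
  have Z [measurable]: "Z1 \<in> measurable M N1" "Z2 \<in> measurable M N2" "Z3 \<in> measurable M N3"
    and ind: "indep_sets ?E {..<3}"
    using assms by (auto simp: indep_three_def)
  (* the two groups of families: the first alone, and the other two *)
  let ?I = "case_bool {0::nat} {1, 2}"
  have I: "(\<Union>j\<in>UNIV. ?I j) = {..<3}" by (auto simp: UNIV_bool)
  have "indep_sets (\<lambda>j. sigma_sets (space M) (\<Union>i\<in>?I j. ?E i)) UNIV"
  proof (rule indep_sets_collect_sigma)
    show "indep_sets ?E (\<Union>j\<in>UNIV. ?I j)" unfolding I by (rule ind)
    show "Int_stable (?E i)" if "i \<in> ?I j" for i j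
      using that by (cases j) (auto simp: Int_stable_generated_events)
    show "disjoint_family_on ?I UNIV"
      by (auto simp: disjoint_family_on_def split: bool.splits)
  qed
  then have sig: "indep_set (sigma_sets (space M) (?E 0)) (sigma_sets (space M) (?E 1 \<union> ?E 2))"
    unfolding indep_set_def by (rule indep_sets_mono_sets) (auto split: bool.splits)
  have "indep_set (generated_events M N1 Z1) (generated_events M (N2 \<Otimes>\<^sub>M N3) (\<lambda>\<omega>. (Z2 \<omega>, Z3 \<omega>)))"
    unfolding indep_set_def
  proof (rule indep_sets_mono_sets[OF sig[unfolded indep_set_def]])
    fix j :: bool
    have pair: "generated_events M (N2 \<Otimes>\<^sub>M N3) (\<lambda>\<omega>. (Z2 \<omega>, Z3 \<omega>)) \<subseteq> sigma_sets (space M) (?E 1 \<union> ?E 2)"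
    proof -
      let ?S = "sigma (space M) (?E 1 \<union> ?E 2)"
      have sub: "?E 1 \<union> ?E 2 \<subseteq> Pow (space M)" by (auto simp: generated_events_def)
      then have sp: "space ?S = space M" and st: "sets ?S = sigma_sets (space M) (?E 1 \<union> ?E 2)"
        by (simp_all add: space_measure_of sets_measure_of)
      have "Z2 \<in> measurable ?S N2"
        using measurable_space[OF Z(2)] unfolding measurable_def sp st
        by (auto simp: generated_events_def intro!: sigma_sets.Basic)
      moreover have "Z3 \<in> measurable ?S N3"
        using measurable_space[OF Z(3)] unfolding measurable_def sp st
        by (auto simp: generated_events_def intro!: sigma_sets.Basic)
      ultimately have "(\<lambda>\<omega>. (Z2 \<omega>, Z3 \<omega>)) \<in> measurable ?S (N2 \<Otimes>\<^sub>M N3)" by (rule measurable_Pair)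
      from measurable_sets[OF this, unfolded sp st] show ?thesis
        unfolding generated_events_def[of M "N2 \<Otimes>\<^sub>M N3"] by (intro subsetI) (elim CollectE exE conjE, simp)
    qed
    show "case_bool (generated_events M N1 Z1) (generated_events M (N2 \<Otimes>\<^sub>M N3) (\<lambda>\<omega>. (Z2 \<omega>, Z3 \<omega>))) j
        \<subseteq> case_bool (sigma_sets (space M) (?E 0)) (sigma_sets (space M) (?E 1 \<union> ?E 2)) j"
      using pair by (cases j) (auto intro: sigma_sets.Basic)
  qed
  then show "distr M N1 Z1 \<Otimes>\<^sub>M distr M (N2 \<Otimes>\<^sub>M N3) (\<lambda>\<omega>. (Z2 \<omega>, Z3 \<omega>))
       = distr M (N1 \<Otimes>\<^sub>M (N2 \<Otimes>\<^sub>M N3)) (\<lambda>\<omega>. (Z1 \<omega>, Z2 \<omega>, Z3 \<omega>))"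
    by (intro indep_set_imp_product_distr) measurable
  have "indep_set (generated_events M N2 Z2) (generated_events M N3 Z3)"
  proof (unfold indep_sets2_eq, intro conjI ballI)
    show "generated_events M N2 Z2 \<subseteq> events" "generated_events M N3 Z3 \<subseteq> events"
      by (auto simp: generated_events_def)
    fix a b assume "a \<in> generated_events M N2 Z2" "b \<in> generated_events M N3 Z3"
    then have "prob (\<Inter>j\<in>{1,2::nat}. if j = 1 then a else b) = (\<Prod>j\<in>{1,2::nat}. prob (if j = 1 then a else b))"
      by (intro indep_setsD[OF ind]) auto
    then show "prob (a \<inter> b) = prob a * prob b" by (simp add: Int_commute)
  qed
  then show "distr M N2 Z2 \<Otimes>\<^sub>M distr M N3 Z3 = distr M (N2 \<Otimes>\<^sub>M N3) (\<lambda>\<omega>. (Z2 \<omega>, Z3 \<omega>))"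
    by (intro indep_set_imp_product_distr Z)
qed

text \<open>Conditionally on \<open>Y\<close>, the event concerns independent Frechet variables with fixed scales.\<close>

lemma frechet_scale_mixture:
  fixes U :: "'s \<Rightarrow> 'a \<Rightarrow> real" and Y :: "'a \<Rightarrow> 'b" and \<nu> :: "'s \<Rightarrow> 'b \<Rightarrow> real"
  assumes U: "indep_vars (\<lambda>_. borel) U UNIV" and U_frechet: "\<And>s. has_frechet_distribution M (U s) (ereal q)"
    and Y [measurable]: "Y \<in> measurable M S"
    and joint: "distr M path_space (\<lambda>\<omega> s. U s \<omega>) \<Otimes>\<^sub>M distr M S Y = distr M (path_space \<Otimes>\<^sub>M S) (\<lambda>\<omega>. (\<lambda>s. U s \<omega>, Y \<omega>))"
    and \<nu> [measurable]: "\<And>s. \<nu> s \<in> borel_measurable S" and \<nu>0: "\<And>s y. 0 \<le> \<nu> s y"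
    and J: "finite J" and x: "\<And>s. s \<in> J \<Longrightarrow> 0 < x s"
  shows "prob {\<omega>\<in>space M. \<forall>s\<in>J. U s \<omega> * \<nu> s (Y \<omega>) \<le> x s}
    = (\<integral>\<omega>. exp (- (\<Sum>s\<in>J. (\<nu> s (Y \<omega>) / x s) powr q)) \<partial>M)"
proof -
  have Um [measurable]: "U s \<in> borel_measurable M" for s using U by (auto simp: indep_vars_def)
  have Up [measurable]: "(\<lambda>\<omega> s. U s \<omega>) \<in> measurable M path_space" by (rule measurable_path) measurable
  let ?DU = "distr M path_space (\<lambda>\<omega> s. U s \<omega>)" and ?DY = "distr M S Y"
  interpret DU: prob_space ?DU by (rule prob_space_distr) measurable
  interpret DY: prob_space ?DY by (rule prob_space_distr) measurable
  interpret D: pair_prob_space ?DU ?DY ..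
  let ?B = "{(u, y). \<forall>s\<in>J. u s * \<nu> s y \<le> x s} \<inter> space (path_space \<Otimes>\<^sub>M S)"
  have B: "?B \<in> sets (path_space \<Otimes>\<^sub>M S)"
  proof -
    have "{z\<in>space (path_space \<Otimes>\<^sub>M S). \<forall>s\<in>J. fst z s * \<nu> s (snd z) \<le> x s} \<in> sets (path_space \<Otimes>\<^sub>M S)"
      using J by measurable
    also have "{z\<in>space (path_space \<Otimes>\<^sub>M S). \<forall>s\<in>J. fst z s * \<nu> s (snd z) \<le> x s} = ?B" by auto
    finally show ?thesis .
  qed
  have conditional: "emeasure ?DU ((\<lambda>u. (u, y)) -` ?B) = ennreal (exp (- (\<Sum>s\<in>J. (\<nu> s y / x s) powr q)))"
    if y: "y \<in> space S" for y
  proof -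
    have eq: "(\<lambda>u. (u, y)) -` ?B = {u\<in>space path_space. \<forall>s\<in>J. u s * \<nu> s y \<le> x s}"
      using y by (auto simp: space_pair_measure)
    have "{u\<in>space path_space. \<forall>s\<in>J. u s * \<nu> s y \<le> x s} \<in> sets path_space" using J by measurable
    then have "emeasure ?DU ((\<lambda>u. (u, y)) -` ?B) = emeasure M {\<omega>\<in>space M. \<forall>s\<in>J. U s \<omega> * \<nu> s y \<le> x s}"
      unfolding eq by (subst emeasure_distr) (auto intro!: arg_cong[where f="emeasure M"])
    also have "{\<omega>\<in>space M. \<forall>s\<in>J. U s \<omega> * \<nu> s y \<le> x s} = {\<omega>\<in>space M. \<forall>s\<in>J. \<not> 1 < \<nu> s y / x s * U s \<omega>}"
    proof -
      have "U s \<omega> * \<nu> s y \<le> x s \<longleftrightarrow> \<not> 1 < \<nu> s y / x s * U s \<omega>" if "s \<in> J" for s \<omega>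
        using x[OF that] by (auto simp: field_simps)
      then show ?thesis by auto
    qed
    also have "emeasure M \<dots> = ennreal (exp (- (\<Sum>s\<in>J. (\<nu> s y / x s) powr q)))"
      using x \<nu>0 unfolding emeasure_eq_measure
      by (subst frechet_family_below[OF U U_frechet J]) (auto simp: less_imp_le)
    finally show ?thesis .
  qed
  have "ennreal (prob {\<omega>\<in>space M. \<forall>s\<in>J. U s \<omega> * \<nu> s (Y \<omega>) \<le> x s}) = emeasure (?DU \<Otimes>\<^sub>M ?DY) ?B"
    unfolding joint emeasure_eq_measure[symmetric] using measurable_space[OF Y]
    by (subst emeasure_distr[OF _ B]) (auto simp: space_pair_measure intro!: arg_cong[where f="emeasure M"])
  also have "\<dots> = (\<integral>\<^sup>+y. emeasure ?DU ((\<lambda>u. (u, y)) -` ?B) \<partial>?DY)"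
    using B by (intro D.emeasure_pair_measure_alt2) simp
  also have "\<dots> = (\<integral>\<^sup>+y. ennreal (exp (- (\<Sum>s\<in>J. (\<nu> s y / x s) powr q))) \<partial>?DY)"
    by (intro nn_integral_cong conditional) simp
  also have "\<dots> = (\<integral>\<^sup>+\<omega>. ennreal (exp (- (\<Sum>s\<in>J. (\<nu> s (Y \<omega>) / x s) powr q))) \<partial>M)"
    by (subst nn_integral_distr) auto
  also have "\<dots> = ennreal (\<integral>\<omega>. exp (- (\<Sum>s\<in>J. (\<nu> s (Y \<omega>) / x s) powr q)) \<partial>M)"
    by (intro nn_integral_eq_integral integrable_const_bound[of _ 1]) (auto simp: sum_nonneg)
  finally show ?thesis
    by (simp add: ennreal_inj integral_nonneg)
qed

end

context poisson_representation
begin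

text \<open>The \<open>q\<close>-th power of the scaled \<open>q\<close>-norm splits into the sum over \<open>J\<close>.\<close>

lemma power_series_functional:
  assumes N: "prob_space N" and U: "has_frechet_distribution N U (ereal q)" and Um: "U \<in> borel_measurable N"
    and q: "1 < q" and J: "finite J" and x: "\<And>s. s \<in> J \<Longrightarrow> 0 < x s"
  shows "(\<lambda>n. \<integral>\<omega>. exp (- (\<Sum>i<n. \<Sum>s\<in>J. (A i \<omega> * W i s \<omega> / x s) powr q)) \<partial>M)
     \<longlonglongrightarrow> exp (- (enn2real (\<integral>\<^sup>+\<omega>. ennreal (U \<omega>) \<partial>N) * exponent (ereal q) J x))"
proof -
  let ?h = "norm_of_path (ereal q) J x"
  note hm [measurable] = measurable_norm_of_path[OF J, of "ereal q" x]
  have int: "(\<integral>\<^sup>+z. ennreal (?h z) \<partial>path_law P V) = ennreal (exponent (ereal q) J x)"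
    using x q by (intro nn_integral_norm_of_path[OF _ J]) auto
  have "(\<lambda>n. \<integral>\<omega>. exp (- (\<Sum>i<n. (A i \<omega> * ?h (\<lambda>s. W i s \<omega>)) powr q)) \<partial>M)
     \<longlonglongrightarrow> exp (- enn2real ((\<integral>\<^sup>+\<omega>. ennreal (U \<omega>) \<partial>N) * (\<integral>\<^sup>+z. ennreal (?h z) \<partial>path_law P V)))"
    by (rule exp_power_series_functional[OF N U Um q hm])
       (auto simp: norm_of_path_def coordinate_norm_nonneg[OF J] int[unfolded norm_of_path_def])
  moreover have "(\<integral>\<omega>. exp (- (\<Sum>i<n. (A i \<omega> * ?h (\<lambda>s. W i s \<omega>)) powr q)) \<partial>M)
     = (\<integral>\<omega>. exp (- (\<Sum>i<n. \<Sum>s\<in>J. (A i \<omega> * W i s \<omega> / x s) powr q)) \<partial>M)" for n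
  proof (rule integral_cong_AE)
    show "AE \<omega> in M. exp (- (\<Sum>i<n. (A i \<omega> * ?h (\<lambda>s. W i s \<omega>)) powr q))
        = exp (- (\<Sum>i<n. \<Sum>s\<in>J. (A i \<omega> * W i s \<omega> / x s) powr q))"
      using AE_marks_nonneg AE_space
    proof eventually_elim
      case (elim \<omega>)
      have "(A i \<omega> * ?h (\<lambda>s. W i s \<omega>)) powr q = (\<Sum>s\<in>J. (A i \<omega> * W i s \<omega> / x s) powr q)" for i
      proof -
        have "A i \<omega> * ?h (\<lambda>s. W i s \<omega>) = A i \<omega> * coordinate_norm (ereal q) J (\<lambda>s. W i s \<omega> / x s)"
          using elim by (simp add: norm_of_path_def max.absorb2)
        also have "\<dots> = coordinate_norm (ereal q) J (\<lambda>s. A i \<omega> * (W i s \<omega> / x s))"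
          using q J x elim point_pos[OF elim(2), of i]
          by (intro coordinate_norm_scale[symmetric]) (auto simp: less_imp_le)
        finally show ?thesis
          using q by (simp add: coordinate_norm_def powr_inverse_cancel sum_nonneg)
      qed
      then show ?case by simp
    qed
  qed measurable
  ultimately show ?thesis
    unfolding int using exponent_nonneg[OF J] by (simp add: enn2real_mult)
qed

text \<open>In the limit, the functional of the series scaled by \<open>1 / m\<close> charges only the event of convergence,
  which therefore has probability at least \<open>exp (- K / m)\<close> for every \<open>m\<close>.\<close>

lemma AE_power_series_summable:
  assumes N: "prob_space N" and U: "has_frechet_distribution N U (ereal q)" and Um: "U \<in> borel_measurable N"
    and q: "1 < q"
  shows "AE \<omega> in M. summable (\<lambda>i. (A i \<omega> * W i s \<omega>) powr q)"
proof -
  let ?K = "enn2real (\<integral>\<^sup>+\<omega>. ennreal (U \<omega>) \<partial>N)"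
  let ?D = "{\<omega>\<in>space M. summable (\<lambda>i. (A i \<omega> * W i s \<omega>) powr q)}"
  have "(\<lambda>n. \<Sum>i<n. f i) \<longlonglongrightarrow> (\<Sum>i. f i) \<longleftrightarrow> summable f" for f :: "nat \<Rightarrow> real"
    using summable_LIMSEQ sums_def summable_def by blast
  then have D: "?D = {\<omega>\<in>space M. (\<lambda>n. \<Sum>i<n. (A i \<omega> * W i s \<omega>) powr q) \<longlonglongrightarrow> (\<Sum>i. (A i \<omega> * W i s \<omega>) powr q)}" by simp
  have [measurable]: "?D \<in> sets M" unfolding D by measurable
  have le: "exp (- (?K * (1 / real (Suc m)))) \<le> measure M ?D" for m
  proof -
    let ?c = "\<lambda>\<omega> i. (A i \<omega> * W i s \<omega> / real (Suc m)) powr q"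
    have "(\<lambda>n. \<integral>\<omega>. exp (- (\<Sum>i<n. ?c \<omega> i)) \<partial>M) \<longlonglongrightarrow> exp (- (?K * (1 / real (Suc m))))"
      using power_series_functional[OF N U Um q, of "{s}" "\<lambda>_. real (Suc m)"] q
      by (simp add: exponent_singleton)
    moreover have "(\<lambda>n. \<integral>\<omega>. exp (- (\<Sum>i<n. ?c \<omega> i)) \<partial>M)
       \<longlonglongrightarrow> (\<integral>\<omega>. (if \<omega> \<in> ?D then exp (- max 0 (\<Sum>i. ?c \<omega> i)) else 0) \<partial>M)"
    proof (rule integral_dominated_convergence[where w="\<lambda>_. 1"])
      show "AE \<omega> in M. (\<lambda>n. exp (- (\<Sum>i<n. ?c \<omega> i))) \<longlonglongrightarrow> (if \<omega> \<in> ?D then exp (- max 0 (\<Sum>i. ?c \<omega> i)) else 0)"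
        using AE_marks_nonneg AE_space
      proof eventually_elim
        case (elim \<omega>)
        have "?c \<omega> i = (1 / real (Suc m)) powr q * (A i \<omega> * W i s \<omega>) powr q" for i
          using elim point_pos[OF elim(2), of i]
          by (subst powr_mult[symmetric]) (auto simp: less_imp_le divide_inverse mult_ac)
        then have "summable (?c \<omega>) \<longleftrightarrow> \<omega> \<in> ?D"
          using elim by (simp add: summable_cmult_iff)
        then show ?case
          using exp_neg_partial_sums[of "?c \<omega>"] suminf_nonneg[of "?c \<omega>"]
          by (cases "summable (?c \<omega>)") (auto simp: max.absorb2 simp del: of_nat_Suc)
      qed
      show "AE \<omega> in M. norm (exp (- (\<Sum>i<n. ?c \<omega> i))) \<le> 1" for n
        by (intro AE_I2) (simp add: sum_nonneg)
    qed measurable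
    ultimately have "exp (- (?K * (1 / real (Suc m)))) = (\<integral>\<omega>. (if \<omega> \<in> ?D then exp (- max 0 (\<Sum>i. ?c \<omega> i)) else 0) \<partial>M)"
      by (rule LIMSEQ_unique)
    also have "\<dots> \<le> (\<integral>\<omega>. indicator ?D \<omega> \<partial>M)"
    proof (rule integral_mono')
      show "integrable M (indicat_real ?D)"
        by (intro integrable_real_indicator) (auto simp: less_top[symmetric])
    qed (auto simp: indicator_def)
    finally show ?thesis by simp
  qed
  have "(\<lambda>m. exp (- (?K * (1 / real (Suc m))))) \<longlonglongrightarrow> exp (- (?K * 0))"
    by (intro tendsto_intros LIMSEQ_inverse_real_of_nat[unfolded inverse_eq_divide])
  then have "1 \<le> measure M ?D"
    by (intro LIMSEQ_le_const2[of _ 1]) (use le in auto)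
  then have "measure M ?D = 1" using prob_le_1 by (intro antisym) auto
  then have "AE \<omega> in M. \<omega> \<in> ?D"
    by (subst (asm) prob_eq_1) auto
  then show ?thesis by eventually_elim auto
qed

lemma exponent_scale:
  assumes "1 < p" "finite J" "0 < c" "\<And>s. s \<in> J \<Longrightarrow> 0 < x s"
  shows "exponent p J (\<lambda>s. c * x s) = exponent p J x / c"
proof -
  have "exponent p J (\<lambda>s. c * x s) = (\<integral>\<omega>. (1 / c) * coordinate_norm p J (\<lambda>s. V s \<omega> / x s) \<partial>P)"
    unfolding exponent_def
  proof (rule Bochner_Integration.integral_cong[OF refl])
    fix \<omega> assume "\<omega> \<in> space P"
    then have "coordinate_norm p J (\<lambda>s. (1 / c) * (V s \<omega> / x s)) = (1 / c) * coordinate_norm p J (\<lambda>s. V s \<omega> / x s)"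
      using assms spectral_nonneg by (intro coordinate_norm_scale) (auto simp: less_imp_le)
    then show "coordinate_norm p J (\<lambda>s. V s \<omega> / (c * x s)) = (1 / c) * coordinate_norm p J (\<lambda>s. V s \<omega> / x s)"
      by simp
  qed
  then show ?thesis by (simp add: exponent_def)
qed

text \<open>The constant is the mean of the Frechet variable divided by \<open>c\<close>.\<close>

lemma frechet_mixture_law:
  fixes U :: "int \<Rightarrow> 'a \<Rightarrow> real"
  assumes q: "1 < q" and U: "indep_vars (\<lambda>_. borel) U UNIV" and U_frechet: "\<And>s. has_frechet_distribution M (U s) (ereal q)"
    and joint: "distr M path_space (\<lambda>\<omega> s. U s \<omega>) \<Otimes>\<^sub>M
        distr M (path_space \<Otimes>\<^sub>M (\<Pi>\<^sub>M i\<in>UNIV. path_space)) (\<lambda>\<omega>. (\<lambda>i. A i \<omega>, \<lambda>i s. W i s \<omega>))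
      = distr M (path_space \<Otimes>\<^sub>M (path_space \<Otimes>\<^sub>M (\<Pi>\<^sub>M i\<in>UNIV. path_space)))
          (\<lambda>\<omega>. (\<lambda>s. U s \<omega>, (\<lambda>i. A i \<omega>, \<lambda>i s. W i s \<omega>)))"
    and c: "0 < c" and J: "finite J" and x: "\<And>s. s \<in> J \<Longrightarrow> 0 < x s"
  shows "prob {\<omega>\<in>space M. \<forall>s\<in>J. U s \<omega> / c * lp_norm (ereal q) (\<lambda>i. A i \<omega> * W i s \<omega>) \<le> x s}
    = exp (- (enn2real (\<integral>\<^sup>+\<omega>. ennreal (U 0 \<omega>) \<partial>M) / c * exponent (ereal q) J x))"
proof -
  have Um [measurable]: "U s \<in> borel_measurable M" for s using U by (auto simp: indep_vars_def)
  let ?S = "path_space \<Otimes>\<^sub>M (\<Pi>\<^sub>M i\<in>UNIV. path_space) :: ((nat \<Rightarrow> real) \<times> (nat \<Rightarrow> int \<Rightarrow> real)) measure"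
  let ?Y = "\<lambda>\<omega>. (\<lambda>i. A i \<omega>, \<lambda>i s. W i s \<omega>)"
  let ?\<nu> = "\<lambda>s (y :: (nat \<Rightarrow> real) \<times> (nat \<Rightarrow> int \<Rightarrow> real)). lp_norm (ereal q) (\<lambda>i. fst y i * snd y i s)"
  have [measurable]: "(\<lambda>y. fst y i) \<in> borel_measurable ?S" for i
    by (rule measurable_compose[OF measurable_fst measurable_path_coordinate])
  have "(\<lambda>y. snd y i) \<in> measurable ?S path_space" for i
    by (rule measurable_compose[OF measurable_snd measurable_component_singleton]) simp
  from measurable_compose[OF this measurable_path_coordinate]
  have [measurable]: "(\<lambda>y. snd y i s) \<in> borel_measurable ?S" for i s .
  have "prob {\<omega>\<in>space M. \<forall>s\<in>J. U s \<omega> * ?\<nu> s (?Y \<omega>) \<le> c * x s}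
      = (\<integral>\<omega>. exp (- (\<Sum>s\<in>J. (?\<nu> s (?Y \<omega>) / (c * x s)) powr q)) \<partial>M)"
  proof (rule frechet_scale_mixture[OF U U_frechet _ joint _ _ J])
    show "?Y \<in> measurable M ?S" by measurable
    show "?\<nu> s \<in> borel_measurable ?S" for s
    proof -
      have "?\<nu> s = (\<lambda>y. (\<Sum>i. (fst y i * snd y i s) powr q) powr (1 / q))"
        by (simp add: lp_norm_def fun_eq_iff)
      then show ?thesis by (simp only:) measurable
    qed
    show "0 \<le> ?\<nu> s y" for s y by (simp add: lp_norm_def)
    show "0 < c * x s" if "s \<in> J" for s using x[OF that] c by simp
  qed
  also have "\<dots> = exp (- (enn2real (\<integral>\<^sup>+\<omega>. ennreal (U 0 \<omega>) \<partial>M) * exponent (ereal q) J (\<lambda>s. c * x s)))"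
  proof (rule LIMSEQ_unique)
    show "(\<lambda>n. \<integral>\<omega>. exp (- (\<Sum>i<n. \<Sum>s\<in>J. (A i \<omega> * W i s \<omega> / (c * x s)) powr q)) \<partial>M)
     \<longlonglongrightarrow> exp (- (enn2real (\<integral>\<^sup>+\<omega>. ennreal (U 0 \<omega>) \<partial>M) * exponent (ereal q) J (\<lambda>s. c * x s)))"
      by (rule power_series_functional[OF prob_space_axioms U_frechet Um q J]) (use x c in simp)
    show "(\<lambda>n. \<integral>\<omega>. exp (- (\<Sum>i<n. \<Sum>s\<in>J. (A i \<omega> * W i s \<omega> / (c * x s)) powr q)) \<partial>M)
     \<longlonglongrightarrow> (\<integral>\<omega>. exp (- (\<Sum>s\<in>J. (?\<nu> s (?Y \<omega>) / (c * x s)) powr q)) \<partial>M)"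
    proof (rule integral_dominated_convergence[where w="\<lambda>_. 1"])
      have "AE \<omega> in M. \<forall>s\<in>J. summable (\<lambda>i. (A i \<omega> * W i s \<omega>) powr q)"
        using AE_power_series_summable[OF prob_space_axioms U_frechet[of 0] Um q] J by (intro AE_finite_allI) auto
      then show "AE \<omega> in M. (\<lambda>n. exp (- (\<Sum>i<n. \<Sum>s\<in>J. (A i \<omega> * W i s \<omega> / (c * x s)) powr q)))
          \<longlonglongrightarrow> exp (- (\<Sum>s\<in>J. (?\<nu> s (?Y \<omega>) / (c * x s)) powr q))"
        using AE_marks_nonneg AE_space
      proof eventually_elim
        case (elim \<omega>)
        have "(\<lambda>n. \<Sum>s\<in>J. \<Sum>i<n. (A i \<omega> * W i s \<omega> / (c * x s)) powr q)
            \<longlonglongrightarrow> (\<Sum>s\<in>J. (?\<nu> s (?Y \<omega>) / (c * x s)) powr q)"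
        proof (rule tendsto_sum)
          fix s assume s: "s \<in> J"
          let ?T = "\<Sum>i. (A i \<omega> * W i s \<omega>) powr q"
          have sum: "summable (\<lambda>i. (A i \<omega> * W i s \<omega>) powr q)" using elim s by blast
          have scaled: "(A i \<omega> * W i s \<omega> / (c * x s)) powr q = (A i \<omega> * W i s \<omega>) powr q / (c * x s) powr q" for i
            by (simp add: powr_divide)
          have "0 \<le> ?T" by (intro suminf_nonneg sum) simp
          then have "(?\<nu> s (?Y \<omega>) / (c * x s)) powr q = ?T / (c * x s) powr q"
            using x[OF s] c q by (simp add: lp_norm_def powr_divide powr_inverse_cancel)
          moreover have "(\<lambda>n. \<Sum>i<n. (A i \<omega> * W i s \<omega>) powr q / (c * x s) powr q) \<longlonglongrightarrow> ?T / (c * x s) powr q"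
            unfolding sum_divide_distrib[symmetric]
            by (intro tendsto_divide tendsto_const summable_LIMSEQ[OF sum]) (use x[OF s] c in simp)
          ultimately show "(\<lambda>n. \<Sum>i<n. (A i \<omega> * W i s \<omega> / (c * x s)) powr q)
            \<longlonglongrightarrow> (?\<nu> s (?Y \<omega>) / (c * x s)) powr q"
            unfolding scaled by simp
        qed
        then have "(\<lambda>n. exp (- (\<Sum>s\<in>J. \<Sum>i<n. (A i \<omega> * W i s \<omega> / (c * x s)) powr q)))
            \<longlonglongrightarrow> exp (- (\<Sum>s\<in>J. (?\<nu> s (?Y \<omega>) / (c * x s)) powr q))"
          by (intro tendsto_exp tendsto_minus)
        then show ?case by (subst sum.swap)
      qed
      show "AE \<omega> in M. norm (exp (- (\<Sum>i<n. \<Sum>s\<in>J. (A i \<omega> * W i s \<omega> / (c * x s)) powr q))) \<le> 1" for n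
        by (intro AE_I2) (simp add: sum_nonneg)
    qed (auto simp: lp_norm_def)
  qed
  also have "enn2real (\<integral>\<^sup>+\<omega>. ennreal (U 0 \<omega>) \<partial>M) * exponent (ereal q) J (\<lambda>s. c * x s)
      = enn2real (\<integral>\<^sup>+\<omega>. ennreal (U 0 \<omega>) \<partial>M) / c * exponent (ereal q) J x"
    using exponent_scale[of "ereal q" J c x] q J c x by simp
  also have "{\<omega>\<in>space M. \<forall>s\<in>J. U s \<omega> * ?\<nu> s (?Y \<omega>) \<le> c * x s}
      = {\<omega>\<in>space M. \<forall>s\<in>J. U s \<omega> / c * lp_norm (ereal q) (\<lambda>i. A i \<omega> * W i s \<omega>) \<le> x s}"
    using c by (auto simp: field_simps)
  finally show ?thesis .
qed

end

section \<open>Moments determine finite measures\<close>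

lemma (in finite_measure) integrable_bounded:
  fixes f :: "'a \<Rightarrow> real"
  assumes "f \<in> borel_measurable M" "\<And>\<omega>. \<omega> \<in> space M \<Longrightarrow> \<bar>f \<omega>\<bar> \<le> B"
  shows "integrable M f"
  using assms by (intro integrable_const_bound[of _ B] AE_I2) auto

lemma (in finite_measure) weighted_integral_close:
  fixes f g :: "real \<Rightarrow> real"
  assumes [measurable]: "Y \<in> borel_measurable M" "G \<in> borel_measurable M" "f \<in> borel_measurable borel" "g \<in> borel_measurable borel"
    and Y: "\<And>\<omega>. \<omega> \<in> space M \<Longrightarrow> Y \<omega> \<in> {0..1}" and G: "\<And>\<omega>. \<omega> \<in> space M \<Longrightarrow> G \<omega> \<in> {0..1}"
    and B: "\<And>y. y \<in> {0..1} \<Longrightarrow> \<bar>f y\<bar> \<le> B" and e: "\<And>y. y \<in> {0..1} \<Longrightarrow> \<bar>f y - g y\<bar> \<le> e"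
  shows "\<bar>(\<integral>\<omega>. f (Y \<omega>) * G \<omega> \<partial>M) - (\<integral>\<omega>. g (Y \<omega>) * G \<omega> \<partial>M)\<bar> \<le> e * measure M (space M)"
proof -
  have bd: "\<bar>u * G \<omega>\<bar> \<le> \<bar>u\<bar>" if "\<omega> \<in> space M" for u \<omega>
    using G[OF that] by (simp add: abs_mult mult_left_le)
  have int: "integrable M (\<lambda>\<omega>. h (Y \<omega>) * G \<omega>)"
    if [measurable]: "h \<in> borel_measurable borel" and "\<And>y. y \<in> {0..1} \<Longrightarrow> \<bar>h y\<bar> \<le> C" for h :: "real \<Rightarrow> real" and C
  proof (rule integrable_bounded[of _ C])
    fix \<omega> assume "\<omega> \<in> space M"
    then show "\<bar>h (Y \<omega>) * G \<omega>\<bar> \<le> C" using that(2) Y by (intro order_trans[OF bd]) auto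
  qed measurable
  have "\<bar>g y\<bar> \<le> B + e" if "y \<in> {0..1}" for y using B[OF that] e[OF that] by linarith
  then have "(\<integral>\<omega>. f (Y \<omega>) * G \<omega> \<partial>M) - (\<integral>\<omega>. g (Y \<omega>) * G \<omega> \<partial>M) = (\<integral>\<omega>. (f (Y \<omega>) - g (Y \<omega>)) * G \<omega> \<partial>M)"
    using int[of f B] int[of g "B + e"] B by (simp add: left_diff_distrib)
  also have "\<bar>\<dots>\<bar> \<le> (\<integral>\<omega>. \<bar>(f (Y \<omega>) - g (Y \<omega>)) * G \<omega>\<bar> \<partial>M)"
    by (rule integral_abs_bound)
  also have "\<dots> \<le> (\<integral>\<omega>. e \<partial>M)"
  proof (rule integral_mono)
    show "integrable M (\<lambda>\<omega>. \<bar>(f (Y \<omega>) - g (Y \<omega>)) * G \<omega>\<bar>)"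
      using int[of "\<lambda>y. f y - g y" e] e by (intro integrable_abs) auto
    show "\<bar>(f (Y \<omega>) - g (Y \<omega>)) * G \<omega>\<bar> \<le> e" if "\<omega> \<in> space M" for \<omega>
      using e[OF Y[OF that]] bd[OF that] by (rule order_trans[rotated])
  qed simp
  finally show ?thesis by (simp add: mult.commute)
qed

text \<open>Equality passes from monomials to polynomials, by the Weierstrass theorem to continuous functions,
  and by piecewise linear ramps to indicators of half-lines. The weights \<open>G1\<close> and \<open>G2\<close> allow the
  coordinates of a process to be treated one at a time.\<close>

lemma weighted_moments_determine_halflines:
  fixes Y1 G1 :: "'a \<Rightarrow> real" and Y2 G2 :: "'b \<Rightarrow> real"
  assumes "finite_measure M1" "finite_measure M2"
    and [measurable]: "Y1 \<in> borel_measurable M1" "G1 \<in> borel_measurable M1"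
      "Y2 \<in> borel_measurable M2" "G2 \<in> borel_measurable M2"
    and Y1: "\<And>\<omega>. \<omega> \<in> space M1 \<Longrightarrow> Y1 \<omega> \<in> {0..1}" and Y2: "\<And>\<omega>. \<omega> \<in> space M2 \<Longrightarrow> Y2 \<omega> \<in> {0..1}"
    and G1: "\<And>\<omega>. \<omega> \<in> space M1 \<Longrightarrow> G1 \<omega> \<in> {0..1}" and G2: "\<And>\<omega>. \<omega> \<in> space M2 \<Longrightarrow> G2 \<omega> \<in> {0..1}"
    and moments: "\<And>j. (\<integral>\<omega>. Y1 \<omega> ^ j * G1 \<omega> \<partial>M1) = (\<integral>\<omega>. Y2 \<omega> ^ j * G2 \<omega> \<partial>M2)"
  shows "(\<integral>\<omega>. indicator {..x} (Y1 \<omega>) * G1 \<omega> \<partial>M1) = (\<integral>\<omega>. indicator {..x} (Y2 \<omega>) * G2 \<omega> \<partial>M2)"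
proof -
  interpret M1: finite_measure M1 by fact
  interpret M2: finite_measure M2 by fact
  have bd1: "\<bar>u * G1 \<omega>\<bar> \<le> \<bar>u\<bar>" if "\<omega> \<in> space M1" for u \<omega>
    using G1[OF that] by (simp add: abs_mult mult_left_le)
  have bd2: "\<bar>u * G2 \<omega>\<bar> \<le> \<bar>u\<bar>" if "\<omega> \<in> space M2" for u \<omega>
    using G2[OF that] by (simp add: abs_mult mult_left_le)
  have int1: "integrable M1 (\<lambda>\<omega>. f (Y1 \<omega>) * G1 \<omega>)"
    if [measurable]: "f \<in> borel_measurable borel" and "\<And>y. y \<in> {0..1} \<Longrightarrow> \<bar>f y\<bar> \<le> B" for f :: "real \<Rightarrow> real" and B
  proof (rule M1.integrable_bounded[of _ B])
    fix \<omega> assume "\<omega> \<in> space M1"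
    then show "\<bar>f (Y1 \<omega>) * G1 \<omega>\<bar> \<le> B" using that(2) Y1 by (intro order_trans[OF bd1]) auto
  qed measurable
  have int2: "integrable M2 (\<lambda>\<omega>. f (Y2 \<omega>) * G2 \<omega>)"
    if [measurable]: "f \<in> borel_measurable borel" and "\<And>y. y \<in> {0..1} \<Longrightarrow> \<bar>f y\<bar> \<le> B" for f :: "real \<Rightarrow> real" and B
  proof (rule M2.integrable_bounded[of _ B])
    fix \<omega> assume "\<omega> \<in> space M2"
    then show "\<bar>f (Y2 \<omega>) * G2 \<omega>\<bar> \<le> B" using that(2) Y2 by (intro order_trans[OF bd2]) auto
  qed measurable
  have poly: "(\<integral>\<omega>. (\<Sum>i\<le>n. a i * Y1 \<omega> ^ i) * G1 \<omega> \<partial>M1) = (\<integral>\<omega>. (\<Sum>i\<le>n. a i * Y2 \<omega> ^ i) * G2 \<omega> \<partial>M2)"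
    for a :: "nat \<Rightarrow> real" and n
  proof -
    have "integrable M1 (\<lambda>\<omega>. Y1 \<omega> ^ i * G1 \<omega>)" "integrable M2 (\<lambda>\<omega>. Y2 \<omega> ^ i * G2 \<omega>)" for i
      by (rule int1[of "\<lambda>y. y ^ i" 1] int2[of "\<lambda>y. y ^ i" 1]; simp add: power_le_one)+
    then show ?thesis by (simp add: sum_distrib_right mult.assoc moments)
  qed
  have cont: "(\<integral>\<omega>. f (Y1 \<omega>) * G1 \<omega> \<partial>M1) = (\<integral>\<omega>. f (Y2 \<omega>) * G2 \<omega> \<partial>M2)"
    if f: "continuous_on UNIV f" and fB: "\<And>y. \<bar>f y\<bar> \<le> 1" for f :: "real \<Rightarrow> real"
  proof -
    let ?C = "measure M1 (space M1) + measure M2 (space M2)"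
    have [measurable]: "f \<in> borel_measurable borel" using f by (rule borel_measurable_continuous_onI)
    have "\<bar>(\<integral>\<omega>. f (Y1 \<omega>) * G1 \<omega> \<partial>M1) - (\<integral>\<omega>. f (Y2 \<omega>) * G2 \<omega> \<partial>M2)\<bar> \<le> e * ?C" if "0 < e" for e
    proof -
      obtain g where g: "real_polynomial_function g" "\<And>y. y \<in> {0..1} \<Longrightarrow> \<bar>f y - g y\<bar> < e"
        using Stone_Weierstrass_real_polynomial_function[of "{0..1}" f e] continuous_on_subset[OF f] \<open>0 < e\<close>
        by auto
      then obtain a n where gs: "g = (\<lambda>x. \<Sum>i\<le>n. a i * x ^ i)"
        by (auto simp: real_polynomial_function_iff_sum)
      have [measurable]: "g \<in> borel_measurable borel" unfolding gs by measurable
      have "\<bar>(\<integral>\<omega>. f (Y1 \<omega>) * G1 \<omega> \<partial>M1) - (\<integral>\<omega>. g (Y1 \<omega>) * G1 \<omega> \<partial>M1)\<bar> \<le> e * measure M1 (space M1)"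
        using fB g(2) by (intro M1.weighted_integral_close Y1 G1) (auto intro: less_imp_le)
      moreover have "\<bar>(\<integral>\<omega>. f (Y2 \<omega>) * G2 \<omega> \<partial>M2) - (\<integral>\<omega>. g (Y2 \<omega>) * G2 \<omega> \<partial>M2)\<bar> \<le> e * measure M2 (space M2)"
        using fB g(2) by (intro M2.weighted_integral_close Y2 G2) (auto intro: less_imp_le)
      moreover have "(\<integral>\<omega>. g (Y1 \<omega>) * G1 \<omega> \<partial>M1) = (\<integral>\<omega>. g (Y2 \<omega>) * G2 \<omega> \<partial>M2)"
        unfolding gs by (rule poly)
      ultimately show ?thesis by (simp add: algebra_simps)
    qed
    note small = this
    have "\<bar>(\<integral>\<omega>. f (Y1 \<omega>) * G1 \<omega> \<partial>M1) - (\<integral>\<omega>. f (Y2 \<omega>) * G2 \<omega> \<partial>M2)\<bar> \<le> 0"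
    proof (rule field_le_epsilon)
      fix e :: real assume "0 < e"
      have scale: "0 < e / (C + 1) \<and> e / (C + 1) * C \<le> e" if "0 \<le> C" for C
        using that \<open>0 < e\<close> by (auto simp: field_simps)
      have "0 \<le> ?C" by simp
      from scale[OF this] have "0 < e / (?C + 1)" "e / (?C + 1) * ?C \<le> e" by blast+
      with small[of "e / (?C + 1)"]
      show "\<bar>(\<integral>\<omega>. f (Y1 \<omega>) * G1 \<omega> \<partial>M1) - (\<integral>\<omega>. f (Y2 \<omega>) * G2 \<omega> \<partial>M2)\<bar> \<le> 0 + e" by linarith
    qed
    then show ?thesis by simp
  qed
  (* ramps that decrease from 1 to 0 on an interval of length 1 / n to the right of x *)
  define f where "f n y = max 0 (min 1 (1 - real n * (y - x)))" for n y
  have f: "continuous_on UNIV (f n)" "\<bar>f n y\<bar> \<le> 1" for n y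
    unfolding f_def by (auto intro!: continuous_intros)
  have [measurable]: "f n \<in> borel_measurable borel" for n using f(1) by (rule borel_measurable_continuous_onI)
  have flim: "(\<lambda>n. f n y) \<longlonglongrightarrow> indicator {..x} y" for y
  proof (cases "y \<le> x")
    case True
    then have "real n * (y - x) \<le> 0" for n by (simp add: mult_nonneg_nonpos)
    then have "f n y = 1" for n unfolding f_def by (simp add: min_absorb1)
    then show ?thesis using True by simp
  next
    case False
    then obtain m where "1 < real m * (y - x)" using reals_Archimedean3[of "y - x"] by auto
    then have "f n y = 0" if "m \<le> n" for n
    proof -
      have "real m * (y - x) \<le> real n * (y - x)" using that False by (intro mult_right_mono) auto
      then show ?thesis using \<open>1 < real m * (y - x)\<close> unfolding f_def by simp
    qed
    then have "\<forall>\<^sub>F n in sequentially. f n y = indicator {..x} y"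
      using False by (auto simp: eventually_sequentially)
    then show ?thesis by (rule tendsto_eventually)
  qed
  have "(\<lambda>n. \<integral>\<omega>. f n (Y1 \<omega>) * G1 \<omega> \<partial>M1) \<longlonglongrightarrow> (\<integral>\<omega>. indicator {..x} (Y1 \<omega>) * G1 \<omega> \<partial>M1)"
    by (rule integral_dominated_convergence[where w="\<lambda>_. 1"])
      (auto intro!: tendsto_mult flim order_trans[OF bd1] f)
  moreover have "(\<lambda>n. \<integral>\<omega>. f n (Y2 \<omega>) * G2 \<omega> \<partial>M2) \<longlonglongrightarrow> (\<integral>\<omega>. indicator {..x} (Y2 \<omega>) * G2 \<omega> \<partial>M2)"
    by (rule integral_dominated_convergence[where w="\<lambda>_. 1"])
      (auto intro!: tendsto_mult flim order_trans[OF bd2] f)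
  ultimately show ?thesis
    by (simp only: cont[OF f]) (rule LIMSEQ_unique)
qed

lemma monomial_unit_interval:
  fixes Y :: "'s \<Rightarrow> 'a \<Rightarrow> real"
  assumes "\<And>s. Y s \<omega> \<in> {0..1}" shows "(\<Prod>s\<leftarrow>l. Y s \<omega>) \<in> {0..1}"
  using assms by (induction l) (auto simp: mult_le_one)

text \<open>Monomials are lists of indices. Induction on \<open>J\<close> replaces the coordinates in a mixed moment, one
  after the other, by indicators of half-lines.\<close>

lemma path_law_eqI_moments:
  fixes Y1 :: "'s \<Rightarrow> 'a \<Rightarrow> real" and Y2 :: "'s \<Rightarrow> 'b \<Rightarrow> real"
  assumes fin: "finite_measure M1" "finite_measure M2"
    and [measurable]: "\<And>s. Y1 s \<in> borel_measurable M1" "\<And>s. Y2 s \<in> borel_measurable M2"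
    and Y1: "\<And>s \<omega>. \<omega> \<in> space M1 \<Longrightarrow> Y1 s \<omega> \<in> {0..1}" and Y2: "\<And>s \<omega>. \<omega> \<in> space M2 \<Longrightarrow> Y2 s \<omega> \<in> {0..1}"
    and moments: "\<And>l. (\<integral>\<omega>. (\<Prod>s\<leftarrow>l. Y1 s \<omega>) \<partial>M1) = (\<integral>\<omega>. (\<Prod>s\<leftarrow>l. Y2 s \<omega>) \<partial>M2)"
  shows "path_law M1 Y1 = path_law M2 Y2"
proof -
  interpret M1: finite_measure M1 by fact
  interpret M2: finite_measure M2 by fact
  have [measurable]: "(\<lambda>\<omega>. \<Prod>s\<leftarrow>l. Y1 s \<omega>) \<in> borel_measurable M1" "(\<lambda>\<omega>. \<Prod>s\<leftarrow>l. Y2 s \<omega>) \<in> borel_measurable M2" for l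
    by (induction l) auto
  have step: "(\<integral>\<omega>. (\<Prod>s\<in>J. indicator {..x s} (Y1 s \<omega>)) * (\<Prod>s\<leftarrow>l. Y1 s \<omega>) \<partial>M1)
      = (\<integral>\<omega>. (\<Prod>s\<in>J. indicator {..x s} (Y2 s \<omega>)) * (\<Prod>s\<leftarrow>l. Y2 s \<omega>) \<partial>M2)" if "finite J" for J l and x :: "'s \<Rightarrow> real"
    using that
  proof (induction J arbitrary: l rule: finite_induct)
    case empty
    then show ?case by (simp add: moments)
  next
    case (insert t J)
    let ?G1 = "\<lambda>\<omega>. (\<Prod>s\<in>J. indicator {..x s} (Y1 s \<omega>)) * (\<Prod>s\<leftarrow>l. Y1 s \<omega>)"
    let ?G2 = "\<lambda>\<omega>. (\<Prod>s\<in>J. indicator {..x s} (Y2 s \<omega>)) * (\<Prod>s\<leftarrow>l. Y2 s \<omega>)"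
    have unit: "(\<Prod>s\<in>J. indicator {..x s} (Y s)) * m \<in> {0..1::real}" if "m \<in> {0..1}" for m and Y :: "'s \<Rightarrow> real"
      using that by (auto intro!: mult_le_one prod_le_1 prod_nonneg mult_nonneg_nonneg)
    have "(\<integral>\<omega>. indicator {..x t} (Y1 t \<omega>) * ?G1 \<omega> \<partial>M1) = (\<integral>\<omega>. indicator {..x t} (Y2 t \<omega>) * ?G2 \<omega> \<partial>M2)"
    proof (rule weighted_moments_determine_halflines[OF fin])
      show "?G1 \<in> borel_measurable M1" "?G2 \<in> borel_measurable M2" by measurable
      show "?G1 \<omega> \<in> {0..1}" if "\<omega> \<in> space M1" for \<omega>
        by (intro unit monomial_unit_interval Y1 that)
      show "?G2 \<omega> \<in> {0..1}" if "\<omega> \<in> space M2" for \<omega>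
        by (intro unit monomial_unit_interval Y2 that)
      show "(\<integral>\<omega>. Y1 t \<omega> ^ j * ?G1 \<omega> \<partial>M1) = (\<integral>\<omega>. Y2 t \<omega> ^ j * ?G2 \<omega> \<partial>M2)" for j
        using insert.IH[of "replicate j t @ l"] by (simp add: prod_list_replicate mult_ac)
    qed (use Y1 Y2 in auto)
    then show ?case using insert.hyps by (simp add: mult_ac)
  qed
  show ?thesis
  proof (rule finite_path_measure_eqI)
    fix J :: "'s set" and x :: "'s \<Rightarrow> real" assume J: "finite J"
    have prod_ind: "(\<Prod>s\<in>J. indicator {..x s} (Y s \<omega>)) = (indicator {\<omega>. \<forall>s\<in>J. Y s \<omega> \<le> x s} \<omega> :: real)" for Y :: "'s \<Rightarrow> 'c \<Rightarrow> real" and \<omega>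
      using J by (auto simp: indicator_def prod_zero_iff)
    have "measure M1 {\<omega>\<in>space M1. \<forall>s\<in>J. Y1 s \<omega> \<le> x s} = (\<integral>\<omega>. (\<Prod>s\<in>J. indicator {..x s} (Y1 s \<omega>)) \<partial>M1)"
      unfolding prod_ind by (simp add: Int_def conj_commute)
    moreover have "measure M2 {\<omega>\<in>space M2. \<forall>s\<in>J. Y2 s \<omega> \<le> x s} = (\<integral>\<omega>. (\<Prod>s\<in>J. indicator {..x s} (Y2 s \<omega>)) \<partial>M2)"
      unfolding prod_ind by (simp add: Int_def conj_commute)
    ultimately show "measure (path_law M1 Y1) (lower_orthant J x) = measure (path_law M2 Y2) (lower_orthant J x)"
      using step[OF J, of x "[]"] J by (simp add: measure_path_law_orthant)
  qed (auto simp: path_law_def intro!: M1.finite_measure_distr M2.finite_measure_distr measurable_path)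
qed

section \<open>Maximum and power exponents determine each other\<close>

text \<open>By max-stability the maximum has the law of one Frechet variable scaled by the \<open>q\<close>-norm of \<open>y\<close>; the
  comparison is made through the tails.\<close>

lemma frechet_max_expectation:
  fixes U :: "'s \<Rightarrow> 'a \<Rightarrow> real"
  assumes N: "prob_space N" and ind: "prob_space.indep_vars N (\<lambda>_. borel) U UNIV"
    and U: "\<And>s. has_frechet_distribution N (U s) (ereal q)" and q: "1 < q"
    and J: "finite J" and y: "\<And>s. s \<in> J \<Longrightarrow> 0 \<le> y s"
  shows "(\<integral>\<^sup>+\<omega>. ennreal (coordinate_norm \<infinity> J (\<lambda>s. U s \<omega> * y s)) \<partial>N)
    = (\<integral>\<^sup>+\<omega>. ennreal (U r \<omega>) \<partial>N) * ennreal (coordinate_norm (ereal q) J y)"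
proof -
  interpret N: prob_space N by fact
  have Um [measurable]: "U s \<in> borel_measurable N" for s using ind by (auto simp: N.indep_vars_def)
  let ?m = "\<lambda>\<omega>. coordinate_norm \<infinity> J (\<lambda>s. U s \<omega> * y s)"
  have [measurable]: "?m \<in> borel_measurable N" using J by measurable
  have "(\<integral>\<^sup>+\<omega>. ennreal (?m \<omega>) \<partial>N) = (\<integral>\<^sup>+a. (\<integral>\<^sup>+\<omega>. indicator {1<..} (a * ?m \<omega>) \<partial>N) \<partial>inverse_square_measure)"
    by (rule nn_integral_layers[symmetric, OF N.sigma_finite_measure_axioms]) measurable
  also have "\<dots> = (\<integral>\<^sup>+a. ennreal (1 - exp (- ((a * coordinate_norm (ereal q) J y) powr q))) \<partial>inverse_square_measure)"
  proof (rule nn_integral_cong)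
    fix a assume "a \<in> space inverse_square_measure"
    then have a: "0 < a" by simp
    have iff: "1 < a * ?m \<omega> \<longleftrightarrow> \<not> (\<forall>s\<in>J. \<not> 1 < a * y s * U s \<omega>)" for \<omega>
    proof -
      have "1 < a * t \<longleftrightarrow> 1 / a < t" for t using a by (simp add: field_simps)
      then have "1 < a * ?m \<omega> \<longleftrightarrow> (\<exists>t\<in>insert 0 ((\<lambda>s. U s \<omega> * y s) ` J). 1 < a * t)"
        using J a by (simp add: coordinate_norm_def del: Max_insert) (auto simp: Max_gr_iff)
      then show ?thesis by (auto simp: mult_ac)
    qed
    have "(\<integral>\<^sup>+\<omega>. indicator {1<..} (a * ?m \<omega>) \<partial>N) = (\<integral>\<^sup>+\<omega>. indicator {\<omega>\<in>space N. \<not> (\<forall>s\<in>J. \<not> 1 < a * y s * U s \<omega>)} \<omega> \<partial>N)"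
      by (intro nn_integral_cong) (auto simp: indicator_def iff)
    also have "\<dots> = emeasure N {\<omega>\<in>space N. \<not> (\<forall>s\<in>J. \<not> 1 < a * y s * U s \<omega>)}" using J by simp
    also have "\<dots> = ennreal (1 - measure N {\<omega>\<in>space N. \<forall>s\<in>J. \<not> 1 < a * y s * U s \<omega>})"
      unfolding N.emeasure_eq_measure using J by (subst N.prob_neg) auto
    also have "measure N {\<omega>\<in>space N. \<forall>s\<in>J. \<not> 1 < a * y s * U s \<omega>} = exp (- (\<Sum>s\<in>J. (a * y s) powr q))"
      using a y by (intro N.frechet_family_below[OF ind U J]) simp
    also have "(\<Sum>s\<in>J. (a * y s) powr q) = (a * coordinate_norm (ereal q) J y) powr q"
    proof -
      have "a * coordinate_norm (ereal q) J y = coordinate_norm (ereal q) J (\<lambda>s. a * y s)"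
        using a q J y by (intro coordinate_norm_scale[symmetric]) auto
      then show ?thesis using q by (simp add: coordinate_norm_def powr_inverse_cancel sum_nonneg)
    qed
    finally show "(\<integral>\<^sup>+\<omega>. indicator {1<..} (a * ?m \<omega>) \<partial>N) = ennreal (1 - exp (- ((a * coordinate_norm (ereal q) J y) powr q)))" .
  qed
  also have "\<dots> = (\<integral>\<^sup>+\<omega>. ennreal (U r \<omega>) \<partial>N) * ennreal (coordinate_norm (ereal q) J y)"
    by (rule frechet_layers[OF N U Um coordinate_norm_nonneg[OF J]])
  finally show ?thesis .
qed

context spectral_process
begin

lemma power_exponent_from_max:
  fixes U :: "int \<Rightarrow> 'a \<Rightarrow> real"
  assumes N: "prob_space N" and ind: "prob_space.indep_vars N (\<lambda>_. borel) U UNIV"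
    and U: "\<And>s. has_frechet_distribution N (U s) (ereal q)" and q: "1 < q"
    and J: "finite J" and x: "\<And>s. s \<in> J \<Longrightarrow> 0 < x s"
  shows "(\<integral>\<^sup>+\<omega>. ennreal (U 0 \<omega>) \<partial>N) * ennreal (exponent (ereal q) J x)
    = (\<integral>\<^sup>+\<omega>. ennreal (exponent \<infinity> J (\<lambda>s. x s / U s \<omega>)) \<partial>N)"
proof -
  interpret N: prob_space N by fact
  interpret P: prob_space P by (rule prob_space_P)
  interpret NP: pair_prob_space N P ..
  have Um [measurable]: "U s \<in> borel_measurable N" for s using ind by (auto simp: N.indep_vars_def)
  have pos: "AE \<omega> in N. \<forall>s\<in>J. 0 < U s \<omega>"
    using J frechet_AE_pos[OF N U Um] by (intro AE_finite_allI) auto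
  have "(\<integral>\<^sup>+\<omega>. ennreal (U 0 \<omega>) \<partial>N) * ennreal (exponent (ereal q) J x)
     = (\<integral>\<^sup>+w. (\<integral>\<^sup>+\<omega>. ennreal (U 0 \<omega>) \<partial>N) * ennreal (coordinate_norm (ereal q) J (\<lambda>s. V s w / x s)) \<partial>P)"
    using nn_integral_exponent[of "ereal q" J x] q J x by (simp add: nn_integral_cmult)
  also have "\<dots> = (\<integral>\<^sup>+w. (\<integral>\<^sup>+\<omega>. ennreal (coordinate_norm \<infinity> J (\<lambda>s. U s \<omega> * (V s w / x s))) \<partial>N) \<partial>P)"
    using x by (intro nn_integral_cong frechet_max_expectation[symmetric, OF N ind U q J])
      (simp add: spectral_nonneg less_imp_le)
  also have "\<dots> = (\<integral>\<^sup>+\<omega>. (\<integral>\<^sup>+w. ennreal (coordinate_norm \<infinity> J (\<lambda>s. U s \<omega> * (V s w / x s))) \<partial>P) \<partial>N)"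
    by (rule NP.Fubini'[of "\<lambda>\<omega> w. ennreal (coordinate_norm \<infinity> J (\<lambda>s. U s \<omega> * (V s w / x s)))"]) (use J in measurable)
  also have "\<dots> = (\<integral>\<^sup>+\<omega>. ennreal (exponent \<infinity> J (\<lambda>s. x s / U s \<omega>)) \<partial>N)"
  proof (rule nn_integral_cong_AE)
    show "AE \<omega> in N. (\<integral>\<^sup>+w. ennreal (coordinate_norm \<infinity> J (\<lambda>s. U s \<omega> * (V s w / x s))) \<partial>P)
        = ennreal (exponent \<infinity> J (\<lambda>s. x s / U s \<omega>))"
      using pos
    proof eventually_elim
      case (elim \<omega>)
      have "(\<integral>\<^sup>+w. ennreal (coordinate_norm \<infinity> J (\<lambda>s. V s w / (x s / U s \<omega>))) \<partial>P) = ennreal (exponent \<infinity> J (\<lambda>s. x s / U s \<omega>))"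
        using elim J x by (intro nn_integral_exponent) auto
      then show ?case by (simp add: mult.commute)
    qed
  qed
  finally show ?thesis .
qed

end

text \<open>By \<open>power_exponent_from_max\<close> an exponent of order \<open>q\<close> is an average of exponents of order \<open>\<infinity>\<close> with
  randomly scaled thresholds, up to a factor that is positive and finite.\<close>

lemma max_exponents_determine_power_exponents:
  fixes U :: "int \<Rightarrow> 'a \<Rightarrow> real"
  assumes V1: "spectral_process P1 V1" and V2: "spectral_process P2 V2"
    and N: "prob_space N" and ind: "prob_space.indep_vars N (\<lambda>_. borel) U UNIV"
    and U: "\<And>s. has_frechet_distribution N (U s) (ereal q)" and q: "1 < q"
    and eq: "\<And>J x. finite J \<Longrightarrow> (\<And>s. s \<in> J \<Longrightarrow> 0 < x s) \<Longrightarrow>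
      spectral_process.exponent P1 V1 \<infinity> J x = spectral_process.exponent P2 V2 \<infinity> J x"
    and J: "finite J" and x: "\<And>s. s \<in> J \<Longrightarrow> 0 < x s"
  shows "spectral_process.exponent P1 V1 (ereal q) J x = spectral_process.exponent P2 V2 (ereal q) J x"
proof -
  interpret V1: spectral_process P1 V1 by fact
  interpret V2: spectral_process P2 V2 by fact
  interpret N: prob_space N by fact
  have Um [measurable]: "U s \<in> borel_measurable N" for s using ind by (auto simp: N.indep_vars_def)
  let ?K = "\<integral>\<^sup>+\<omega>. ennreal (U 0 \<omega>) \<partial>N"
  have pos: "AE \<omega> in N. \<forall>s\<in>J. 0 < U s \<omega>"
    using J frechet_AE_pos[OF N U Um] by (intro AE_finite_allI) auto
  have "?K * ennreal (V1.exponent (ereal q) J x) = (\<integral>\<^sup>+\<omega>. ennreal (V1.exponent \<infinity> J (\<lambda>s. x s / U s \<omega>)) \<partial>N)"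
    by (rule V1.power_exponent_from_max[OF N ind U q J x])
  also have "\<dots> = (\<integral>\<^sup>+\<omega>. ennreal (V2.exponent \<infinity> J (\<lambda>s. x s / U s \<omega>)) \<partial>N)"
  proof (rule nn_integral_cong_AE)
    show "AE \<omega> in N. ennreal (V1.exponent \<infinity> J (\<lambda>s. x s / U s \<omega>)) = ennreal (V2.exponent \<infinity> J (\<lambda>s. x s / U s \<omega>))"
      using pos by eventually_elim (use x in \<open>simp add: eq[OF J]\<close>)
  qed
  also have "\<dots> = ?K * ennreal (V2.exponent (ereal q) J x)"
    by (rule V2.power_exponent_from_max[symmetric, OF N ind U q J x])
  finally have "ennreal (V1.exponent (ereal q) J x) = ennreal (V2.exponent (ereal q) J x)"
    using frechet_mean_pos[OF N U[of 0] Um] frechet_mean_finite[OF N U[of 0] Um q]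
    by (auto simp: ennreal_mult_cancel_left)
  then show ?thesis using V1.exponent_nonneg[OF J] V2.exponent_nonneg[OF J] by simp
qed

lemma count_list_pos: "s \<in> set l \<Longrightarrow> 0 < count_list l s"
  by (metis count_list_0_iff gr0I)

lemma sum_list_by_multiplicity:
  fixes f :: "'s \<Rightarrow> real"
  shows "(\<Sum>s\<leftarrow>l. f s) = (\<Sum>s\<in>set l. real (count_list l s) * f s)"
proof -
  have "(\<Sum>s\<leftarrow>l. f s) = (\<Sum>s\<in>S. real (count_list l s) * f s)" if "finite S" "set l \<subseteq> S" for S
    using that(2)
  proof (induction l)
    case (Cons a l)
    have "(\<Sum>s\<in>S. real (count_list (a # l) s) * f s) = (\<Sum>s\<in>S. (if s = a then f s else 0) + real (count_list l s) * f s)"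
      by (intro sum.cong refl) (auto simp: algebra_simps)
    then show ?case using Cons that(1) by (simp add: sum.distrib sum.delta)
  qed simp
  then show ?thesis by simp
qed

context spectral_process
begin

text \<open>The image of this measure under \<open>(a, \<omega>) \<mapsto> (a * V s \<omega>)\<close> is the exponent measure of the max-stable
  process with spectral process \<open>V\<close>.\<close>

definition intensity :: "(real \<times> 'w) measure"
  where "intensity = inverse_square_measure \<Otimes>\<^sub>M P"

text \<open>In the coordinates \<open>exp (- z powr q)\<close>, which take values in the unit interval, Laplace transforms
  become moments.\<close>

definition laplace_coordinate :: "real \<Rightarrow> int \<Rightarrow> real \<times> 'w \<Rightarrow> real"
  where "laplace_coordinate q s = (\<lambda>(a, \<omega>). exp (- ((a * V s \<omega>) powr q)))"

text \<open>The density, which vanishes like \<open>z powr q\<close> as the coordinate \<open>z\<close> at \<open>t\<close> tends to \<open>0\<close>, makes the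
  infinite intensity finite.\<close>

definition jump_measure :: "real \<Rightarrow> int \<Rightarrow> (real \<times> 'w) measure"
  where "jump_measure q t = density intensity (\<lambda>z. ennreal (1 - laplace_coordinate q t z))"

lemma measurable_point_coordinate [measurable]: "(\<lambda>a. a) \<in> borel_measurable inverse_square_measure"
  by (rule borel_measurable_inverse_square) simp

lemma sets_intensity [measurable_cong]: "sets intensity = sets (inverse_square_measure \<Otimes>\<^sub>M P)"
  by (simp add: intensity_def)

lemma space_intensity: "space intensity = {0<..} \<times> space P"
  by (simp add: intensity_def space_pair_measure)

lemma nn_integral_intensity:
  assumes [measurable]: "f \<in> borel_measurable (inverse_square_measure \<Otimes>\<^sub>M P)"
  shows "(\<integral>\<^sup>+z. f z \<partial>intensity) = (\<integral>\<^sup>+\<omega>. (\<integral>\<^sup>+a. f (a, \<omega>) \<partial>inverse_square_measure) \<partial>P)"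
proof -
  interpret I: sigma_finite_measure inverse_square_measure by (rule sigma_finite_inverse_square)
  interpret P: prob_space P by (rule prob_space_P)
  interpret IP: pair_sigma_finite inverse_square_measure P ..
  show ?thesis unfolding intensity_def by (rule IP.nn_integral_snd[symmetric]) measurable
qed

text \<open>Some \<open>a * V s \<omega>\<close> exceeds its threshold iff \<open>a\<close> times the maximum of the quotients exceeds \<open>1\<close>.\<close>

lemma exceedance_measure:
  assumes J: "finite J" and x: "\<And>s. s \<in> J \<Longrightarrow> 0 < x s"
  shows "(\<integral>\<^sup>+z. indicator {(a, \<omega>). \<exists>s\<in>J. x s < a * V s \<omega>} z \<partial>intensity) = ennreal (exponent \<infinity> J x)"
proof -
  let ?m = "\<lambda>\<omega>. coordinate_norm \<infinity> J (\<lambda>s. V s \<omega> / x s)"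
  have m [measurable]: "?m \<in> borel_measurable P" using J by measurable
  interpret I: sigma_finite_measure inverse_square_measure by (rule sigma_finite_inverse_square)
  interpret P: prob_space P by (rule prob_space_P)
  interpret IP: pair_sigma_finite inverse_square_measure P ..
  have iff: "1 < a * ?m \<omega> \<longleftrightarrow> (\<exists>s\<in>J. x s < a * V s \<omega>)" if a: "0 < a" for a \<omega>
  proof -
    have "1 < a * t \<longleftrightarrow> 1 / a < t" for t using a by (simp add: field_simps)
    then have "1 < a * ?m \<omega> \<longleftrightarrow> (\<exists>t\<in>insert 0 ((\<lambda>s. V s \<omega> / x s) ` J). 1 < a * t)"
      using J a by (simp add: coordinate_norm_def del: Max_insert) (auto simp: Max_gr_iff)
    also have "\<dots> \<longleftrightarrow> (\<exists>s\<in>J. x s < a * V s \<omega>)" using x by (auto simp: field_simps)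
    finally show ?thesis .
  qed
  have "(\<integral>\<^sup>+z. indicator {(a, \<omega>). \<exists>s\<in>J. x s < a * V s \<omega>} z \<partial>intensity)
     = (\<integral>\<^sup>+z. indicator {1<..} (fst z * ?m (snd z)) \<partial>intensity)"
    by (intro nn_integral_cong) (auto simp: space_intensity indicator_def iff)
  also have "\<dots> = (\<integral>\<^sup>+a. (\<integral>\<^sup>+\<omega>. indicator {1<..} (a * ?m \<omega>) \<partial>P) \<partial>inverse_square_measure)"
    unfolding intensity_def by (subst P.nn_integral_fst[symmetric]) auto
  also have "\<dots> = (\<integral>\<^sup>+\<omega>. ennreal (?m \<omega>) \<partial>P)"
    by (rule nn_integral_layers[OF P.sigma_finite_measure_axioms m])
  also have "\<dots> = ennreal (exponent \<infinity> J x)"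
    using J x by (intro nn_integral_exponent) auto
  finally show ?thesis .
qed

lemma laplace_coordinate_unit: "laplace_coordinate q s z \<in> {0..1}"
  by (simp add: laplace_coordinate_def case_prod_beta)

lemma measurable_laplace_coordinate [measurable]:
  "laplace_coordinate q s \<in> borel_measurable (inverse_square_measure \<Otimes>\<^sub>M P)"
  unfolding laplace_coordinate_def by measurable

lemma measurable_monomial [measurable]:
  "(\<lambda>z. \<Prod>s\<leftarrow>l. laplace_coordinate q s z) \<in> borel_measurable (inverse_square_measure \<Otimes>\<^sub>M P)"
  by (induction l) auto

text \<open>A monomial in the Laplace coordinates is \<open>exp (- (a * m) powr q)\<close>, where \<open>m\<close> is a \<open>q\<close>-norm weighted by
  the multiplicities in \<open>l\<close>; \<open>frechet_layers\<close> integrates over \<open>a\<close>.\<close>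

lemma laplace_functional:
  assumes N: "prob_space N" and U: "has_frechet_distribution N U (ereal q)" and Um: "U \<in> borel_measurable N" and q: "1 < q"
  shows "(\<integral>\<^sup>+z. ennreal (1 - (\<Prod>s\<leftarrow>l. laplace_coordinate q s z)) \<partial>intensity)
    = (\<integral>\<^sup>+\<omega>. ennreal (U \<omega>) \<partial>N) * ennreal (exponent (ereal q) (set l) (\<lambda>s. real (count_list l s) powr (- 1 / q)))"
proof -
  let ?x = "\<lambda>s. real (count_list l s) powr (- 1 / q)"
  let ?m = "\<lambda>\<omega>. coordinate_norm (ereal q) (set l) (\<lambda>s. V s \<omega> / ?x s)"
  have x: "0 < ?x s" if "s \<in> set l" for s
    using that by (simp add: count_list_pos)
  have Y: "(\<Prod>s\<leftarrow>l. laplace_coordinate q s (a, \<omega>)) = exp (- ((a * ?m \<omega>) powr q))" if "0 < a" "\<omega> \<in> space P" for a \<omega>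
  proof -
    have "(\<Prod>s\<leftarrow>l. laplace_coordinate q s (a, \<omega>)) = exp (- (\<Sum>s\<leftarrow>l. (a * V s \<omega>) powr q))"
      by (induction l) (auto simp: laplace_coordinate_def exp_add[symmetric])
    also have "(\<Sum>s\<leftarrow>l. (a * V s \<omega>) powr q) = (\<Sum>s\<in>set l. real (count_list l s) * (a * V s \<omega>) powr q)"
      by (rule sum_list_by_multiplicity)
    also have "\<dots> = (\<Sum>s\<in>set l. (a * (V s \<omega> / ?x s)) powr q)"
    proof (intro sum.cong refl)
      fix s assume "s \<in> set l"
      then have c: "0 < real (count_list l s)" by (simp add: count_list_pos)
      have "a * (V s \<omega> / ?x s) = real (count_list l s) powr (1 / q) * (a * V s \<omega>)"
        using c by (simp add: powr_minus_divide)
      then have "(a * (V s \<omega> / ?x s)) powr q = (real (count_list l s) powr (1 / q)) powr q * (a * V s \<omega>) powr q"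
        using that spectral_nonneg[of \<omega> s] by (simp add: powr_mult)
      then show "real (count_list l s) * (a * V s \<omega>) powr q = (a * (V s \<omega> / ?x s)) powr q"
        using q c by (simp add: powr_inverse_cancel)
    qed
    also have "\<dots> = (coordinate_norm (ereal q) (set l) (\<lambda>s. a * (V s \<omega> / ?x s))) powr q"
      using q by (simp add: coordinate_norm_def powr_inverse_cancel sum_nonneg)
    also have "coordinate_norm (ereal q) (set l) (\<lambda>s. a * (V s \<omega> / ?x s)) = a * ?m \<omega>"
      using that q x spectral_nonneg by (intro coordinate_norm_scale) (auto simp: less_imp_le)
    finally show ?thesis .
  qed
  have "(\<integral>\<^sup>+z. ennreal (1 - (\<Prod>s\<leftarrow>l. laplace_coordinate q s z)) \<partial>intensity)
     = (\<integral>\<^sup>+\<omega>. (\<integral>\<^sup>+a. ennreal (1 - (\<Prod>s\<leftarrow>l. laplace_coordinate q s (a, \<omega>))) \<partial>inverse_square_measure) \<partial>P)"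
    by (rule nn_integral_intensity) measurable
  also have "\<dots> = (\<integral>\<^sup>+\<omega>. (\<integral>\<^sup>+a. ennreal (1 - exp (- ((a * ?m \<omega>) powr q))) \<partial>inverse_square_measure) \<partial>P)"
    by (intro nn_integral_cong) (simp add: Y)
  also have "\<dots> = (\<integral>\<^sup>+\<omega>. (\<integral>\<^sup>+\<omega>. ennreal (U \<omega>) \<partial>N) * ennreal (?m \<omega>) \<partial>P)"
    by (intro nn_integral_cong frechet_layers[OF N U Um] coordinate_norm_nonneg) simp
  also have "\<dots> = (\<integral>\<^sup>+\<omega>. ennreal (U \<omega>) \<partial>N) * ennreal (exponent (ereal q) (set l) ?x)"
    using nn_integral_exponent[of "ereal q" "set l" ?x] q x by (simp add: nn_integral_cmult)
  finally show ?thesis .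
qed

lemma nn_integral_jump_measure:
  assumes [measurable]: "f \<in> borel_measurable (inverse_square_measure \<Otimes>\<^sub>M P)"
  shows "(\<integral>\<^sup>+z. f z \<partial>jump_measure q t) = (\<integral>\<^sup>+z. ennreal (1 - laplace_coordinate q t z) * f z \<partial>intensity)"
  unfolding jump_measure_def by (rule nn_integral_density) measurable

lemma sets_jump_measure [measurable_cong]: "sets (jump_measure q t) = sets (inverse_square_measure \<Otimes>\<^sub>M P)"
  by (simp add: jump_measure_def sets_intensity)

text \<open>The density of the jump measure is \<open>1\<close> minus the coordinate at \<open>t\<close>, so the moments are differences
  of the integrals in \<open>laplace_functional\<close>; the right-hand side involves \<open>V\<close> only through its exponents
  of order \<open>q\<close>.\<close>

lemma jump_moments:
  assumes N: "prob_space N" and U: "has_frechet_distribution N U (ereal q)" and Um: "U \<in> borel_measurable N" and q: "1 < q"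
  defines "\<Psi> \<equiv> \<lambda>l. (\<integral>\<^sup>+\<omega>. ennreal (U \<omega>) \<partial>N) * ennreal (exponent (ereal q) (set l) (\<lambda>s. real (count_list l s) powr (- 1 / q)))"
  shows "finite_measure (jump_measure q t)"
    and "(\<integral>z. (\<Prod>s\<leftarrow>l. laplace_coordinate q s z) \<partial>jump_measure q t) = enn2real (\<Psi> (t # l) - \<Psi> l)"
proof -
  note unit = laplace_coordinate_unit[of q]
  have mon: "(\<Prod>s\<leftarrow>l. laplace_coordinate q s z) \<in> {0..1}" for l z
    by (rule monomial_unit_interval) (rule unit)
  have fin: "\<Psi> l < \<infinity>" for l
    using frechet_mean_finite[OF N U Um q] by (simp add: \<Psi>_def ennreal_mult_less_top)
  have \<Psi>: "(\<integral>\<^sup>+z. ennreal (1 - (\<Prod>s\<leftarrow>l. laplace_coordinate q s z)) \<partial>intensity) = \<Psi> l" for l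
    unfolding \<Psi>_def by (rule laplace_functional[OF N U Um q])
  have "emeasure (jump_measure q t) (space (jump_measure q t)) = (\<integral>\<^sup>+z. 1 \<partial>jump_measure q t)" by simp
  also have "\<dots> = \<Psi> [t]"
    unfolding \<Psi>[symmetric] by (subst nn_integral_jump_measure) simp_all
  finally show "finite_measure (jump_measure q t)" using fin[of "[t]"] by (intro finite_measureI) simp
  have "(\<integral>z. (\<Prod>s\<leftarrow>l. laplace_coordinate q s z) \<partial>jump_measure q t)
      = enn2real (\<integral>\<^sup>+z. ennreal (\<Prod>s\<leftarrow>l. laplace_coordinate q s z) \<partial>jump_measure q t)"
    by (rule integral_eq_nn_integral) (use mon in auto)
  also have "(\<integral>\<^sup>+z. ennreal (\<Prod>s\<leftarrow>l. laplace_coordinate q s z) \<partial>jump_measure q t)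
      = (\<integral>\<^sup>+z. ennreal ((1 - laplace_coordinate q t z) * (\<Prod>s\<leftarrow>l. laplace_coordinate q s z)) \<partial>intensity)"
    using unit mon by (subst nn_integral_jump_measure) (auto simp: ennreal_mult)
  also have "\<dots> = \<Psi> (t # l) - \<Psi> l"
  proof -
    have "\<Psi> l + (\<integral>\<^sup>+z. ennreal ((1 - laplace_coordinate q t z) * (\<Prod>s\<leftarrow>l. laplace_coordinate q s z)) \<partial>intensity)
       = (\<integral>\<^sup>+z. ennreal (1 - (\<Prod>s\<leftarrow>l. laplace_coordinate q s z))
            + ennreal ((1 - laplace_coordinate q t z) * (\<Prod>s\<leftarrow>l. laplace_coordinate q s z)) \<partial>intensity)"
      unfolding \<Psi>[symmetric] by (rule nn_integral_add[symmetric]) measurable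
    also have "\<dots> = (\<integral>\<^sup>+z. ennreal (1 - (\<Prod>s\<leftarrow>t # l. laplace_coordinate q s z)) \<partial>intensity)"
    proof (rule nn_integral_cong)
      fix z
      show "ennreal (1 - (\<Prod>s\<leftarrow>l. laplace_coordinate q s z)) + ennreal ((1 - laplace_coordinate q t z) * (\<Prod>s\<leftarrow>l. laplace_coordinate q s z))
          = ennreal (1 - (\<Prod>s\<leftarrow>t # l. laplace_coordinate q s z))"
        using unit[where s=t and z=z] mon[where l=l and z=z]
          mult_left_le_one_le[of "\<Prod>s\<leftarrow>l. laplace_coordinate q s z" "laplace_coordinate q t z"]
        by (subst ennreal_plus[symmetric]) (auto simp: algebra_simps)
    qed
    also have "\<dots> = \<Psi> (t # l)" by (rule \<Psi>)
    finally show ?thesis using fin[of l] by (metis ennreal_add_diff_cancel_left infinity_ennreal_def less_irrefl)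
  qed
  finally show "(\<integral>z. (\<Prod>s\<leftarrow>l. laplace_coordinate q s z) \<partial>jump_measure q t) = enn2real (\<Psi> (t # l) - \<Psi> l)" .
qed

text \<open>The event is bounded away from the zeros of the density of the jump measure, which can therefore
  be divided out.\<close>

lemma first_exceedance:
  assumes q: "1 < q" and J: "finite J" and x: "\<And>s. s \<in> insert t J \<Longrightarrow> 0 < x s"
  shows "(\<integral>\<^sup>+z. indicator {(a, \<omega>). x t < a * V t \<omega> \<and> (\<forall>s\<in>J. a * V s \<omega> \<le> x s)} z \<partial>intensity)
    = (\<integral>\<^sup>+y. indicator {y. y t < exp (- (x t powr q)) \<and> (\<forall>s\<in>J. exp (- (x s powr q)) \<le> y s)} y / ennreal (1 - y t)
        \<partial>path_law (jump_measure q t) (laplace_coordinate q))"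
proof -
  let ?G = "{y. y t < exp (- (x t powr q)) \<and> (\<forall>s\<in>J. exp (- (x s powr q)) \<le> y s)}"
  let ?g = "\<lambda>y. indicator ?G y / ennreal (1 - y t)"
  have "{y\<in>space path_space. y t < exp (- (x t powr q)) \<and> (\<forall>s\<in>J. exp (- (x s powr q)) \<le> y s)} \<in> sets path_space"
    using J by measurable
  then have [measurable]: "?G \<in> sets path_space" by simp
  have gm [measurable]: "?g \<in> borel_measurable path_space" by measurable
  have pm: "(\<lambda>z s. laplace_coordinate q s z) \<in> measurable (inverse_square_measure \<Otimes>\<^sub>M P) path_space"
    by (rule measurable_path) measurable
  have pm': "(\<lambda>z s. laplace_coordinate q s z) \<in> measurable (jump_measure q t) path_space"
    using pm by (simp add: measurable_cong_sets[OF sets_jump_measure refl])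
  have mono: "exp (- (b powr q)) < exp (- (c powr q)) \<longleftrightarrow> c < b" if "0 \<le> b" "0 \<le> c" for b c
    using that q powr_less_mono2[of q c b] powr_mono2[of q b c] by (auto simp: not_le[symmetric])
  have "(\<integral>\<^sup>+y. ?g y \<partial>path_law (jump_measure q t) (laplace_coordinate q))
      = (\<integral>\<^sup>+z. ?g (\<lambda>s. laplace_coordinate q s z) \<partial>jump_measure q t)"
    unfolding path_law_def using gm by (subst nn_integral_distr[OF pm']) auto
  also have "\<dots> = (\<integral>\<^sup>+z. ennreal (1 - laplace_coordinate q t z) * ?g (\<lambda>s. laplace_coordinate q s z) \<partial>intensity)"
    by (rule nn_integral_jump_measure) (rule measurable_compose[OF pm gm])
  also have "\<dots> = (\<integral>\<^sup>+z. indicator {(a, \<omega>). x t < a * V t \<omega> \<and> (\<forall>s\<in>J. a * V s \<omega> \<le> x s)} z \<partial>intensity)"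
  proof (rule nn_integral_cong)
    fix z assume "z \<in> space intensity"
    then obtain a \<omega> where z: "z = (a, \<omega>)" "0 < a" "\<omega> \<in> space P" by (auto simp: space_intensity)
    have nn: "0 \<le> a * V s \<omega>" for s using z spectral_nonneg by simp
    have "laplace_coordinate q t z < exp (- (x t powr q)) \<longleftrightarrow> x t < a * V t \<omega>"
      using mono[OF nn[of t], of "x t"] x[of t] z by (simp add: laplace_coordinate_def less_imp_le)
    moreover have "exp (- (x s powr q)) \<le> laplace_coordinate q s z \<longleftrightarrow> a * V s \<omega> \<le> x s" if "s \<in> J" for s
      using mono[OF nn[of s], of "x s"] x[of s] z that unfolding laplace_coordinate_def
      by (simp only: not_less[symmetric]) (simp add: less_imp_le)
    ultimately have iff: "(\<lambda>s. laplace_coordinate q s z) \<in> ?G \<longleftrightarrow> z \<in> {(a, \<omega>). x t < a * V t \<omega> \<and> (\<forall>s\<in>J. a * V s \<omega> \<le> x s)}"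
      using z by auto
    show "ennreal (1 - laplace_coordinate q t z) * ?g (\<lambda>s. laplace_coordinate q s z)
        = indicator {(a, \<omega>). x t < a * V t \<omega> \<and> (\<forall>s\<in>J. a * V s \<omega> \<le> x s)} z"
    proof (cases "(\<lambda>s. laplace_coordinate q s z) \<in> ?G")
      case True
      have "exp (- (x t powr q)) \<le> 1" by simp
      with True have "laplace_coordinate q t z < 1" by (auto intro: less_le_trans)
      then have "0 < 1 - laplace_coordinate q t z" by simp
      then have "ennreal (1 - laplace_coordinate q t z) * (1 / ennreal (1 - laplace_coordinate q t z)) = 1"
        by (simp add: ennreal_times_divide ennreal_divide_self)
      then show ?thesis using True iff by (simp only: indicator_simps)
    next
      case False
      then show ?thesis using iff by (simp only: indicator_simps) simp
    qed
  qed
  finally show ?thesis by simp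
qed

lemma exceedance_insert:
  assumes "finite J"
  shows "(\<integral>\<^sup>+z. indicator {(a, \<omega>). \<exists>s\<in>insert t J. x s < a * V s \<omega>} z \<partial>intensity)
    = (\<integral>\<^sup>+z. indicator {(a, \<omega>). \<exists>s\<in>J. x s < a * V s \<omega>} z \<partial>intensity)
      + (\<integral>\<^sup>+z. indicator {(a, \<omega>). x t < a * V t \<omega> \<and> (\<forall>s\<in>J. a * V s \<omega> \<le> x s)} z \<partial>intensity)"
proof -
  have "{z\<in>space intensity. \<exists>s\<in>J. x s < fst z * V s (snd z)} \<in> sets intensity"
    "{z\<in>space intensity. x t < fst z * V t (snd z) \<and> (\<forall>s\<in>J. fst z * V s (snd z) \<le> x s)} \<in> sets intensity"
    using assms by measurable
  then have m: "(\<lambda>z. indicator {z\<in>space intensity. \<exists>s\<in>J. x s < fst z * V s (snd z)} z :: ennreal) \<in> borel_measurable intensity"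
    "(\<lambda>z. indicator {z\<in>space intensity. x t < fst z * V t (snd z) \<and> (\<forall>s\<in>J. fst z * V s (snd z) \<le> x s)} z :: ennreal) \<in> borel_measurable intensity"
    by measurable
  have "(\<integral>\<^sup>+z. indicator {(a, \<omega>). \<exists>s\<in>insert t J. x s < a * V s \<omega>} z \<partial>intensity)
    = (\<integral>\<^sup>+z. indicator {z\<in>space intensity. \<exists>s\<in>J. x s < fst z * V s (snd z)} z
        + indicator {z\<in>space intensity. x t < fst z * V t (snd z) \<and> (\<forall>s\<in>J. fst z * V s (snd z) \<le> x s)} z \<partial>intensity)"
  proof (rule nn_integral_cong)
    fix z assume z: "z \<in> space intensity"
    obtain a \<omega> where "z = (a, \<omega>)" by fastforce
    with z show "indicator {(a, \<omega>). \<exists>s\<in>insert t J. x s < a * V s \<omega>} z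
      = (indicator {z\<in>space intensity. \<exists>s\<in>J. x s < fst z * V s (snd z)} z
        + indicator {z\<in>space intensity. x t < fst z * V t (snd z) \<and> (\<forall>s\<in>J. fst z * V s (snd z) \<le> x s)} z :: ennreal)"
      by (cases "\<exists>s\<in>J. x s < a * V s \<omega>") (auto simp: not_less indicator_def dest: leD)
  qed
  also have "\<dots> = (\<integral>\<^sup>+z. indicator {z\<in>space intensity. \<exists>s\<in>J. x s < fst z * V s (snd z)} z \<partial>intensity)
      + (\<integral>\<^sup>+z. indicator {z\<in>space intensity. x t < fst z * V t (snd z) \<and> (\<forall>s\<in>J. fst z * V s (snd z) \<le> x s)} z \<partial>intensity)"
    by (rule nn_integral_add[OF m])
  also have "(\<integral>\<^sup>+z. indicator {z\<in>space intensity. \<exists>s\<in>J. x s < fst z * V s (snd z)} z \<partial>intensity)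
      = (\<integral>\<^sup>+z. indicator {(a, \<omega>). \<exists>s\<in>J. x s < a * V s \<omega>} z \<partial>intensity)"
    by (intro nn_integral_cong) (auto simp: indicator_def)
  also have "(\<integral>\<^sup>+z. indicator {z\<in>space intensity. x t < fst z * V t (snd z) \<and> (\<forall>s\<in>J. fst z * V s (snd z) \<le> x s)} z \<partial>intensity)
      = (\<integral>\<^sup>+z. indicator {(a, \<omega>). x t < a * V t \<omega> \<and> (\<forall>s\<in>J. a * V s \<omega> \<le> x s)} z \<partial>intensity)"
    by (intro nn_integral_cong) (auto simp: indicator_def)
  finally show ?thesis .
qed

end

text \<open>The jump measures have equal moments, hence equal laws. These give the intensity of the set where
  \<open>t\<close> is an exceedance and no element of \<open>J\<close> is, and such sets partition the set of all exceedances.\<close>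

lemma power_exponents_determine_max_exponents:
  assumes V1: "spectral_process P1 V1" and V2: "spectral_process P2 V2"
    and N: "prob_space N" and U: "has_frechet_distribution N U (ereal q)" and Um: "U \<in> borel_measurable N" and q: "1 < q"
    and eq: "\<And>J x. finite J \<Longrightarrow> (\<And>s. s \<in> J \<Longrightarrow> 0 < x s) \<Longrightarrow>
      spectral_process.exponent P1 V1 (ereal q) J x = spectral_process.exponent P2 V2 (ereal q) J x"
    and J: "finite J" and x: "\<And>s. s \<in> J \<Longrightarrow> 0 < x s"
  shows "spectral_process.exponent P1 V1 \<infinity> J x = spectral_process.exponent P2 V2 \<infinity> J x"
proof -
  interpret V1: spectral_process P1 V1 by fact
  interpret V2: spectral_process P2 V2 by fact
  have laws: "path_law (V1.jump_measure q t) (V1.laplace_coordinate q) = path_law (V2.jump_measure q t) (V2.laplace_coordinate q)" for t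
  proof (rule path_law_eqI_moments)
    show "finite_measure (V1.jump_measure q t)" "finite_measure (V2.jump_measure q t)"
      by (rule V1.jump_moments[OF N U Um q] V2.jump_moments[OF N U Um q])+
    show "V1.laplace_coordinate q s \<in> borel_measurable (V1.jump_measure q t)"
      "V2.laplace_coordinate q s \<in> borel_measurable (V2.jump_measure q t)" for s
      by (simp_all add: measurable_cong_sets[OF V1.sets_jump_measure refl] measurable_cong_sets[OF V2.sets_jump_measure refl]
          V1.measurable_laplace_coordinate V2.measurable_laplace_coordinate)
    have "V1.exponent (ereal q) (set l) (\<lambda>s. real (count_list l s) powr (- 1 / q))
        = V2.exponent (ereal q) (set l) (\<lambda>s. real (count_list l s) powr (- 1 / q))" for l
      by (rule eq) (auto simp: count_list_pos)
    then show "(\<integral>z. (\<Prod>s\<leftarrow>l. V1.laplace_coordinate q s z) \<partial>V1.jump_measure q t)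
        = (\<integral>z. (\<Prod>s\<leftarrow>l. V2.laplace_coordinate q s z) \<partial>V2.jump_measure q t)" for l
      by (simp only: V1.jump_moments(2)[OF N U Um q] V2.jump_moments(2)[OF N U Um q])
  qed (rule V1.laplace_coordinate_unit V2.laplace_coordinate_unit)+
  have "(\<integral>\<^sup>+z. indicator {(a, \<omega>). \<exists>s\<in>J. x s < a * V1 s \<omega>} z \<partial>V1.intensity)
      = (\<integral>\<^sup>+z. indicator {(a, \<omega>). \<exists>s\<in>J. x s < a * V2 s \<omega>} z \<partial>V2.intensity)"
    using J x
  proof (induction J rule: finite_induct)
    case (insert t J)
    have "(\<integral>\<^sup>+z. indicator {(a, \<omega>). x t < a * V1 t \<omega> \<and> (\<forall>s\<in>J. a * V1 s \<omega> \<le> x s)} z \<partial>V1.intensity)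
        = (\<integral>\<^sup>+z. indicator {(a, \<omega>). x t < a * V2 t \<omega> \<and> (\<forall>s\<in>J. a * V2 s \<omega> \<le> x s)} z \<partial>V2.intensity)"
      (is "?L1 = ?L2")
    proof -
      let ?I = "\<lambda>L. (\<integral>\<^sup>+y. indicator {y. y t < exp (- (x t powr q)) \<and> (\<forall>s\<in>J. exp (- (x s powr q)) \<le> y s)} y / ennreal (1 - y t) \<partial>L)"
      have "?L1 = ?I (path_law (V1.jump_measure q t) (V1.laplace_coordinate q))"
        by (rule V1.first_exceedance[OF q insert.hyps(1) insert.prems])
      also have "\<dots> = ?I (path_law (V2.jump_measure q t) (V2.laplace_coordinate q))"
        by (simp only: laws)
      also have "\<dots> = ?L2"
        by (rule V2.first_exceedance[symmetric, OF q insert.hyps(1) insert.prems])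
      finally show ?thesis .
    qed
    then show ?case
      using insert by (simp only: V1.exceedance_insert[OF insert.hyps(1)] V2.exceedance_insert[OF insert.hyps(1)] insert_iff simp_thms)
  qed simp
  then have "ennreal (V1.exponent \<infinity> J x) = ennreal (V2.exponent \<infinity> J x)"
    using V1.exceedance_measure[OF J x] V2.exceedance_measure[OF J x] by simp
  then show ?thesis using V1.exponent_nonneg[OF J] V2.exponent_nonneg[OF J] by simp
qed

section \<open>Negligible correlations\<close>

text \<open>The properties shared by convergence to \<open>0\<close> and by convergence to \<open>0\<close> of the averaged absolute
  values. They are what the passage from a generating \<open>\<pi>\<close>-system to the whole \<open>\<sigma>\<close>-algebra requires.\<close>

locale null_mode =
  fixes null :: "(nat \<Rightarrow> real) \<Rightarrow> bool"
  assumes null_zero: "null (\<lambda>_. 0)"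
    and null_add: "null a \<Longrightarrow> null b \<Longrightarrow> null (\<lambda>n. a n + b n)"
    and null_dominated: "null a \<Longrightarrow> (\<And>n. \<bar>b n\<bar> \<le> C * \<bar>a n\<bar>) \<Longrightarrow> null b"
    and null_uniform_limit: "(\<And>e. 0 < e \<Longrightarrow> \<exists>b. null b \<and> (\<forall>n. \<bar>a n - b n\<bar> \<le> e)) \<Longrightarrow> null a"
    and null_Suc: "null (\<lambda>n. a (Suc n)) \<longleftrightarrow> null a"
begin

lemma null_shift: "null (\<lambda>n. a (n + m)) \<longleftrightarrow> null a"
proof (induction m arbitrary: a)
  case (Suc m)
  show ?case using Suc[of "\<lambda>n. a (Suc n)"] null_Suc[of a] by simp
qed simp

lemma null_cmult: "null a \<Longrightarrow> null (\<lambda>n. c * a n)"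
  by (rule null_dominated[of a _ "\<bar>c\<bar>"]) (simp_all add: abs_mult)

lemma null_uminus: "null a \<Longrightarrow> null (\<lambda>n. - a n)"
  by (rule null_dominated[of a _ 1]) simp_all

lemma null_sum: "finite I \<Longrightarrow> (\<And>i. i \<in> I \<Longrightarrow> null (a i)) \<Longrightarrow> null (\<lambda>n. \<Sum>i\<in>I. a i n)"
  by (induction I rule: finite_induct) (auto intro: null_zero null_add)

end

definition vanishes :: "(nat \<Rightarrow> real) \<Rightarrow> bool"
  where "vanishes a \<longleftrightarrow> a \<longlonglongrightarrow> 0"

text \<open>Absolute values are averaged, so that domination is preserved.\<close>

definition vanishes_on_average :: "(nat \<Rightarrow> real) \<Rightarrow> bool"
  where "vanishes_on_average a \<longleftrightarrow> (\<lambda>n. (\<Sum>k<n. \<bar>a k\<bar>) / real n) \<longlonglongrightarrow> 0"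

lemma tendsto_zero_by_approximation:
  fixes u :: "nat \<Rightarrow> real"
  assumes "\<And>e. 0 < e \<Longrightarrow> \<exists>v. v \<longlonglongrightarrow> 0 \<and> (\<forall>n. \<bar>u n\<bar> \<le> \<bar>v n\<bar> + e)"
  shows "u \<longlonglongrightarrow> 0"
proof (rule LIMSEQ_I)
  fix r :: real assume "0 < r"
  then have r: "0 < r / 2" by simp
  obtain v where v: "v \<longlonglongrightarrow> 0" "\<And>n. \<bar>u n\<bar> \<le> \<bar>v n\<bar> + r / 2" using assms[OF r] by auto
  obtain N where "\<And>n. n \<ge> N \<Longrightarrow> norm (v n - 0) < r / 2" using LIMSEQ_D[OF v(1) r] by blast
  then have "norm (u n - 0) < r" if "n \<ge> N" for n using v(2)[of n] that by fastforce
  then show "\<exists>no. \<forall>n\<ge>no. norm (u n - 0) < r" by blast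
qed

interpretation vanishing: null_mode vanishes
proof
  show "vanishes (\<lambda>_. 0)" by (simp add: vanishes_def)
  show "vanishes (\<lambda>n. a n + b n)" if "vanishes a" "vanishes b" for a b
    using that tendsto_add[of a 0 _ b 0] by (simp add: vanishes_def)
  show "vanishes b" if "vanishes a" "\<And>n. \<bar>b n\<bar> \<le> C * \<bar>a n\<bar>" for a b C
  proof -
    have "(\<lambda>n. C * \<bar>a n\<bar>) \<longlonglongrightarrow> 0"
      using that(1) by (auto simp: vanishes_def intro!: tendsto_mult_right_zero tendsto_rabs_zero)
    then show ?thesis
      unfolding vanishes_def by (rule Lim_null_comparison[rotated]) (use that(2) in simp)
  qed
  show "vanishes a" if "\<And>e. 0 < e \<Longrightarrow> \<exists>b. vanishes b \<and> (\<forall>n. \<bar>a n - b n\<bar> \<le> e)" for a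
    unfolding vanishes_def
  proof (rule tendsto_zero_by_approximation)
    fix e :: real assume "0 < e"
    from that[OF this] obtain b where "b \<longlonglongrightarrow> 0" "\<And>n. \<bar>a n - b n\<bar> \<le> e" by (auto simp: vanishes_def)
    then show "\<exists>v. v \<longlonglongrightarrow> 0 \<and> (\<forall>n. \<bar>a n\<bar> \<le> \<bar>v n\<bar> + e)"
    proof (intro exI[of _ b] conjI allI)
      show "\<bar>a n\<bar> \<le> \<bar>b n\<bar> + e" for n using \<open>\<bar>a n - b n\<bar> \<le> e\<close> by linarith
    qed
  qed
  show "vanishes (\<lambda>n. a (Suc n)) \<longleftrightarrow> vanishes a" for a
    unfolding vanishes_def by (rule filterlim_sequentially_Suc)
qed

interpretation averaging: null_mode vanishes_on_average
proof
  show "vanishes_on_average (\<lambda>_. 0)" by (simp add: vanishes_on_average_def)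
  have avg_mono: "vanishes_on_average b"
    if a: "(\<lambda>n. C * ((\<Sum>k<n. a k) / real n)) \<longlonglongrightarrow> 0" and le: "\<And>n. \<bar>b n\<bar> \<le> C * a n" for a b :: "nat \<Rightarrow> real" and C
    unfolding vanishes_on_average_def
  proof (rule Lim_null_comparison[OF _ a])
    have "(\<Sum>k<n. \<bar>b k\<bar>) \<le> C * (\<Sum>k<n. a k)" for n
      unfolding sum_distrib_left by (intro sum_mono le)
    then have "(\<Sum>k<n. \<bar>b k\<bar>) / real n \<le> C * (\<Sum>k<n. a k) / real n" for n
      by (intro divide_right_mono) auto
    then show "\<forall>\<^sub>F n in sequentially. norm ((\<Sum>k<n. \<bar>b k\<bar>) / real n) \<le> C * ((\<Sum>k<n. a k) / real n)"
      by (simp add: sum_nonneg)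
  qed
  show "vanishes_on_average (\<lambda>n. a n + b n)" if "vanishes_on_average a" "vanishes_on_average b" for a b
  proof (rule avg_mono[of 1 "\<lambda>n. \<bar>a n\<bar> + \<bar>b n\<bar>"])
    show "(\<lambda>n. 1 * ((\<Sum>k<n. \<bar>a k\<bar> + \<bar>b k\<bar>) / real n)) \<longlonglongrightarrow> 0"
      using tendsto_add[OF that[unfolded vanishes_on_average_def]] by (simp add: sum.distrib add_divide_distrib)
  qed simp
  show "vanishes_on_average b" if "vanishes_on_average a" "\<And>n. \<bar>b n\<bar> \<le> C * \<bar>a n\<bar>" for a b C
    using that(1) by (intro avg_mono[of C "\<lambda>n. \<bar>a n\<bar>"] tendsto_mult_right_zero that(2)) (simp add: vanishes_on_average_def)
  show "vanishes_on_average a" if "\<And>e. 0 < e \<Longrightarrow> \<exists>b. vanishes_on_average b \<and> (\<forall>n. \<bar>a n - b n\<bar> \<le> e)" for a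
    unfolding vanishes_on_average_def
  proof (rule tendsto_zero_by_approximation)
    fix e :: real assume "0 < e"
    from that[OF this] obtain b where b: "vanishes_on_average b" "\<And>n. \<bar>a n - b n\<bar> \<le> e" by auto
    have "\<bar>(\<Sum>k<n. \<bar>a k\<bar>) / real n\<bar> \<le> \<bar>(\<Sum>k<n. \<bar>b k\<bar>) / real n\<bar> + e" for n
    proof (cases "n = 0")
      case False
      have "\<bar>a k\<bar> \<le> \<bar>b k\<bar> + e" for k using b(2)[of k] by linarith
      then have "(\<Sum>k<n. \<bar>a k\<bar>) \<le> (\<Sum>k<n. \<bar>b k\<bar> + e)" by (intro sum_mono)
      then have "(\<Sum>k<n. \<bar>a k\<bar>) / real n \<le> ((\<Sum>k<n. \<bar>b k\<bar>) + real n * e) / real n"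
        by (intro divide_right_mono) (simp_all add: sum.distrib)
      then show ?thesis using False by (simp add: sum_nonneg add_divide_distrib)
    qed (use \<open>0 < e\<close> in simp)
    with b(1) show "\<exists>v. v \<longlonglongrightarrow> 0 \<and> (\<forall>n. \<bar>(\<Sum>k<n. \<bar>a k\<bar>) / real n\<bar> \<le> \<bar>v n\<bar> + e)"
      unfolding vanishes_on_average_def by blast
  qed
  show "vanishes_on_average (\<lambda>n. a (Suc n)) \<longleftrightarrow> vanishes_on_average a" for a
  proof -
    let ?s = "\<lambda>n. \<Sum>k<n. \<bar>a k\<bar>"
    have Suc: "(\<Sum>k<n. \<bar>a (Suc k)\<bar>) = ?s (Suc n) - \<bar>a 0\<bar>" for n
      by (subst sum.lessThan_Suc_shift) simp
    have inv: "(\<lambda>n. c / real n) \<longlonglongrightarrow> 0" for c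
      by (intro tendsto_divide_0[OF tendsto_const] filterlim_at_top_imp_at_infinity filterlim_real_sequentially)
    have ratio: "(\<lambda>n. real (Suc n) / real n) \<longlonglongrightarrow> 1"
    proof (rule Lim_transform_eventually)
      show "(\<lambda>n. 1 + 1 / real n) \<longlonglongrightarrow> 1" using tendsto_add[OF tendsto_const[of 1] inv[of 1]] by simp
      show "\<forall>\<^sub>F n in sequentially. 1 + 1 / real n = real (Suc n) / real n"
        using eventually_gt_at_top[of 0] by eventually_elim (simp add: field_simps)
    qed
    have ratio': "(\<lambda>n. real n / real (Suc n)) \<longlonglongrightarrow> 1"
      using tendsto_divide[OF tendsto_const[of 1] ratio] by simp
    have "vanishes_on_average a \<longleftrightarrow> (\<lambda>n. ?s (Suc n) / real (Suc n)) \<longlonglongrightarrow> 0"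
      unfolding vanishes_on_average_def by (rule filterlim_sequentially_Suc[symmetric])
    also have "\<dots> \<longleftrightarrow> (\<lambda>n. ?s (Suc n) / real n) \<longlonglongrightarrow> 0"
    proof
      assume "(\<lambda>n. ?s (Suc n) / real (Suc n)) \<longlonglongrightarrow> 0"
      from tendsto_mult[OF this ratio] have l: "(\<lambda>n. ?s (Suc n) / real (Suc n) * (real (Suc n) / real n)) \<longlonglongrightarrow> 0" by simp
      show "(\<lambda>n. ?s (Suc n) / real n) \<longlonglongrightarrow> 0"
        by (rule Lim_transform_eventually[OF l]) (simp del: of_nat_Suc sum.lessThan_Suc)
    next
      assume "(\<lambda>n. ?s (Suc n) / real n) \<longlonglongrightarrow> 0"
      from tendsto_mult[OF this ratio'] have l: "(\<lambda>n. ?s (Suc n) / real n * (real n / real (Suc n))) \<longlonglongrightarrow> 0" by simp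
      show "(\<lambda>n. ?s (Suc n) / real (Suc n)) \<longlonglongrightarrow> 0"
        by (rule Lim_transform_eventually[OF l])
          (use eventually_gt_at_top[of 0] in \<open>eventually_elim, simp del: of_nat_Suc sum.lessThan_Suc\<close>)
    qed
    also have "\<dots> \<longleftrightarrow> (\<lambda>n. (?s (Suc n) - \<bar>a 0\<bar>) / real n) \<longlonglongrightarrow> 0"
    proof
      assume "(\<lambda>n. ?s (Suc n) / real n) \<longlonglongrightarrow> 0"
      from tendsto_diff[OF this inv[of "\<bar>a 0\<bar>"]] show "(\<lambda>n. (?s (Suc n) - \<bar>a 0\<bar>) / real n) \<longlonglongrightarrow> 0"
        by (simp add: diff_divide_distrib del: sum.lessThan_Suc)
    next
      assume "(\<lambda>n. (?s (Suc n) - \<bar>a 0\<bar>) / real n) \<longlonglongrightarrow> 0"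
      from tendsto_add[OF this inv[of "\<bar>a 0\<bar>"]] show "(\<lambda>n. ?s (Suc n) / real n) \<longlonglongrightarrow> 0"
        by (simp add: diff_divide_distrib del: sum.lessThan_Suc)
    qed
    finally show ?thesis by (simp add: vanishes_on_average_def Suc del: sum.lessThan_Suc)
  qed
qed

lemma measurable_shift_path [measurable]: "shift_path h \<in> measurable path_space path_space"
  unfolding shift_path_def by (rule measurable_path_spaceI) (rule measurable_path_coordinate)

lemma shift_path_funpow: "(shift_path 1 ^^ n) = shift_path (int n)"
  by (induction n) (auto simp: shift_path_def fun_eq_iff algebra_simps)

locale invariant_path_law = prob_space L for L :: "(int \<Rightarrow> real) measure" +
  assumes sets_L [measurable_cong]: "sets L = sets path_space"
    and invariant: "distr L path_space (shift_path h) = L"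
begin

lemma space_L [simp]: "space L = UNIV"
  using sets_eq_imp_space_eq[OF sets_L] by simp

lemma prob_shift: "E \<in> sets path_space \<Longrightarrow> prob (shift_path h -` E) = prob E"
  using measure_distr[of "shift_path h" L path_space E] by (simp add: invariant)

lemma sets_shift: "E \<in> sets path_space \<Longrightarrow> shift_path h -` E \<in> sets path_space"
  using measurable_sets[OF measurable_shift_path, of E h] by simp

definition correlation :: "(int \<Rightarrow> real) set \<Rightarrow> (int \<Rightarrow> real) set \<Rightarrow> nat \<Rightarrow> real"
  where "correlation E F n = prob (E \<inter> shift_path (int n) -` F) - prob E * prob F"

lemma joint_prob_bound:
  assumes "E \<in> sets path_space" "F \<in> sets path_space"
  shows "prob (E \<inter> shift_path h -` F) \<le> prob E" "prob (E \<inter> shift_path h -` F) \<le> prob F"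
proof -
  have m: "E \<in> sets L" "shift_path h -` F \<in> sets L" using assms by (simp_all add: sets_L sets_shift)
  show "prob (E \<inter> shift_path h -` F) \<le> prob E" by (rule finite_measure_mono[OF _ m(1)]) simp
  have "prob (E \<inter> shift_path h -` F) \<le> prob (shift_path h -` F)" by (rule finite_measure_mono[OF _ m(2)]) simp
  then show "prob (E \<inter> shift_path h -` F) \<le> prob F" using assms by (simp add: prob_shift)
qed

lemma correlation_bound:
  assumes "E \<in> sets path_space" "F \<in> sets path_space"
  shows "\<bar>correlation E F n\<bar> \<le> prob E" "\<bar>correlation E F n\<bar> \<le> prob F"
proof -
  have "0 \<le> prob E * prob F" "prob E * prob F \<le> prob E" "prob E * prob F \<le> prob F"
    by (simp_all add: mult_left_le mult_left_le_one_le)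
  then show "\<bar>correlation E F n\<bar> \<le> prob E" "\<bar>correlation E F n\<bar> \<le> prob F"
    using joint_prob_bound[OF assms, of "int n"] measure_nonneg[of L "E \<inter> shift_path (int n) -` F"]
    unfolding correlation_def by linarith+
qed

lemma correlation_Un:
  assumes "B \<in> sets path_space" "C \<in> sets path_space" "F \<in> sets path_space" "B \<inter> C = {}"
  shows "correlation (B \<union> C) F n = correlation B F n + correlation C F n"
    and "correlation F (B \<union> C) n = correlation F B n + correlation F C n"
proof -
  note [measurable] = sets_shift assms(1,2,3)
  have B: "prob (B \<union> C) = prob B + prob C"
    using assms by (intro finite_measure_Union) (auto simp: sets_L)
  have "prob ((B \<inter> shift_path (int n) -` F) \<union> (C \<inter> shift_path (int n) -` F))
      = prob (B \<inter> shift_path (int n) -` F) + prob (C \<inter> shift_path (int n) -` F)"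
    using assms(4) by (intro finite_measure_Union) (auto simp: sets_L)
  then show "correlation (B \<union> C) F n = correlation B F n + correlation C F n"
    by (simp add: correlation_def B Int_Un_distrib2 distrib_right)
  have "prob ((F \<inter> shift_path (int n) -` B) \<union> (F \<inter> shift_path (int n) -` C))
      = prob (F \<inter> shift_path (int n) -` B) + prob (F \<inter> shift_path (int n) -` C)"
    using assms(4) by (intro finite_measure_Union) (auto simp: sets_L)
  then show "correlation F (B \<union> C) n = correlation F B n + correlation F C n"
    by (simp add: correlation_def B Int_Un_distrib distrib_left)
qed

lemma correlation_UNIV:
  assumes "F \<in> sets path_space"
  shows "correlation UNIV F n = 0" "correlation F UNIV n = 0"
  using assms prob_space by (simp_all add: correlation_def prob_shift)

end

text \<open>The bound by \<open>L\<close> makes the tails of a disjoint union small uniformly in \<open>n\<close>, so the sets with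
  null \<open>\<kappa>\<close> form a Dynkin system.\<close>

lemma (in null_mode) null_on_sigma_algebra:
  fixes \<kappa> :: "nat \<Rightarrow> ('s \<Rightarrow> real) set \<Rightarrow> real"
  assumes "prob_space L" and sets_L: "sets L = sets path_space"
    and add: "\<And>n B C. B \<in> sets path_space \<Longrightarrow> C \<in> sets path_space \<Longrightarrow> B \<inter> C = {} \<Longrightarrow> \<kappa> n (B \<union> C) = \<kappa> n B + \<kappa> n C"
    and total: "\<And>n. \<kappa> n UNIV = 0"
    and bound: "\<And>n B. B \<in> sets path_space \<Longrightarrow> \<bar>\<kappa> n B\<bar> \<le> measure L B"
    and orthants: "\<And>J x. finite J \<Longrightarrow> null (\<lambda>n. \<kappa> n (lower_orthant J x))"
    and B: "B \<in> sets path_space"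
  shows "null (\<lambda>n. \<kappa> n B)"
proof -
  interpret L: prob_space L by fact
  let ?G = "{lower_orthant J x |J (x :: 's \<Rightarrow> real). finite J}"
  have sig: "E \<in> sets path_space \<longleftrightarrow> E \<in> sigma_sets UNIV ?G" for E
    by (simp add: sets_path_space_eq)
  have sub: "?G \<subseteq> Pow UNIV" by simp
  have empty: "\<kappa> n {} = 0" for n using bound[of "{}" n] by simp
  show ?thesis
    using Int_stable_lower_orthants sub B[unfolded sig]
  proof (induction B rule: sigma_sets_induct_disjoint)
    case (basic B)
    then show ?case using orthants by auto
  next
    case empty
    then show ?case by (simp add: \<open>\<And>n. \<kappa> n {} = 0\<close> null_zero)
  next
    case (compl B)
    then have B: "B \<in> sets path_space" by (simp add: sig)
    then have "UNIV - B \<in> sets path_space" using sets.compl_sets[of B path_space] by simp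
    with B have "\<kappa> n (UNIV - B) = - \<kappa> n B" for n
      using add[of B "UNIV - B" n] total[of n] by simp
    then show ?case using null_uminus[OF compl(2)] by simp
  next
    case (union A)
    then have A: "A i \<in> sets path_space" for i by (auto simp: sig)
    have dis: "i = j" if "x \<in> A i" "x \<in> A j" for x i j
      using union(1) that by (auto simp: disjoint_family_on_def)
    show ?case
    proof (rule null_uniform_limit)
      fix e :: real assume "0 < e"
      let ?R = "\<lambda>m. \<Union>i\<in>{m..}. A i"
      have R: "?R m \<in> sets path_space" for m using A by auto
      have "(\<lambda>m. measure L (?R m)) \<longlonglongrightarrow> measure L (\<Inter>m. ?R m)"
      proof (rule L.finite_Lim_measure_decseq)
        show "range ?R \<subseteq> sets L" using R by (simp add: sets_L image_subset_iff)
        show "decseq ?R" unfolding decseq_def by (intro allI impI UN_mono) auto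
      qed
      moreover have "(\<Inter>m. ?R m) = {}"
      proof -
        have "x \<notin> (\<Inter>m. ?R m)" for x
        proof
          assume x: "x \<in> (\<Inter>m. ?R m)"
          then obtain i where "x \<in> A i" by auto
          moreover have "x \<in> ?R (Suc i)" using INT_D[OF x, of "Suc i"] by simp
          then obtain j where "Suc i \<le> j" "x \<in> A j" by auto
          ultimately have "i = j" by (intro dis)
          with \<open>Suc i \<le> j\<close> show False by simp
        qed
        then show ?thesis by blast
      qed
      ultimately have "(\<lambda>m. measure L (?R m)) \<longlonglongrightarrow> 0" by simp
      from LIMSEQ_D[OF this \<open>0 < e\<close>] obtain m where m: "measure L (?R m) < e" by auto
      have split: "\<kappa> n (\<Union>i. A i) = (\<Sum>i<k. \<kappa> n (A i)) + \<kappa> n (?R k)" for n k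
      proof (induction k)
        case 0
        then show ?case by (simp add: atLeast_0)
      next
        case (Suc k)
        have "{k..} = insert k {Suc k..}" by auto
        then have "?R k = A k \<union> ?R (Suc k)" by simp
        moreover have "A k \<inter> ?R (Suc k) = {}" by (auto dest: dis)
        ultimately show ?case using Suc add[OF A[of k] R[of "Suc k"], of n] by simp
      qed
      have "\<bar>\<kappa> n (\<Union>i. A i) - (\<Sum>i<m. \<kappa> n (A i))\<bar> \<le> e" for n
        using split[of n m] bound[OF R, of n m] m by simp
      then show "\<exists>b. null b \<and> (\<forall>n. \<bar>\<kappa> n (\<Union>i. A i) - b n\<bar> \<le> e)"
        using union.IH by (intro exI[of _ "\<lambda>n. \<Sum>i<m. \<kappa> n (A i)"]) (auto intro: null_sum)
    qed
  qed
qed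

text \<open>Correlations are additive in each argument, so \<open>null_on_sigma_algebra\<close> applies to one after the
  other.\<close>

lemma (in null_mode) correlations_null:
  assumes "invariant_path_law L"
    and orthants: "\<And>J x K y. finite J \<Longrightarrow> finite K \<Longrightarrow>
      null (invariant_path_law.correlation L (lower_orthant J x) (lower_orthant K y))"
    and E: "E \<in> sets path_space" and F: "F \<in> sets path_space"
  shows "null (invariant_path_law.correlation L E F)"
proof -
  interpret invariant_path_law L by fact
  have left: "null (\<lambda>n. correlation E (lower_orthant K y) n)" if K: "finite K" for K y
  proof (rule null_on_sigma_algebra[OF prob_space_axioms sets_L _ _ _ _ E])
    have K': "lower_orthant K y \<in> sets path_space" using K by (rule sets_lower_orthant)
    show "correlation (B \<union> C) (lower_orthant K y) n = correlation B (lower_orthant K y) n + correlation C (lower_orthant K y) n"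
      if "B \<in> sets path_space" "C \<in> sets path_space" "B \<inter> C = {}" for n B C
      using that K' by (intro correlation_Un)
    show "correlation UNIV (lower_orthant K y) n = 0" for n using K' by (rule correlation_UNIV)
    show "\<bar>correlation B (lower_orthant K y) n\<bar> \<le> prob B" if "B \<in> sets path_space" for n B
      using that K' by (rule correlation_bound)
  qed (use orthants[OF _ K] in simp)
  show ?thesis
  proof (rule null_on_sigma_algebra[OF prob_space_axioms sets_L _ _ _ _ F, of "\<lambda>n F. correlation E F n"])
    show "correlation E (B \<union> C) n = correlation E B n + correlation E C n"
      if "B \<in> sets path_space" "C \<in> sets path_space" "B \<inter> C = {}" for n B C
      using that E by (intro correlation_Un)
    show "correlation E UNIV n = 0" for n using E by (rule correlation_UNIV)
    show "\<bar>correlation E B n\<bar> \<le> prob B" if "B \<in> sets path_space" for n B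
      using E that by (rule correlation_bound)
  qed (rule left)
qed

section \<open>The upper half of the ergodic theorem\<close>

locale measure_preserving_map = prob_space M for M :: "'a measure" +
  fixes T :: "'a \<Rightarrow> 'a"
  assumes measurable_T [measurable]: "T \<in> measurable M M"
    and preserving: "distr M M T = M"
begin

lemma integral_preserved:
  fixes f :: "'a \<Rightarrow> real"
  assumes "f \<in> borel_measurable M"
  shows "(\<integral>x. f (T x) \<partial>M) = (\<integral>x. f x \<partial>M)"
  using integral_distr[of T M M f] assms by (simp add: preserving)

lemma T_space: "x \<in> space M \<Longrightarrow> T x \<in> space M"
  by (rule measurable_space[OF measurable_T])

definition birkhoff_sum :: "('a \<Rightarrow> real) \<Rightarrow> nat \<Rightarrow> 'a \<Rightarrow> real"
  where "birkhoff_sum f n x = (\<Sum>k<n. f ((T ^^ k) x))"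

lemma birkhoff_sum_Suc: "birkhoff_sum f (Suc n) x = f x + birkhoff_sum f n (T x)"
  unfolding birkhoff_sum_def by (subst sum.lessThan_Suc_shift) (simp add: funpow_swap1)

lemma measurable_birkhoff_sum [measurable]:
  assumes [measurable]: "f \<in> borel_measurable M" shows "birkhoff_sum f n \<in> borel_measurable M"
  unfolding birkhoff_sum_def[abs_def] by measurable

text \<open>The maximum of the Birkhoff sums of length \<open>0, \<dots>, n\<close>, in the recursive form that the maximal
  inequality uses.\<close>

primrec max_birkhoff_sum :: "('a \<Rightarrow> real) \<Rightarrow> nat \<Rightarrow> 'a \<Rightarrow> real"
  where "max_birkhoff_sum f 0 x = 0"
  | "max_birkhoff_sum f (Suc n) x = max 0 (f x + max_birkhoff_sum f n (T x))"

lemma max_birkhoff_sum_nonneg: "0 \<le> max_birkhoff_sum f n x"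
  by (cases n) auto

lemma max_birkhoff_sum_mono: "max_birkhoff_sum f n x \<le> max_birkhoff_sum f (Suc n) x"
proof (induction n arbitrary: x)
  case (Suc n)
  show ?case using Suc[of "T x"] by (auto simp: max_def)
qed simp

lemma birkhoff_sum_le_max: "birkhoff_sum f n x \<le> max_birkhoff_sum f n x"
proof (induction n arbitrary: x)
  case (Suc n)
  show ?case using Suc[of "T x"] by (simp add: birkhoff_sum_Suc)
qed (simp add: birkhoff_sum_def)

lemma measurable_max_birkhoff_sum [measurable]:
  assumes [measurable]: "f \<in> borel_measurable M" shows "max_birkhoff_sum f n \<in> borel_measurable M"
proof (induction n)
  case (Suc n)
  note [measurable] = Suc
  show ?case unfolding max_birkhoff_sum.simps[abs_def] by measurable
qed simp

lemma max_birkhoff_sum_bound: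
  assumes f: "\<And>x. x \<in> space M \<Longrightarrow> \<bar>f x\<bar> \<le> B" and B: "0 \<le> B" and "x \<in> space M"
  shows "max_birkhoff_sum f n x \<le> real n * B"
  using \<open>x \<in> space M\<close>
proof (induction n arbitrary: x)
  case (Suc n)
  show ?case using Suc.IH[OF T_space[OF Suc.prems]] f[OF Suc.prems] B by (auto simp: algebra_simps max_def abs_le_iff)
qed simp

text \<open>Garsia's argument: where the maximum \<open>m\<close> is positive, the recursion gives \<open>m - m \<circ> T \<le> f\<close>; elsewhere
  \<open>m - m \<circ> T \<le> 0\<close>; and \<open>m - m \<circ> T\<close> has integral \<open>0\<close>.\<close>

lemma maximal_ergodic_inequality:
  assumes [measurable]: "f \<in> borel_measurable M" and f: "\<And>x. x \<in> space M \<Longrightarrow> \<bar>f x\<bar> \<le> B"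
  shows "0 \<le> (\<integral>x. f x * indicator {x. 0 < max_birkhoff_sum f (Suc n) x} x \<partial>M)"
proof -
  let ?m = "max_birkhoff_sum f (Suc n)"
  obtain x0 where "x0 \<in> space M" using not_empty by blast
  then have B: "0 \<le> B" using f[of x0] by linarith
  have bd: "\<bar>?m x\<bar> \<le> real (Suc n) * B" if "x \<in> space M" for x
    using max_birkhoff_sum_bound[of f B x "Suc n", OF f B that] max_birkhoff_sum_nonneg[of f "Suc n" x] by linarith
  have int: "integrable M ?m" "integrable M (\<lambda>x. ?m (T x))"
    using bd bd[OF T_space]
    by (intro integrable_const_bound[of _ "real (Suc n) * B"] AE_I2; simp del: max_birkhoff_sum.simps of_nat_Suc)+
  have "0 = (\<integral>x. ?m x - ?m (T x) \<partial>M)"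
    using int by (simp add: integral_preserved del: max_birkhoff_sum.simps)
  also have "\<dots> \<le> (\<integral>x. f x * indicator {x. 0 < ?m x} x \<partial>M)"
  proof (rule integral_mono)
    show "integrable M (\<lambda>x. ?m x - ?m (T x))" using int by (rule Bochner_Integration.integrable_diff)
    have "{x\<in>space M. 0 < ?m x} \<in> sets M" by measurable
    then have "(\<lambda>x. f x * indicator {x\<in>space M. 0 < ?m x} x) \<in> borel_measurable M" by measurable
    then have [measurable]: "(\<lambda>x. f x * indicator {x. 0 < ?m x} x) \<in> borel_measurable M"
      by (rule measurable_cong[THEN iffD1, rotated]) (auto simp: indicator_def)
    show "integrable M (\<lambda>x. f x * indicator {x. 0 < ?m x} x)"
      using f B by (intro integrable_const_bound[of _ B] AE_I2) (auto simp: indicator_def simp del: max_birkhoff_sum.simps)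
    show "?m x - ?m (T x) \<le> f x * indicator {x. 0 < ?m x} x" for x
    proof (cases "0 < ?m x")
      case True
      then have "?m x = f x + max_birkhoff_sum f n (T x)" by (auto simp: max_def split: if_splits)
      with True max_birkhoff_sum_mono[of f n "T x"] show ?thesis by (simp del: max_birkhoff_sum.simps)
    next
      case False
      then show ?thesis using max_birkhoff_sum_nonneg[of f "Suc n" "T x"] by (simp del: max_birkhoff_sum.simps)
    qed
  qed
  finally show ?thesis .
qed

text \<open>The exceptional set is invariant, and on it some Birkhoff sum is positive. If it had full measure,
  the maximal inequality would give \<open>f\<close> a non-negative integral.\<close>

lemma ergodic_average_eventually_small:
  assumes ergodic: "\<And>E. E \<in> sets M \<Longrightarrow> T -` E \<inter> space M = E \<Longrightarrow> prob E = 0 \<or> prob E = 1"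
    and [measurable]: "f \<in> borel_measurable M" and f: "\<And>x. x \<in> space M \<Longrightarrow> \<bar>f x\<bar> \<le> B"
    and neg: "(\<integral>x. f x \<partial>M) < 0"
  shows "AE x in M. \<forall>j. \<forall>\<^sub>F n in sequentially. birkhoff_sum f n x \<le> real n / real (Suc j)"
proof -
  obtain x0 where "x0 \<in> space M" using not_empty by blast
  then have B: "0 \<le> B" using f[of x0] by linarith
  let ?H = "\<lambda>x. \<forall>j. \<forall>\<^sub>F n in sequentially. birkhoff_sum f n x \<le> real n / real (Suc j)"
  have meas: "{x\<in>space M. \<not> ?H x} \<in> sets M" unfolding eventually_sequentially by measurable
  (* dropping or adding one term changes a Birkhoff sum by at most B; halving the slope absorbs this *)
  have slack: "\<forall>\<^sub>F n in sequentially. real (Suc n) / real (Suc (2 * j + 1)) + B \<le> real n / real (Suc j)" for j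
  proof -
    have "real (Suc n) / real (Suc (2 * j + 1)) + B \<le> real n / real (Suc j)" if n: "1 + 2 * (real j + 1) * B \<le> real n" for n
    proof -
      have "real (Suc n) / real (Suc (2 * j + 1)) + B = (real n + 1 + 2 * (real j + 1) * B) / (2 * (real j + 1))"
        by (simp add: field_simps)
      also have "\<dots> \<le> (2 * real n) / (2 * (real j + 1))"
        using n by (intro divide_right_mono) auto
      also have "\<dots> = real n / real (Suc j)"
        by (subst mult_divide_mult_cancel_left) (auto simp: add.commute)
      finally show ?thesis .
    qed
    then show ?thesis
      by (rule eventually_mono[OF filterlim_at_top[THEN iffD1, rule_format, OF filterlim_real_sequentially]])
  qed
  have inv: "?H (T x) \<longleftrightarrow> ?H x" if x: "x \<in> space M" for x
  proof
    assume H: "?H x"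
    show "?H (T x)"
    proof
      fix j
      have "\<forall>\<^sub>F n in sequentially. birkhoff_sum f n x \<le> real n / real (Suc (2 * j + 1))" using H by blast
      then have "\<forall>\<^sub>F n in sequentially. birkhoff_sum f (Suc n) x \<le> real (Suc n) / real (Suc (2 * j + 1))"
        by (subst eventually_sequentially_Suc[of "\<lambda>n. birkhoff_sum f n x \<le> real n / real (Suc (2 * j + 1))"])
      then show "\<forall>\<^sub>F n in sequentially. birkhoff_sum f n (T x) \<le> real n / real (Suc j)"
        using slack[of j]
      proof eventually_elim
        case (elim n)
        then show ?case using f[OF x] unfolding birkhoff_sum_Suc by linarith
      qed
    qed
  next
    assume H: "?H (T x)"
    show "?H x"
    proof
      fix j
      have "\<forall>\<^sub>F n in sequentially. birkhoff_sum f n (T x) \<le> real n / real (Suc (2 * j + 1))" using H by blast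
      then have "\<forall>\<^sub>F n in sequentially. birkhoff_sum f (Suc n) x \<le> real (Suc n) / real (Suc j)"
        using slack[of j]
      proof eventually_elim
        case (elim n)
        have "real n / real (Suc (2 * j + 1)) \<le> real (Suc n) / real (Suc (2 * j + 1))"
          "real n / real (Suc j) \<le> real (Suc n) / real (Suc j)" by (intro divide_right_mono; simp)+
        with elim f[OF x] show ?case unfolding birkhoff_sum_Suc by linarith
      qed
      then show "\<forall>\<^sub>F n in sequentially. birkhoff_sum f n x \<le> real n / real (Suc j)"
        by (subst (asm) eventually_sequentially_Suc[of "\<lambda>n. birkhoff_sum f n x \<le> real n / real (Suc j)"])
    qed
  qed
  have "T -` {x\<in>space M. \<not> ?H x} \<inter> space M = {x\<in>space M. \<not> ?H x}"
    using inv T_space by auto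
  then consider "prob {x\<in>space M. \<not> ?H x} = 0" | "prob {x\<in>space M. \<not> ?H x} = 1"
    using ergodic[OF meas] by blast
  then show ?thesis
  proof cases
    case 1
    then have "AE x in M. x \<notin> {x\<in>space M. \<not> ?H x}"
      using meas by (intro AE_not_in) (simp add: null_sets_def emeasure_eq_measure)
    with AE_space show ?thesis by eventually_elim auto
  next
    case 2
    then have bad: "AE x in M. \<not> ?H x" using meas by (subst (asm) prob_eq_1) auto
    let ?S = "\<lambda>n. {x. 0 < max_birkhoff_sum f (Suc n) x}"
    have "(\<lambda>n. \<integral>x. f x * indicator (?S n) x \<partial>M) \<longlonglongrightarrow> (\<integral>x. f x \<partial>M)"
    proof (rule integral_dominated_convergence[where w="\<lambda>_. B"])
      show "(\<lambda>x. f x * indicator (?S n) x) \<in> borel_measurable M" for n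
      proof -
        have "{x\<in>space M. 0 < max_birkhoff_sum f (Suc n) x} \<in> sets M" by measurable
        then have "(\<lambda>x. f x * indicator {x\<in>space M. 0 < max_birkhoff_sum f (Suc n) x} x) \<in> borel_measurable M" by measurable
        then show ?thesis by (rule measurable_cong[THEN iffD1, rotated]) (auto simp: indicator_def)
      qed
      show "AE x in M. (\<lambda>n. f x * indicator (?S n) x) \<longlonglongrightarrow> f x"
        using bad
      proof eventually_elim
        case (elim x)
        then obtain j where "\<not> (\<forall>\<^sub>F n in sequentially. birkhoff_sum f n x \<le> real n / real (Suc j))" by blast
        then obtain m where "real m / real (Suc j) < birkhoff_sum f m x"
          unfolding eventually_sequentially not_le by (metis not_le)
        moreover have "0 \<le> real m / real (Suc j)" by simp
        ultimately have pos: "0 < max_birkhoff_sum f m x" using birkhoff_sum_le_max[of f m x] by linarith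
        have "x \<in> ?S n" if "m \<le> n" for n
        proof -
          have "max_birkhoff_sum f m x \<le> max_birkhoff_sum f n x"
            using lift_Suc_mono_le[of "\<lambda>n. max_birkhoff_sum f n x", OF max_birkhoff_sum_mono that] .
          with pos max_birkhoff_sum_mono[of f n x] show ?thesis by (simp del: max_birkhoff_sum.simps)
        qed
        then have "\<forall>\<^sub>F n in sequentially. f x * indicator (?S n) x = f x"
          by (intro eventually_sequentiallyI[of m]) (simp add: indicator_def)
        then show ?case by (rule tendsto_eventually)
      qed
      show "AE x in M. norm (f x * indicator (?S n) x) \<le> B" for n
        using f B by (intro AE_I2) (auto simp: indicator_def)
    qed auto
    then have "0 \<le> (\<integral>x. f x \<partial>M)"
      by (rule LIMSEQ_le_const) (use maximal_ergodic_inequality[OF _ f] in auto)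
    with neg show ?thesis by simp
  qed
qed

text \<open>Applied to the centred indicator of \<open>C\<close> minus a small constant, the preceding lemma bounds the
  frequency of visits to \<open>C\<close> almost surely; integrating over \<open>C\<close> yields the correlations.\<close>

lemma ergodic_correlation_average_upper:
  assumes ergodic: "\<And>E. E \<in> sets M \<Longrightarrow> T -` E \<inter> space M = E \<Longrightarrow> prob E = 0 \<or> prob E = 1"
    and C [measurable]: "C \<in> sets M" and "0 < e"
  shows "\<forall>\<^sub>F n in sequentially. (\<Sum>k<n. prob (C \<inter> (T ^^ k) -` C)) / real n \<le> prob C * prob C + e"
proof -
  (* one d is lost by centring at prob C + d, another by the slack j below, and 2 * d < e is needed *)
  define d where "d = e / 4"
  have d: "0 < d" using \<open>0 < e\<close> by (simp add: d_def)
  let ?f = "\<lambda>x. indicat_real C x - (prob C + d)"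
  let ?c = "prob C + 2 * d"
  have [measurable]: "(T ^^ k) \<in> measurable M M" for k by (induction k) auto
  have "integrable M (indicat_real C)"
    by (intro integrable_real_indicator) (auto simp: less_top[symmetric])
  then have "(\<integral>x. ?f x \<partial>M) = - d" by (simp add: prob_space)
  then have neg: "(\<integral>x. ?f x \<partial>M) < 0" using d by simp
  have "\<bar>?f x\<bar> \<le> 1 + (prob C + d)" for x
    using d measure_nonneg[of M C] by (auto simp: indicator_def abs_if)
  from ergodic_average_eventually_small[OF ergodic _ this neg]
  have small: "AE x in M. \<forall>j. \<forall>\<^sub>F n in sequentially. birkhoff_sum ?f n x \<le> real n / real (Suc j)" by simp
  let ?avg = "\<lambda>n x. (\<Sum>k<n. indicat_real C ((T ^^ k) x)) / real n"
  have avg: "0 \<le> ?avg n x \<and> ?avg n x \<le> 1" for n x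
  proof -
    have "(\<Sum>k<n. indicat_real C ((T ^^ k) x)) \<le> (\<Sum>k<n. 1)" by (intro sum_mono) (simp add: indicator_def)
    then show ?thesis by (simp add: divide_le_eq sum_nonneg)
  qed
  have capped: "norm (indicat_real C x * max ?c (?avg n x)) \<le> 1 + ?c" for n x
  proof -
    have unit: "0 \<le> ?avg n x \<and> ?avg n x \<le> 1" by (rule avg)
    have "0 \<le> ?c" using d by simp
    then have "0 \<le> max ?c (?avg n x)" "max ?c (?avg n x) \<le> 1 + ?c" using unit by linarith+
    then show ?thesis using \<open>0 \<le> ?c\<close> by (cases "x \<in> C") simp_all
  qed
  obtain j where j: "1 / real (Suc j) < d" using d nat_approx_posE by blast
  have lim: "(\<lambda>n. \<integral>x. indicat_real C x * max ?c (?avg n x) \<partial>M) \<longlonglongrightarrow> (\<integral>x. indicat_real C x * ?c \<partial>M)"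
  proof (rule integral_dominated_convergence[where w="\<lambda>_. 1 + ?c"])
    show "AE x in M. (\<lambda>n. indicat_real C x * max ?c (?avg n x)) \<longlonglongrightarrow> indicat_real C x * ?c"
      using small
    proof eventually_elim
      case (elim x)
      then have "\<forall>\<^sub>F n in sequentially. birkhoff_sum ?f n x \<le> real n / real (Suc j)" by blast
      then have "\<forall>\<^sub>F n in sequentially. indicat_real C x * max ?c (?avg n x) = indicat_real C x * ?c"
        using eventually_gt_at_top[of 0]
      proof eventually_elim
        case (elim n)
        have "(\<Sum>k<n. indicat_real C ((T ^^ k) x)) = birkhoff_sum ?f n x + real n * (prob C + d)"
          by (simp add: birkhoff_sum_def sum_subtractf)
        also have "\<dots> \<le> real n * (1 / real (Suc j)) + real n * (prob C + d)" using elim by simp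
        also have "\<dots> \<le> real n * d + real n * (prob C + d)" using j by (intro add_right_mono mult_left_mono) auto
        finally have "?avg n x \<le> ?c" using elim(2) by (simp add: field_simps)
        then show ?case by simp
      qed
      then show ?case by (rule tendsto_eventually)
    qed
    show "AE x in M. norm (indicat_real C x * max ?c (?avg n x)) \<le> 1 + ?c" for n
      by (intro AE_I2 capped)
  qed measurable
  have "(\<integral>x. indicat_real C x * ?c \<partial>M) = prob C * ?c" by simp
  also have "\<dots> < prob C * prob C + e"
  proof -
    have "prob C * (2 * d) \<le> 1 * (2 * d)" using d by (intro mult_right_mono) auto
    moreover have "prob C * ?c = prob C * prob C + prob C * (2 * d)" by (simp add: distrib_left)
    ultimately show ?thesis using \<open>0 < e\<close> unfolding d_def by linarith
  qed
  finally have "\<forall>\<^sub>F n in sequentially. (\<integral>x. indicat_real C x * max ?c (?avg n x) \<partial>M) < prob C * prob C + e"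
    by (rule order_tendstoD(2)[OF lim])
  then show ?thesis
  proof eventually_elim
    case (elim n)
    have "(\<Sum>k<n. prob (C \<inter> (T ^^ k) -` C)) / real n = (\<integral>x. indicat_real C x * ?avg n x \<partial>M)"
    proof -
      have "prob (C \<inter> (T ^^ k) -` C) = (\<integral>x. indicat_real C x * indicat_real C ((T ^^ k) x) \<partial>M)" for k
      proof -
        have m: "C \<inter> (T ^^ k) -` C \<in> sets M"
        proof -
          have "C \<inter> ((T ^^ k) -` C \<inter> space M) \<in> sets M" by measurable
          also have "C \<inter> ((T ^^ k) -` C \<inter> space M) = C \<inter> (T ^^ k) -` C" using sets.sets_into_space[OF C] by auto
          finally show ?thesis .
        qed
        have "(\<integral>x. indicat_real C x * indicat_real C ((T ^^ k) x) \<partial>M) = (\<integral>x. indicat_real (C \<inter> (T ^^ k) -` C) x \<partial>M)"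
          by (intro Bochner_Integration.integral_cong refl) (auto simp: indicator_def)
        then show ?thesis using m by simp
      qed
      moreover have i: "integrable M (\<lambda>x. indicat_real C x * indicat_real C ((T ^^ k) x))" for k
        by (intro integrable_const_bound[of _ 1] AE_I2) (auto simp: indicator_def)
      ultimately show ?thesis
        by (simp only: times_divide_eq_right sum_distrib_left integral_divide_zero Bochner_Integration.integral_sum[OF i])
    qed
    also have "\<dots> \<le> (\<integral>x. indicat_real C x * max ?c (?avg n x) \<partial>M)"
    proof (rule integral_mono)
      show "integrable M (\<lambda>x. indicat_real C x * ?avg n x)"
        using avg by (intro integrable_const_bound[of _ 1] AE_I2) (auto simp: indicator_def)
      show "integrable M (\<lambda>x. indicat_real C x * max ?c (?avg n x))"
        using capped by (intro integrable_const_bound[of _ "1 + ?c"] AE_I2) auto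
      show "indicat_real C x * ?avg n x \<le> indicat_real C x * max ?c (?avg n x)" for x
        by (intro mult_left_mono) auto
    qed
    finally show ?case using elim by linarith
  qed
qed

end

section \<open>Mixing and ergodicity through the overlap of the spectral process\<close>

lemma min_add_left: "0 \<le> a \<Longrightarrow> 0 \<le> a' \<Longrightarrow> 0 \<le> b \<Longrightarrow> min (a + a') b \<le> min a b + min a' (b::real)"
  by (auto simp: min_def)

lemma min_sum_sum_le:
  fixes a :: "'i \<Rightarrow> real" and b :: "'j \<Rightarrow> real"
  assumes "finite I" "finite J" and a: "\<And>i. i \<in> I \<Longrightarrow> 0 \<le> a i" and b: "\<And>j. j \<in> J \<Longrightarrow> 0 \<le> b j"
  shows "min (\<Sum>i\<in>I. a i) (\<Sum>j\<in>J. b j) \<le> (\<Sum>i\<in>I. \<Sum>j\<in>J. min (a i) (b j))"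
proof -
  have one: "min c (\<Sum>j\<in>J. b j) \<le> (\<Sum>j\<in>J. min c (b j))" if "0 \<le> c" for c
    using assms(2) b
  proof (induction J rule: finite_induct)
    case (insert j J)
    have "min c (b j + (\<Sum>j\<in>J. b j)) \<le> min c (b j) + min c (\<Sum>j\<in>J. b j)"
      using min_add_left[of "b j" "\<Sum>j\<in>J. b j" c] insert.prems that by (simp add: min.commute sum_nonneg)
    then show ?case using insert by fastforce
  qed (use that in simp)
  show ?thesis
    using assms(1) a
  proof (induction I rule: finite_induct)
    case (insert i I)
    have "min (a i + (\<Sum>i\<in>I. a i)) (\<Sum>j\<in>J. b j) \<le> min (a i) (\<Sum>j\<in>J. b j) + min (\<Sum>i\<in>I. a i) (\<Sum>j\<in>J. b j)"
      using insert.prems b by (intro min_add_left) (auto simp: sum_nonneg)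
    also have "\<dots> \<le> (\<Sum>j\<in>J. min (a i) (b j)) + (\<Sum>i\<in>I. \<Sum>j\<in>J. min (a i) (b j))"
      using insert by (intro add_mono one) auto
    finally show ?case using insert.hyps by simp
  qed (use b in \<open>simp add: sum_nonneg\<close>)
qed

lemma min_scaled_le:
  fixes a b c c' :: real
  assumes "0 \<le> a" "0 \<le> b" "0 \<le> c" "0 \<le> c'"
  shows "min (c * a) (c' * b) \<le> (c + c') * min a b"
proof (cases "a \<le> b")
  case True
  have "c * a \<le> (c + c') * a" using assms by (intro mult_right_mono) auto
  then show ?thesis using True by (simp add: min_def)
next
  case False
  have "c' * b \<le> (c + c') * b" using assms by (intro mult_right_mono) auto
  then show ?thesis using False by (simp add: min_def)
qed

lemma exp_neg_increment:
  fixes d v :: real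
  assumes "0 \<le> d" "0 \<le> v - d"
  shows "\<bar>exp (- (v - d)) - exp (- v)\<bar> \<le> d"
proof -
  have "exp (- (v - d)) - exp (- v) = exp (- (v - d)) * (1 - exp (- d))"
    by (simp add: algebra_simps exp_add[symmetric])
  also have "\<dots> \<le> 1 * (1 - exp (- d))" using assms by (intro mult_right_mono) auto
  also have "\<dots> \<le> d" using exp_ge_add_one_self[of "- d"] by simp
  finally show ?thesis using assms by simp
qed

locale exponent_process = spectral_process P V + prob_space M
  for P :: "'w measure" and V :: "int \<Rightarrow> 'w \<Rightarrow> real" and M :: "'a measure" +
  fixes p :: ereal and Z :: "int \<Rightarrow> 'a \<Rightarrow> real"
  assumes p: "1 < p"
    and measurable_Z [measurable]: "\<And>s. Z s \<in> borel_measurable M"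
    and exponent_law: "has_exponent_law p P V M Z"
begin

abbreviation L :: "(int \<Rightarrow> real) measure" where "L \<equiv> path_law M Z"

lemma prob_space_L: "prob_space L"
  by (rule prob_space_path_law[OF prob_space_axioms measurable_Z])

lemma prob_below:
  assumes "finite J" "\<And>s. s \<in> J \<Longrightarrow> 0 < x s"
  shows "prob {\<omega>\<in>space M. \<forall>s\<in>J. Z s \<omega> \<le> x s} = exp (- exponent p J x)"
  using exponent_law assms by (simp add: has_exponent_law_def)

lemma AE_pos: "AE \<omega> in M. 0 < Z s \<omega>"
proof -
  have "prob {\<omega>\<in>space M. Z s \<omega> \<le> 0} \<le> exp (- real (Suc m))" for m
  proof -
    have "prob {\<omega>\<in>space M. Z s \<omega> \<le> 0} \<le> prob {\<omega>\<in>space M. \<forall>r\<in>{s}. Z r \<omega> \<le> 1 / real (Suc m)}"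
    proof (rule finite_measure_mono)
      have "Z s \<omega> \<le> 1 / real (Suc m)" if "Z s \<omega> \<le> 0" for \<omega>
        using that by (rule order_trans) simp
      then show "{\<omega>\<in>space M. Z s \<omega> \<le> 0} \<subseteq> {\<omega>\<in>space M. \<forall>r\<in>{s}. Z r \<omega> \<le> 1 / real (Suc m)}" by blast
    qed measurable
    also have "\<dots> = exp (- exponent p {s} (\<lambda>_. 1 / real (Suc m)))"
      by (rule prob_below) auto
    also have "exponent p {s} (\<lambda>_. 1 / real (Suc m)) = real (Suc m)"
      using p by (simp add: exponent_singleton)
    finally show ?thesis .
  qed
  moreover have "(\<lambda>m. exp (- real (Suc m))) \<longlonglongrightarrow> 0"
    by (rule filterlim_compose[OF exp_at_bot filterlim_compose[OF filterlim_uminus_at_bot_at_top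
        filterlim_compose[OF filterlim_real_sequentially filterlim_Suc]]])
  ultimately have "prob {\<omega>\<in>space M. Z s \<omega> \<le> 0} \<le> 0"
    by (intro LIMSEQ_le_const) auto
  then have "prob {\<omega>\<in>space M. Z s \<omega> \<le> 0} = 0" by (simp add: measure_le_0_iff)
  then have "AE \<omega> in M. \<omega> \<notin> {\<omega>\<in>space M. Z s \<omega> \<le> 0}"
    by (intro AE_not_in) (simp add: null_sets_def emeasure_eq_measure)
  with AE_space show ?thesis by eventually_elim auto
qed

text \<open>A nonpositive threshold gives probability \<open>0\<close> because the process is almost surely positive.\<close>

lemma orthant_prob:
  assumes "finite J"
  shows "measure L (lower_orthant J x) = (if \<forall>s\<in>J. 0 < x s then exp (- exponent p J x) else 0)"
proof (cases "\<forall>s\<in>J. 0 < x s")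
  case True
  then show ?thesis
    using assms by (simp add: measure_path_law_orthant prob_below)
next
  case False
  then obtain s where s: "s \<in> J" "x s \<le> 0" by (auto simp: not_less)
  have "measure M {\<omega>\<in>space M. \<forall>s\<in>J. Z s \<omega> \<le> x s} = measure M {}"
  proof (rule finite_measure_eq_AE)
    show "AE \<omega> in M. (\<omega> \<in> {\<omega>\<in>space M. \<forall>s\<in>J. Z s \<omega> \<le> x s}) = (\<omega> \<in> {})"
      using AE_pos[of s] by eventually_elim (use s in \<open>auto intro!: bexI[of _ s]\<close>)
  qed (use assms in measurable)
  then show ?thesis using False assms by (simp add: measure_path_law_orthant)
qed

lemma shifted_spectral_process: "spectral_process P (\<lambda>s. V (s + h))"
  by (rule spectral_process.intro) (rule prob_space_P spectral_measurable spectral_nonneg spectral_mean, assumption?)+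

lemma vimage_shift_orthant:
  "shift_path h -` lower_orthant J x = lower_orthant ((\<lambda>s. s + h) ` J) (\<lambda>s. x (s - h))"
  by (auto simp: shift_path_def lower_orthant_def)

lemma exponent_shift:
  "exponent p' ((\<lambda>s. s + h) ` J) (\<lambda>s. x (s - h)) = spectral_process.exponent P (\<lambda>s. V (s + h)) p' J x"
proof -
  interpret shifted: spectral_process P "\<lambda>s. V (s + h)" by (rule shifted_spectral_process)
  show ?thesis
    unfolding exponent_def shifted.exponent_def
  proof (rule Bochner_Integration.integral_cong[OF refl])
    fix \<omega>
    have "inj_on (\<lambda>s. s + h) J" by (simp add: inj_on_def)
    from coordinate_norm_image[OF this, of p' "\<lambda>s. V s \<omega> / x (s - h)"]
    show "coordinate_norm p' ((\<lambda>s. s + h) ` J) (\<lambda>s. V s \<omega> / x (s - h)) = coordinate_norm p' J (\<lambda>s. V (s + h) \<omega> / x s)"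
      by simp
  qed
qed

lemma stationary_iff:
  "stationary_process M Z \<longleftrightarrow>
    (\<forall>h J x. finite J \<longrightarrow> (\<forall>s\<in>J. 0 < x s) \<longrightarrow>
      spectral_process.exponent P (\<lambda>s. V (s + h)) p J x = exponent p J x)"
proof -
  have shifted: "measure (distr L path_space (shift_path h)) (lower_orthant J x)
      = (if \<forall>s\<in>J. 0 < x s then exp (- spectral_process.exponent P (\<lambda>s. V (s + h)) p J x) else 0)"
    if "finite J" for h J x
  proof -
    have "measure (distr L path_space (shift_path h)) (lower_orthant J x) = measure L (shift_path h -` lower_orthant J x)"
      using measure_distr[of "shift_path h" L path_space "lower_orthant J x"] sets_lower_orthant[OF that] measurable_shift_path
      by (simp add: measurable_cong_sets[OF sets_path_law refl])
    also have "\<dots> = (if \<forall>s\<in>(\<lambda>s. s + h) ` J. 0 < x (s - h)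
        then exp (- exponent p ((\<lambda>s. s + h) ` J) (\<lambda>s. x (s - h))) else 0)"
      unfolding vimage_shift_orthant using that by (intro orthant_prob) simp
    finally show ?thesis unfolding exponent_shift by simp
  qed
  show ?thesis
  proof
    assume st: "stationary_process M Z"
    show "\<forall>h J x. finite J \<longrightarrow> (\<forall>s\<in>J. 0 < x s) \<longrightarrow>
      spectral_process.exponent P (\<lambda>s. V (s + h)) p J x = exponent p J x"
    proof (intro allI impI)
      fix h :: int and J :: "int set" and x :: "int \<Rightarrow> real" assume J: "finite J" "\<forall>s\<in>J. 0 < x s"
      show "spectral_process.exponent P (\<lambda>s. V (s + h)) p J x = exponent p J x"
      proof -
        have "distr L path_space (shift_path h) = L" using st by (simp add: stationary_process_def)
        then have "exp (- spectral_process.exponent P (\<lambda>s. V (s + h)) p J x) = exp (- exponent p J x)"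
          using shifted[OF J(1), of h x] orthant_prob[OF J(1), of x] J(2) by simp
        then show ?thesis by simp
      qed
    qed
  next
    assume inv: "\<forall>h J x. finite J \<longrightarrow> (\<forall>s\<in>J. 0 < x s) \<longrightarrow>
      spectral_process.exponent P (\<lambda>s. V (s + h)) p J x = exponent p J x"
    show "stationary_process M Z"
      unfolding stationary_process_def
    proof
      fix h
      have "shift_path h \<in> measurable L path_space"
        by (subst measurable_cong_sets[OF sets_path_law refl]) (rule measurable_shift_path)
      then have pr: "prob_space (distr L path_space (shift_path h))"
        by (rule prob_space.prob_space_distr[OF prob_space_L])
      show "distr L path_space (shift_path h) = L"
        by (rule finite_path_measure_eqI[OF prob_space.finite_measure[OF pr] prob_space.finite_measure[OF prob_space_L]]) (use inv in \<open>auto simp: shifted orthant_prob\<close>)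
    qed
  qed
qed

lemma stationary_invariant_path_law: "stationary_process M Z \<Longrightarrow> invariant_path_law L"
  using prob_space_L by (simp add: invariant_path_law_def invariant_path_law_axioms_def stationary_process_def)

text \<open>Asymptotic independence of \<open>Z\<close> is measured by this quantity, which involves \<open>V\<close> but not \<open>p\<close>.\<close>

definition overlap :: "int \<Rightarrow> int \<Rightarrow> real"
  where "overlap s t = (\<integral>\<omega>. min (V s \<omega>) (V t \<omega>) \<partial>P)"

lemma integrable_min [simp, intro]: "integrable P (\<lambda>\<omega>. min (V s \<omega>) (V t \<omega>))"
  by (rule Bochner_Integration.integrable_bound[OF integrable_spectral[of s]]) (auto simp: spectral_nonneg)

lemma overlap_nonneg: "0 \<le> overlap s t"
  unfolding overlap_def by (intro Bochner_Integration.integral_nonneg) (auto simp: spectral_nonneg)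

lemma overlap_eq:
  assumes "s \<noteq> t" shows "overlap s t = 2 - exponent \<infinity> {s, t} (\<lambda>_. 1)"
proof -
  have "exponent \<infinity> {s, t} (\<lambda>_. 1) = (\<integral>\<omega>. V s \<omega> + V t \<omega> - min (V s \<omega>) (V t \<omega>) \<partial>P)"
    unfolding exponent_def coordinate_norm_def
    by (intro Bochner_Integration.integral_cong refl) (auto simp: spectral_nonneg max_def min_def)
  then show ?thesis by (simp add: overlap_def)
qed

lemma overlap_shift:
  assumes inv: "\<And>h J x. finite J \<Longrightarrow> (\<And>s. s \<in> J \<Longrightarrow> 0 < x s) \<Longrightarrow>
      spectral_process.exponent P (\<lambda>s. V (s + h)) \<infinity> J x = exponent \<infinity> J x"
  shows "overlap (s + h) (t + h) = overlap s t"
proof (cases "s = t")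
  case True then show ?thesis by (simp add: overlap_def)
next
  case False
  have "exponent \<infinity> {s + h, t + h} (\<lambda>_. 1) = exponent \<infinity> {s, t} (\<lambda>_. 1)"
    using exponent_shift[of \<infinity> h "{s, t}" "\<lambda>_. 1"] inv[of "{s, t}" "\<lambda>_. 1" h] by simp
  then show ?thesis using False by (simp add: overlap_eq)
qed

text \<open>The number \<open>d\<close> is the expected triangle defect of the two norms. It is the loss in the exponent
  compared with independence.\<close>

lemma joint_orthant_prob:
  fixes n :: nat
  assumes J: "finite J" "\<And>s. s \<in> J \<Longrightarrow> 0 < x s" and K: "finite K" "\<And>t. t \<in> K \<Longrightarrow> 0 < y t"
    and disj: "J \<inter> (\<lambda>t. t + int n) ` K = {}"
  defines "K' \<equiv> (\<lambda>t. t + int n) ` K" and "y' \<equiv> \<lambda>t. y (t - int n)"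
  defines "d \<equiv> (\<integral>\<omega>. coordinate_norm p J (\<lambda>s. V s \<omega> / x s) + coordinate_norm p K' (\<lambda>t. V t \<omega> / y' t)
      - norm_join p (coordinate_norm p J (\<lambda>s. V s \<omega> / x s)) (coordinate_norm p K' (\<lambda>t. V t \<omega> / y' t)) \<partial>P)"
  shows "measure L (lower_orthant J x \<inter> shift_path (int n) -` lower_orthant K y) = exp (- (exponent p J x + exponent p K' y' - d))"
    and "0 \<le> exponent p J x + exponent p K' y' - d"
    and "integrable P (\<lambda>\<omega>. coordinate_norm p J (\<lambda>s. V s \<omega> / x s) + coordinate_norm p K' (\<lambda>t. V t \<omega> / y' t)
      - norm_join p (coordinate_norm p J (\<lambda>s. V s \<omega> / x s)) (coordinate_norm p K' (\<lambda>t. V t \<omega> / y' t)))"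
proof -
  (* the intersection is the orthant over J \<union> K' with the thresholds merged *)
  let ?w = "\<lambda>s. if s \<in> J then x s else y' s"
  have K': "finite K'" "\<And>t. t \<in> K' \<Longrightarrow> 0 < y' t" using K by (auto simp: K'_def y'_def)
  have dj: "J \<inter> K' = {}" using disj by (simp add: K'_def)
  have w: "\<And>s. s \<in> J \<union> K' \<Longrightarrow> 0 < ?w s" using J K' by auto
  have JK: "finite (J \<union> K')" using J K' by simp
  have join: "coordinate_norm p (J \<union> K') (\<lambda>s. V s \<omega> / ?w s)
      = norm_join p (coordinate_norm p J (\<lambda>s. V s \<omega> / x s)) (coordinate_norm p K' (\<lambda>t. V t \<omega> / y' t))" for \<omega>
  proof -
    have "coordinate_norm p J (\<lambda>s. V s \<omega> / ?w s) = coordinate_norm p J (\<lambda>s. V s \<omega> / x s)"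
      by (rule coordinate_norm_cong) auto
    moreover have "coordinate_norm p K' (\<lambda>s. V s \<omega> / ?w s) = coordinate_norm p K' (\<lambda>t. V t \<omega> / y' t)"
      using dj by (intro coordinate_norm_cong) auto
    ultimately show ?thesis using coordinate_norm_Un[OF p J(1) K'(1) dj] by simp
  qed
  have int: "integrable P (\<lambda>\<omega>. coordinate_norm p J (\<lambda>s. V s \<omega> / x s))"
    "integrable P (\<lambda>\<omega>. coordinate_norm p K' (\<lambda>t. V t \<omega> / y' t))"
    "integrable P (\<lambda>\<omega>. norm_join p (coordinate_norm p J (\<lambda>s. V s \<omega> / x s)) (coordinate_norm p K' (\<lambda>t. V t \<omega> / y' t)))"
    using integrable_coordinate_norm[of p J x] integrable_coordinate_norm[of p K' y'] integrable_coordinate_norm[of p "J \<union> K'" ?w]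
      p J K' JK w unfolding join by blast+
  then show "integrable P (\<lambda>\<omega>. coordinate_norm p J (\<lambda>s. V s \<omega> / x s) + coordinate_norm p K' (\<lambda>t. V t \<omega> / y' t)
      - norm_join p (coordinate_norm p J (\<lambda>s. V s \<omega> / x s)) (coordinate_norm p K' (\<lambda>t. V t \<omega> / y' t)))"
    by simp
  have e: "exponent p (J \<union> K') ?w = exponent p J x + exponent p K' y' - d"
    using int unfolding exponent_def d_def join by simp
  have "shift_path (int n) -` lower_orthant K y = lower_orthant K' y'"
    by (simp add: vimage_shift_orthant K'_def y'_def)
  then have "lower_orthant J x \<inter> shift_path (int n) -` lower_orthant K y = lower_orthant (J \<union> K') ?w"
    using dj by (auto simp: lower_orthant_def)
  then have "measure L (lower_orthant J x \<inter> shift_path (int n) -` lower_orthant K y) = exp (- exponent p (J \<union> K') ?w)"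
    using orthant_prob[OF JK, of ?w] w by simp
  then show "measure L (lower_orthant J x \<inter> shift_path (int n) -` lower_orthant K y) = exp (- (exponent p J x + exponent p K' y' - d))"
    by (simp add: e)
  show "0 \<le> exponent p J x + exponent p K' y' - d"
    unfolding e[symmetric] by (rule exponent_nonneg[OF JK])
qed

text \<open>The triangle defect is at most the minimum of the two norms, hence at most the sum over all pairs
  of minima of single coordinates.\<close>

lemma correlation_upper_bound:
  fixes n :: nat
  assumes st: "stationary_process M Z"
    and J: "finite J" "\<And>s. s \<in> J \<Longrightarrow> 0 < x s" and K: "finite K" "\<And>t. t \<in> K \<Longrightarrow> 0 < y t"
    and disj: "J \<inter> (\<lambda>t. t + int n) ` K = {}"
  shows "\<bar>invariant_path_law.correlation L (lower_orthant J x) (lower_orthant K y) n\<bar>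
    \<le> (\<Sum>s\<in>J. \<Sum>t\<in>K. (1 / x s + 1 / y t) * overlap s (t + int n))"
proof -
  interpret law: invariant_path_law L
    by (rule stationary_invariant_path_law[OF st])
  let ?K = "(\<lambda>t. t + int n) ` K" and ?y = "\<lambda>t. y (t - int n)"
  let ?a = "\<lambda>\<omega>. coordinate_norm p J (\<lambda>s. V s \<omega> / x s)" and ?b = "\<lambda>\<omega>. coordinate_norm p ?K (\<lambda>t. V t \<omega> / ?y t)"
  let ?d = "\<integral>\<omega>. ?a \<omega> + ?b \<omega> - norm_join p (?a \<omega>) (?b \<omega>) \<partial>P"
  let ?v = "exponent p J x + exponent p ?K ?y"
  have jo: "measure L (lower_orthant J x \<inter> shift_path (int n) -` lower_orthant K y) = exp (- (?v - ?d))"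
    by (rule joint_orthant_prob(1)[OF J K disj])
  have nonneg: "0 \<le> ?v - ?d"
    by (rule joint_orthant_prob(2)[OF J K disj])
  have K': "finite ?K" "\<And>t. t \<in> ?K \<Longrightarrow> 0 < ?y t" using K by auto
  have PJ: "measure L (lower_orthant J x) = exp (- exponent p J x)"
    using J by (simp add: orthant_prob)
  have "measure L (lower_orthant K y) = measure L (shift_path (int n) -` lower_orthant K y)"
    using K by (simp add: law.prob_shift sets_lower_orthant)
  also have "\<dots> = exp (- exponent p ?K ?y)"
    using K' by (simp add: vimage_shift_orthant orthant_prob)
  finally have PK: "measure L (lower_orthant K y) = exp (- exponent p ?K ?y)" .
  have corr: "law.correlation (lower_orthant J x) (lower_orthant K y) n = exp (- (?v - ?d)) - exp (- ?v)"
    unfolding law.correlation_def jo PJ PK by (simp add: exp_add[symmetric])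
  have ab: "0 \<le> ?a \<omega>" "0 \<le> ?b \<omega>" for \<omega> using J K' by (auto intro: coordinate_norm_nonneg)
  have d0: "0 \<le> ?d"
  proof (intro Bochner_Integration.integral_nonneg)
    fix \<omega>
    have "0 \<le> defect_factor p * min (?a \<omega>) (?b \<omega>)"
      using ab[of \<omega>] defect_factor_pos[OF p] by (intro mult_nonneg_nonneg) (auto simp: less_imp_le)
    then show "0 \<le> ?a \<omega> + ?b \<omega> - norm_join p (?a \<omega>) (?b \<omega>)"
      using norm_join_bounds(3)[OF p ab(1)[of \<omega>] ab(2)[of \<omega>]] by linarith
  qed
  have dle: "?d \<le> (\<Sum>s\<in>J. \<Sum>t\<in>K. (1 / x s + 1 / y t) * overlap s (t + int n))"
  proof -
    have "?d \<le> (\<integral>\<omega>. (\<Sum>s\<in>J. \<Sum>t\<in>K. (1 / x s + 1 / y t) * min (V s \<omega>) (V (t + int n) \<omega>)) \<partial>P)"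
    proof (rule integral_mono)
      show "integrable P (\<lambda>\<omega>. ?a \<omega> + ?b \<omega> - norm_join p (?a \<omega>) (?b \<omega>))"
        by (rule joint_orthant_prob(3)[OF J K disj])
      show "integrable P (\<lambda>\<omega>. \<Sum>s\<in>J. \<Sum>t\<in>K. (1 / x s + 1 / y t) * min (V s \<omega>) (V (t + int n) \<omega>))"
        by simp
      fix \<omega> assume \<omega>: "\<omega> \<in> space P"
      have nJ: "0 \<le> V s \<omega> / x s" if "s \<in> J" for s using J(2)[OF that] spectral_nonneg[OF \<omega>] by simp
      have nK: "0 \<le> V (t + int n) \<omega> / y t" if "t \<in> K" for t using K(2)[OF that] spectral_nonneg[OF \<omega>] by simp
      have bK: "?b \<omega> = coordinate_norm p K (\<lambda>t. V (t + int n) \<omega> / y t)"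
        by (simp add: coordinate_norm_image inj_on_def)
      have "?a \<omega> + ?b \<omega> - norm_join p (?a \<omega>) (?b \<omega>) \<le> min (?a \<omega>) (?b \<omega>)"
        using norm_join_bounds(1,2)[OF p ab(1)[of \<omega>] ab(2)[of \<omega>]] by (simp add: min_def)
      also have "\<dots> \<le> min (\<Sum>s\<in>J. V s \<omega> / x s) (\<Sum>t\<in>K. V (t + int n) \<omega> / y t)"
        unfolding bK using J(1) K(1) nJ nK by (intro min.mono coordinate_norm_le_sum[OF p]) auto
      also have "\<dots> \<le> (\<Sum>s\<in>J. \<Sum>t\<in>K. min (V s \<omega> / x s) (V (t + int n) \<omega> / y t))"
        using J(1) K(1) nJ nK by (intro min_sum_sum_le) auto
      also have "\<dots> \<le> (\<Sum>s\<in>J. \<Sum>t\<in>K. (1 / x s + 1 / y t) * min (V s \<omega>) (V (t + int n) \<omega>))"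
      proof (intro sum_mono)
        fix s t assume "s \<in> J" "t \<in> K"
        then show "min (V s \<omega> / x s) (V (t + int n) \<omega> / y t) \<le> (1 / x s + 1 / y t) * min (V s \<omega>) (V (t + int n) \<omega>)"
          using min_scaled_le[of "V s \<omega>" "V (t + int n) \<omega>" "1 / x s" "1 / y t"] J(2) K(2) spectral_nonneg[OF \<omega>]
          by (simp add: less_imp_le)
      qed
      finally show "?a \<omega> + ?b \<omega> - norm_join p (?a \<omega>) (?b \<omega>)
          \<le> (\<Sum>s\<in>J. \<Sum>t\<in>K. (1 / x s + 1 / y t) * min (V s \<omega>) (V (t + int n) \<omega>))" .
    qed
    also have "\<dots> = (\<Sum>s\<in>J. \<Sum>t\<in>K. (1 / x s + 1 / y t) * overlap s (t + int n))"
      by (simp add: overlap_def)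
    finally show ?thesis .
  qed
  have "\<bar>law.correlation (lower_orthant J x) (lower_orthant K y) n\<bar> \<le> ?d"
    unfolding corr by (rule exp_neg_increment[OF d0 nonneg])
  then show ?thesis using dle by (rule order_trans)
qed

text \<open>For single coordinates the triangle defect is at least \<open>defect_factor p\<close> times the minimum.\<close>

lemma correlation_lower_bound:
  assumes st: "stationary_process M Z" and n: "0 < n"
  defines "B \<equiv> lower_orthant {0} (\<lambda>_. 1)"
  shows "exp (- 2) * defect_factor p * overlap 0 (int n) \<le> invariant_path_law.correlation L B B n"
proof -
  interpret law: invariant_path_law L
    by (rule stationary_invariant_path_law[OF st])
  have disj: "{0} \<inter> (\<lambda>t. t + int n) ` {0} = {}" using n by auto
  note jo = joint_orthant_prob[of "{0}" "\<lambda>_. 1" "{0}" "\<lambda>_. 1" n, OF _ _ _ _ disj]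
  let ?d = "\<integral>\<omega>. coordinate_norm p {0} (\<lambda>s. V s \<omega> / 1) + coordinate_norm p ((\<lambda>t. t + int n) ` {0}) (\<lambda>t. V t \<omega> / 1)
      - norm_join p (coordinate_norm p {0} (\<lambda>s. V s \<omega> / 1)) (coordinate_norm p ((\<lambda>t. t + int n) ` {0}) (\<lambda>t. V t \<omega> / 1)) \<partial>P"
  (* 2 is the exponent of the two coordinates if they were independent *)
  have jp: "measure L (B \<inter> shift_path (int n) -` B) = exp (- (2 - ?d))"
    using jo(1) p by (simp add: B_def exponent_singleton)
  have PB: "measure L B = exp (- 1)"
    using p by (simp add: B_def orthant_prob exponent_singleton)
  have "defect_factor p * overlap 0 (int n) = (\<integral>\<omega>. defect_factor p * min (V 0 \<omega>) (V (int n) \<omega>) \<partial>P)"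
    by (simp add: overlap_def)
  also have "\<dots> \<le> ?d"
  proof (rule integral_mono)
    show "integrable P (\<lambda>\<omega>. defect_factor p * min (V 0 \<omega>) (V (int n) \<omega>))" by simp
    show "integrable P (\<lambda>\<omega>. coordinate_norm p {0} (\<lambda>s. V s \<omega> / 1) + coordinate_norm p ((\<lambda>t. t + int n) ` {0}) (\<lambda>t. V t \<omega> / 1)
      - norm_join p (coordinate_norm p {0} (\<lambda>s. V s \<omega> / 1)) (coordinate_norm p ((\<lambda>t. t + int n) ` {0}) (\<lambda>t. V t \<omega> / 1)))"
      by (rule jo(3)) auto
    fix \<omega> assume \<omega>: "\<omega> \<in> space P"
    show "defect_factor p * min (V 0 \<omega>) (V (int n) \<omega>)
      \<le> coordinate_norm p {0} (\<lambda>s. V s \<omega> / 1) + coordinate_norm p ((\<lambda>t. t + int n) ` {0}) (\<lambda>t. V t \<omega> / 1)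
      - norm_join p (coordinate_norm p {0} (\<lambda>s. V s \<omega> / 1)) (coordinate_norm p ((\<lambda>t. t + int n) ` {0}) (\<lambda>t. V t \<omega> / 1))"
      using norm_join_bounds(3)[OF p, of "V 0 \<omega>" "V (int n) \<omega>"] spectral_nonneg[OF \<omega>]
      by (simp add: coordinate_norm_singleton[OF p])
  qed
  finally have le: "defect_factor p * overlap 0 (int n) \<le> ?d" .
  have "exp (- 2) * defect_factor p * overlap 0 (int n) \<le> exp (- (2 - d)) - exp (- 1) * exp (- 1)"
    if "defect_factor p * overlap 0 (int n) \<le> d" for d :: real
  proof -
    have "exp (- 2) * (defect_factor p * overlap 0 (int n)) \<le> exp (- 2) * (exp d - 1)"
    proof (rule mult_left_mono)
      show "defect_factor p * overlap 0 (int n) \<le> exp d - 1" 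
        by (rule order_trans[OF that]) (simp add: le_diff_eq add.commute)
    qed simp
    then show ?thesis by (simp add: algebra_simps exp_add[symmetric] exp_diff[symmetric])
  qed
  from this[OF le] show ?thesis unfolding law.correlation_def jp PB .
qed

text \<open>From some \<open>n\<close> on, \<open>J\<close> and \<open>K\<close> shifted by \<open>n\<close> are disjoint, and the correlation is dominated by finitely
  many shifts of the sequence of overlaps.\<close>

lemma null_overlap_imp_null_correlations:
  assumes mode: "null_mode null" and st: "stationary_process M Z"
    and shift: "\<And>s t h. overlap (s + h) (t + h) = overlap s t"
    and ov: "null (\<lambda>n. overlap 0 (int n))"
    and EF: "E \<in> sets path_space" "F \<in> sets path_space"
  shows "null (invariant_path_law.correlation L E F)"
proof -
  interpret null_mode null by fact
  have inv: "invariant_path_law L"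
    by (rule stationary_invariant_path_law[OF st])
  interpret law: invariant_path_law L by fact
  have diag: "null (\<lambda>n. overlap s (t + int n))" for s t
  proof -
    have eq: "overlap s (t + int n) = overlap 0 (int n + (t - s))" for n
      using shift[of 0 s "int n + (t - s)"] by (simp add: algebra_simps)
    obtain i j :: nat where ij: "t - s = int i - int j" by (metis int_diff_cases)
    have "null (\<lambda>n. overlap 0 (int (n + i)))" using ov null_shift[of "\<lambda>n. overlap 0 (int n)" i] by simp
    moreover have "(\<lambda>n. overlap 0 (int (n + i))) = (\<lambda>n. overlap 0 (int (n + j) + (t - s)))"
      unfolding ij by (simp add: algebra_simps)
    ultimately have "null (\<lambda>n. overlap 0 (int (n + j) + (t - s)))" by simp
    then have "null (\<lambda>n. overlap 0 (int n + (t - s)))"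
      using null_shift[of "\<lambda>n. overlap 0 (int n + (t - s))" j] by simp
    then show ?thesis by (simp only: eq)
  qed
  show ?thesis
  proof (rule correlations_null[OF inv _ EF])
    fix J K :: "int set" and x y :: "int \<Rightarrow> real" assume J: "finite J" and K: "finite K"
    show "null (law.correlation (lower_orthant J x) (lower_orthant K y))"
    proof (cases "(\<forall>s\<in>J. 0 < x s) \<and> (\<forall>t\<in>K. 0 < y t)")
      case False
      have "law.correlation (lower_orthant J x) (lower_orthant K y) n = 0" for n
      proof -
        have mj: "measure L (lower_orthant J x \<inter> shift_path (int n) -` lower_orthant K y) \<le> measure L (lower_orthant J x)"
          "measure L (lower_orthant J x \<inter> shift_path (int n) -` lower_orthant K y) \<le> measure L (shift_path (int n) -` lower_orthant K y)"
          using J K by (auto intro!: law.finite_measure_mono law.sets_shift simp: sets_lower_orthant)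
        have "measure L (lower_orthant J x) = 0 \<or> measure L (lower_orthant K y) = 0"
          using False J K by (auto simp: orthant_prob)
        moreover have "measure L (shift_path (int n) -` lower_orthant K y) = measure L (lower_orthant K y)"
          using K by (simp add: law.prob_shift sets_lower_orthant)
        ultimately have "measure L (lower_orthant J x \<inter> shift_path (int n) -` lower_orthant K y) = 0"
          using mj measure_nonneg[of L "lower_orthant J x \<inter> shift_path (int n) -` lower_orthant K y"] by (elim disjE) linarith+
        with \<open>measure L (lower_orthant J x) = 0 \<or> measure L (lower_orthant K y) = 0\<close> show ?thesis
          unfolding law.correlation_def by auto
      qed
      then have "law.correlation (lower_orthant J x) (lower_orthant K y) = (\<lambda>_. 0)" by (rule ext)
      then show ?thesis using null_zero by simp
    next
      case True
      define bound where "bound n = (\<Sum>s\<in>J. \<Sum>t\<in>K. (1 / x s + 1 / y t) * overlap s (t + int n))" for n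
      have bound: "null bound"
        unfolding bound_def[abs_def] using J K by (intro null_sum null_cmult diag)
      obtain m where m: "J \<inter> (\<lambda>t. t + int n) ` K = {}" if "m \<le> n" for n
      proof -
        have "finite ((\<lambda>(s, t). nat (s - t)) ` (J \<times> K))" using J K by simp
        then obtain m where "(\<lambda>(s, t). nat (s - t)) ` (J \<times> K) \<subseteq> {..<m}"
          unfolding finite_nat_iff_bounded by blast
        then have m: "nat (s - t) < m" if "s \<in> J" "t \<in> K" for s t using that by auto
        have "J \<inter> (\<lambda>t. t + int n) ` K = {}" if n: "m \<le> n" for n
        proof (rule ccontr)
          assume "J \<inter> (\<lambda>t. t + int n) ` K \<noteq> {}"
          then obtain t where "t \<in> K" "t + int n \<in> J" by blast
          with m[of "t + int n" t] n show False by simp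
        qed
        then show ?thesis by (rule that)
      qed
      have "null (\<lambda>n. law.correlation (lower_orthant J x) (lower_orthant K y) (n + m))"
      proof (rule null_dominated[of "\<lambda>n. bound (n + m)" _ 1])
        show "null (\<lambda>n. bound (n + m))" using bound by (simp add: null_shift)
        fix n
        have "\<bar>law.correlation (lower_orthant J x) (lower_orthant K y) (n + m)\<bar> \<le> bound (n + m)"
          unfolding bound_def by (rule correlation_upper_bound[OF st J _ K _ m]) (use True in auto)
        then show "\<bar>law.correlation (lower_orthant J x) (lower_orthant K y) (n + m)\<bar> \<le> 1 * \<bar>bound (n + m)\<bar>" by linarith
      qed
      then show ?thesis by (simp add: null_shift)
    qed
  qed
qed

lemma null_correlation_imp_null_overlap:
  assumes mode: "null_mode null" and st: "stationary_process M Z"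
    and corr: "null (invariant_path_law.correlation L (lower_orthant {0} (\<lambda>_. 1)) (lower_orthant {0} (\<lambda>_. 1)))"
      (is "null ?c")
  shows "null (\<lambda>n. overlap 0 (int n))"
proof -
  interpret null_mode null by fact
  have "null (\<lambda>n. overlap 0 (int (Suc n)))"
  proof (rule null_dominated)
    show "null (\<lambda>n. ?c (Suc n))" using corr by (simp only: null_Suc)
    fix n
    have pos: "0 < exp (- 2) * defect_factor p" using defect_factor_pos[OF p] by simp
    have "exp (- 2) * defect_factor p * overlap 0 (int (Suc n)) \<le> ?c (Suc n)"
      by (rule correlation_lower_bound[OF st]) simp
    then have "overlap 0 (int (Suc n)) \<le> 1 / (exp (- 2) * defect_factor p) * ?c (Suc n)"
      using pos by (simp add: field_simps)
    also have "\<dots> \<le> 1 / (exp (- 2) * defect_factor p) * \<bar>?c (Suc n)\<bar>"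
      using pos by (intro mult_left_mono) auto
    finally show "\<bar>overlap 0 (int (Suc n))\<bar> \<le> 1 / (exp (- 2) * defect_factor p) * \<bar>?c (Suc n)\<bar>"
      using overlap_nonneg[of 0 "int (Suc n)"] by linarith
  qed
  then show ?thesis using null_Suc[of "\<lambda>n. overlap 0 (int n)"] by blast
qed

lemma mixing_iff:
  assumes st: "stationary_process M Z"
    and shift: "\<And>s t h. overlap (s + h) (t + h) = overlap s t"
  shows "mixing_process M Z \<longleftrightarrow> vanishes (\<lambda>n. overlap 0 (int n))"
proof -
  interpret law: invariant_path_law L
    by (rule stationary_invariant_path_law[OF st])
  have iff: "mixing_process M Z \<longleftrightarrow> (\<forall>E\<in>sets path_space. \<forall>F\<in>sets path_space. vanishes (law.correlation E F))"
    unfolding mixing_process_def vanishes_def law.correlation_def[abs_def] by (simp add: LIM_zero_iff)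
  show ?thesis
  proof
    assume "mixing_process M Z"
    then show "vanishes (\<lambda>n. overlap 0 (int n))"
      unfolding iff by (intro null_correlation_imp_null_overlap[OF vanishing.null_mode_axioms st]) (auto simp: sets_lower_orthant)
  next
    assume "vanishes (\<lambda>n. overlap 0 (int n))"
    then show "mixing_process M Z"
      unfolding iff by (auto intro: null_overlap_imp_null_correlations[OF vanishing.null_mode_axioms st shift])
  qed
qed

text \<open>If the overlaps vanish on average, an invariant event \<open>E\<close> has constant correlation
  \<open>P(E) - P(E)\<^sup>2\<close> with itself, which must be \<open>0\<close>. Conversely, ergodicity bounds the averaged correlations
  of one orthant from above, and these are non-negative and dominate the overlaps.\<close>

lemma ergodic_iff:
  assumes st: "stationary_process M Z"
    and shift: "\<And>s t h. overlap (s + h) (t + h) = overlap s t"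
  shows "ergodic_process M Z \<longleftrightarrow> vanishes_on_average (\<lambda>n. overlap 0 (int n))"
proof
  interpret law: invariant_path_law L
    by (rule stationary_invariant_path_law[OF st])
  {
    assume ov: "vanishes_on_average (\<lambda>n. overlap 0 (int n))"
    show "ergodic_process M Z"
      unfolding ergodic_process_def
    proof (intro ballI impI)
      fix E assume E: "E \<in> sets path_space" "shift_path 1 -` E = E"
      have inv: "shift_path (int n) -` E = E" for n
      proof (induction n)
        case (Suc n)
        have "shift_path (int (Suc n)) -` E = shift_path (int n) -` (shift_path 1 -` E)"
          by (auto simp: shift_path_def algebra_simps)
        then show ?case using Suc E(2) by simp
      qed (auto simp: shift_path_def)
      let ?c = "measure L E - measure L E * measure L E"
      have "vanishes_on_average (law.correlation E E)"
        using null_overlap_imp_null_correlations[OF averaging.null_mode_axioms st shift ov E(1) E(1)] .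
      then have "(\<lambda>n. (\<Sum>k<n. \<bar>?c\<bar>) / real n) \<longlonglongrightarrow> 0"
        by (simp add: vanishes_on_average_def law.correlation_def[abs_def] inv)
      moreover have "(\<lambda>n. (\<Sum>k<n. \<bar>?c\<bar>) / real n) \<longlonglongrightarrow> \<bar>?c\<bar>"
        by (rule tendsto_eventually) (use eventually_gt_at_top[of 0] in \<open>eventually_elim, simp\<close>)
      ultimately have "\<bar>?c\<bar> = 0" by (rule LIMSEQ_unique[symmetric])
      then have "measure L E * (1 - measure L E) = 0" by (simp add: algebra_simps)
      then show "measure L E = 0 \<or> measure L E = 1" by auto
    qed
  }
  assume erg: "ergodic_process M Z"
  have mT: "shift_path 1 \<in> measurable L L"
    by (simp add: measurable_cong_sets[OF sets_path_law sets_path_law])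
  have "distr L L (shift_path 1) = distr L path_space (shift_path 1)"
    by (rule distr_cong) simp_all
  then have pT: "distr L L (shift_path 1) = L" by (simp add: law.invariant)
  interpret T: measure_preserving_map L "shift_path 1"
    by unfold_locales (fact mT pT)+
  let ?B = "lower_orthant {0} (\<lambda>_. 1)"
  have B: "?B \<in> sets L" by (simp add: sets_lower_orthant)
  have c0: "0 \<le> law.correlation ?B ?B n" for n
  proof (cases "n = 0")
    case True
    have "shift_path 0 -` ?B = ?B" by (auto simp: shift_path_def)
    then show ?thesis using True by (simp add: law.correlation_def mult_left_le)
  next
    case False
    have "0 \<le> exp (- 2) * defect_factor p * overlap 0 (int n)"
      using defect_factor_pos[OF p] overlap_nonneg by (intro mult_nonneg_nonneg) (auto simp: less_imp_le)
    also have "\<dots> \<le> law.correlation ?B ?B n" using False by (intro correlation_lower_bound[OF st]) simp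
    finally show ?thesis .
  qed
  have "vanishes_on_average (law.correlation ?B ?B)"
    unfolding vanishes_on_average_def
  proof (rule LIMSEQ_I)
    fix r :: real assume "0 < r"
    have "\<forall>\<^sub>F n in sequentially. (\<Sum>k<n. measure L (?B \<inter> (shift_path 1 ^^ k) -` ?B)) / real n \<le> measure L ?B * measure L ?B + r / 2"
    proof (rule T.ergodic_correlation_average_upper[OF _ B])
      show "measure L E = 0 \<or> measure L E = 1" if "E \<in> sets L" "shift_path 1 -` E \<inter> space L = E" for E
        using erg that by (simp add: ergodic_process_def)
    qed (use \<open>0 < r\<close> in simp)
    then have "\<forall>\<^sub>F n in sequentially. norm ((\<Sum>k<n. \<bar>law.correlation ?B ?B k\<bar>) / real n - 0) < r"
      using eventually_gt_at_top[of 0]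
    proof eventually_elim
      case (elim n)
      have "(\<Sum>k<n. \<bar>law.correlation ?B ?B k\<bar>) / real n
          = (\<Sum>k<n. measure L (?B \<inter> (shift_path 1 ^^ k) -` ?B)) / real n - measure L ?B * measure L ?B"
        using elim(2) c0 by (simp add: law.correlation_def[abs_def] shift_path_funpow sum_subtractf diff_divide_distrib)
      also have "\<dots> \<le> r / 2" using elim(1) by linarith
      finally have "(\<Sum>k<n. \<bar>law.correlation ?B ?B k\<bar>) / real n < r" using \<open>0 < r\<close> by linarith
      then show ?case by (simp add: sum_nonneg)
    qed
    then show "\<exists>no. \<forall>n\<ge>no. norm ((\<Sum>k<n. \<bar>law.correlation ?B ?B k\<bar>) / real n - 0) < r"
      unfolding eventually_sequentially .
  qed
  then show "vanishes_on_average (\<lambda>n. overlap 0 (int n))"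
    by (rule null_correlation_imp_null_overlap[OF averaging.null_mode_axioms st])
qed

end

section \<open>Invariance under denoising\<close>

lemma degenerate_frechet_AE_one:
  assumes "prob_space M" and U: "has_frechet_distribution M U \<infinity>" and [measurable]: "U \<in> borel_measurable M"
  shows "AE \<omega> in M. U \<omega> = 1"
proof -
  interpret prob_space M by fact
  have cdf: "prob {\<omega>\<in>space M. U \<omega> \<le> x} = indicator {1..} x" for x
  proof -
    have "prob {\<omega>\<in>space M. U \<omega> \<le> x} = cdf (distr M borel U) x"
      unfolding cdf_def by (subst measure_distr) (auto intro!: arg_cong[where f=prob])
    then show ?thesis using U by (simp add: has_frechet_distribution_def frechet_cdf_def)
  qed
  have "prob {\<omega>\<in>space M. U \<omega> \<le> 1} = 1" by (simp add: cdf)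
  then have le: "AE \<omega> in M. U \<omega> \<le> 1" by (subst (asm) prob_Collect_eq_1) auto
  have "AE \<omega> in M. \<forall>m::nat. 1 - 1 / real (Suc m) < U \<omega>"
  proof (subst AE_all_countable, intro allI)
    fix m :: nat
    have "prob {\<omega>\<in>space M. U \<omega> \<le> 1 - 1 / real (Suc m)} = 0" by (simp add: cdf del: of_nat_Suc)
    then have "AE \<omega> in M. \<not> U \<omega> \<le> 1 - 1 / real (Suc m)" by (subst (asm) prob_Collect_eq_0) auto
    then show "AE \<omega> in M. 1 - 1 / real (Suc m) < U \<omega>" by eventually_elim auto
  qed
  with le show ?thesis
  proof eventually_elim
    case (elim \<omega>)
    have "1 \<le> U \<omega>"
    proof (rule ccontr)
      assume "\<not> 1 \<le> U \<omega>"
      then obtain m where "1 / real (Suc m) < 1 - U \<omega>" using nat_approx_posE[of "1 - U \<omega>"] by auto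
      with elim(2) show False by (smt (verit))
    qed
    with elim(1) show ?case by simp
  qed
qed

theorem proposition8:
  fixes p :: ereal
    and Q :: "'x measure" and X :: "int \<Rightarrow> 'x \<Rightarrow> real"
    and P :: "'w measure" and W\<^sub>0 :: "int \<Rightarrow> 'w \<Rightarrow> real"
    and M :: "'a measure" and U :: "int \<Rightarrow> 'a \<Rightarrow> real"
    and A :: "nat \<Rightarrow> 'a \<Rightarrow> real" and W :: "nat \<Rightarrow> int \<Rightarrow> 'a \<Rightarrow> real"
  assumes p: "1 < p"
    and "prob_space Q" and "prob_space P" and "prob_space M"
    \<comment> \<open>the process X\<close>
    and X_rv: "\<And>s. X s \<in> borel_measurable Q"
    and X_simple: "simple_max_stable Q X"
    \<comment> \<open>the non-negative process of which the W i are copies\<close>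
    and W0_rv: "\<And>s. W\<^sub>0 s \<in> borel_measurable P"
    and W0_nonneg: "\<And>s \<omega>. \<omega> \<in> space P \<Longrightarrow> 0 \<le> W\<^sub>0 s \<omega>"
    and W0_mean: "\<And>s. has_bochner_integral P (W\<^sub>0 s) 1"
    \<comment> \<open>the three families in the representation\<close>
    and U_indep: "prob_space.indep_vars M (\<lambda>_. borel) U UNIV"
    and U_frechet: "\<And>s. has_frechet_distribution M (U s) p"
    and A_poisson: "poisson_process_points M inverse_square_measure A"
    and W_indep: "prob_space.indep_vars M (\<lambda>_. path_space) (\<lambda>i \<omega> s. W i s \<omega>) UNIV"
    and W_copies: "\<And>i. same_fdd M (W i) P W\<^sub>0"
    and families_indep:
      "indep_three M path_space (\<lambda>\<omega> s. U s \<omega>)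
         path_space (\<lambda>\<omega> i. A i \<omega>)
         (\<Pi>\<^sub>M i\<in>UNIV. path_space) (\<lambda>\<omega> i s. W i s \<omega>)"
    \<comment> \<open>the representation\<close>
    and X_repr:
      "same_fdd Q X M
         (\<lambda>s \<omega>. U s \<omega> / Gamma (1 - real_of_ereal (1 / p)) * lp_norm p (\<lambda>i. A i \<omega> * W i s \<omega>))"
  shows "(stationary_process Q X \<longleftrightarrow> stationary_process M (denoised A W)) \<and>
    (stationary_process Q X \<longrightarrow>
      (mixing_process Q X \<longleftrightarrow> mixing_process M (denoised A W)) \<and>
      (ergodic_process Q X \<longleftrightarrow> ergodic_process M (denoised A W)))"
proof -
  interpret Q: prob_space Q by fact
  interpret M: prob_space M by fact
  interpret V: spectral_process P "W\<^sub>0"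
    by (rule spectral_process.intro) (fact \<open>prob_space P\<close> W0_rv W0_nonneg W0_mean)+
  have Um [measurable]: "U s \<in> borel_measurable M" for s using U_indep by (auto simp: M.indep_vars_def)
  have Wp: "(\<lambda>\<omega> s. W i s \<omega>) \<in> measurable M path_space" for i using W_indep by (auto simp: M.indep_vars_def)
  have Wm: "W i s \<in> borel_measurable M" for i s
    using measurable_compose[OF Wp measurable_path_coordinate] by simp
  interpret R: poisson_representation P "W\<^sub>0" M A W
  proof
    show "poisson_process_points M inverse_square_measure A" by (rule A_poisson)
    show "prob_space.indep_vars M (\<lambda>_. path_space) (\<lambda>i \<omega> s. W i s \<omega>) UNIV" by (rule W_indep)
    show "path_law M (W i) = path_law P W\<^sub>0" for i
      by (rule same_fdd_path_law[OF W_copies \<open>prob_space M\<close> \<open>prob_space P\<close> Wm W0_rv])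
    show "distr M path_space (\<lambda>\<omega> i. A i \<omega>) \<Otimes>\<^sub>M distr M (\<Pi>\<^sub>M i\<in>UNIV. path_space) (\<lambda>\<omega> i s. W i s \<omega>)
       = distr M (path_space \<Otimes>\<^sub>M (\<Pi>\<^sub>M i\<in>UNIV. path_space)) (\<lambda>\<omega>. (\<lambda>i. A i \<omega>, \<lambda>i s. W i s \<omega>))"
      by (rule M.indep_three_product_distr(1)[OF families_indep])
  qed
  interpret D: exponent_process P "W\<^sub>0" M \<infinity> "denoised A W"
    by unfold_locales (auto simp: R.denoised_law)
  let ?Y = "\<lambda>s \<omega>. U s \<omega> / Gamma (1 - real_of_ereal (1 / p)) * lp_norm p (\<lambda>i. A i \<omega> * W i s \<omega>)"
  have X_law: "has_exponent_law p P W\<^sub>0 Q X"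
    using p
  proof (cases rule: exponent_cases)
    case 1
    have Ym: "?Y s \<in> borel_measurable M" for s
    proof -
      have "?Y s = (\<lambda>\<omega>. U s \<omega> * denoised A W s \<omega>)" by (simp add: 1 denoised_def fun_eq_iff)
      then show ?thesis using R.measurable_denoised by simp
    qed
    have one: "AE \<omega> in M. \<forall>s. U s \<omega> = 1"
      using degenerate_frechet_AE_one[OF \<open>prob_space M\<close> _ Um] U_frechet 1 by (simp add: AE_all_countable)
    show ?thesis
      unfolding has_exponent_law_def
    proof (intro allI impI)
      fix J :: "int set" and x :: "int \<Rightarrow> real" assume J: "finite J" and x: "\<forall>s\<in>J. 0 < x s"
      have "measure Q {\<omega>\<in>space Q. \<forall>s\<in>J. X s \<omega> \<le> x s} = measure M {\<omega>\<in>space M. \<forall>s\<in>J. ?Y s \<omega> \<le> x s}"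
        by (rule same_fdd_orthant[OF X_repr X_rv Ym J])
      also have "\<dots> = measure M {\<omega>\<in>space M. \<forall>s\<in>J. denoised A W s \<omega> \<le> x s}"
      proof (rule M.finite_measure_eq_AE)
        show "AE \<omega> in M. (\<omega> \<in> {\<omega>\<in>space M. \<forall>s\<in>J. ?Y s \<omega> \<le> x s}) = (\<omega> \<in> {\<omega>\<in>space M. \<forall>s\<in>J. denoised A W s \<omega> \<le> x s})"
          using one by eventually_elim (simp add: 1 denoised_def)
        show "{\<omega>\<in>space M. \<forall>s\<in>J. ?Y s \<omega> \<le> x s} \<in> sets M"
          using J Ym by measurable
        show "{\<omega>\<in>space M. \<forall>s\<in>J. denoised A W s \<omega> \<le> x s} \<in> sets M"
          using J R.measurable_denoised by measurable
      qed
      also have "\<dots> = exp (- V.exponent p J x)"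
        using D.prob_below[OF J] x 1 by simp
      finally show "measure Q {\<omega>\<in>space Q. \<forall>s\<in>J. X s \<omega> \<le> x s} = exp (- V.exponent p J x)" .
    qed
  next
    case (2 q)
    let ?c = "Gamma (1 - 1 / q) :: real" and ?K = "enn2real (\<integral>\<^sup>+\<omega>. ennreal (U 0 \<omega>) \<partial>M)"
    have c: "0 < ?c" using 2 by (intro Gamma_real_pos) simp
    have Y: "?Y s = (\<lambda>\<omega>. U s \<omega> / ?c * lp_norm (ereal q) (\<lambda>i. A i \<omega> * W i s \<omega>))" for s
      using 2 by (simp add: one_ereal_def)
    note Yq = fun_cong[OF Y]
    note Uq = U_frechet[unfolded 2(1)]
    have Ym: "?Y s \<in> borel_measurable M" for s
    proof -
      have "?Y s = (\<lambda>\<omega>. U s \<omega> / ?c * (\<Sum>i. (A i \<omega> * W i s \<omega>) powr q) powr (1 / q))"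
        unfolding Y by (simp add: lp_norm_def fun_eq_iff)
      moreover have "(\<lambda>\<omega>. U s \<omega> / ?c * (\<Sum>i. (A i \<omega> * W i s \<omega>) powr q) powr (1 / q)) \<in> borel_measurable M"
        using R.measurable_point Wm by measurable
      ultimately show ?thesis by simp
    qed
    have law: "measure Q {\<omega>\<in>space Q. \<forall>s\<in>J. X s \<omega> \<le> x s} = exp (- (?K / ?c * V.exponent p J x))"
      if J: "finite J" and x: "\<And>s. s \<in> J \<Longrightarrow> 0 < x s" for J x
    proof -
      have "measure Q {\<omega>\<in>space Q. \<forall>s\<in>J. X s \<omega> \<le> x s} = measure M {\<omega>\<in>space M. \<forall>s\<in>J. ?Y s \<omega> \<le> x s}"
        by (rule same_fdd_orthant[OF X_repr X_rv Ym J])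
      also have "\<dots> = exp (- (?K / ?c * V.exponent (ereal q) J x))"
        using 2(2) c J x Uq
        unfolding Yq by (intro R.frechet_mixture_law[OF _ U_indep _ M.indep_three_product_distr(2)[OF families_indep]]) auto
      finally show ?thesis by (simp add: 2)
    qed
    (* the unit Frechet marginals of X force the mean of U 0 to be the Gamma value *)
    have "measure Q {\<omega>\<in>space Q. X 0 \<omega> \<le> 1} = exp (- 1)"
      using frechet_cdf_real[of Q "X 0" 1 1] X_simple X_rv by (simp add: simple_max_stable_def one_ereal_def)
    moreover have "measure Q {\<omega>\<in>space Q. X 0 \<omega> \<le> 1} = exp (- (?K / ?c))"
      using law[of "{0}" "\<lambda>_. 1"] p by (simp add: V.exponent_singleton)
    ultimately have "?K / ?c = 1" by simp
    with law show ?thesis by (simp add: has_exponent_law_def)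
  qed
  interpret X: exponent_process P "W\<^sub>0" Q p X
    by unfold_locales (auto simp: p X_rv X_law)
  have same_invariance: "(\<forall>h J x. finite J \<longrightarrow> (\<forall>s\<in>J. 0 < x s) \<longrightarrow>
        spectral_process.exponent P (\<lambda>s. W\<^sub>0 (s + h)) p J x = V.exponent p J x)
    \<longleftrightarrow> (\<forall>h J x. finite J \<longrightarrow> (\<forall>s\<in>J. 0 < x s) \<longrightarrow>
        spectral_process.exponent P (\<lambda>s. W\<^sub>0 (s + h)) \<infinity> J x = V.exponent \<infinity> J x)"
    (is "?invp \<longleftrightarrow> ?invmax")
    using p
  proof (cases rule: exponent_cases)
    case (2 q)
    note Uq = U_frechet[unfolded 2(1)]
    show ?thesis
    proof
      assume inv: ?invp
      show ?invmax
      proof (intro allI impI)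
        fix h :: int and J :: "int set" and x :: "int \<Rightarrow> real" assume "finite J" "\<forall>s\<in>J. 0 < x s"
        then show "spectral_process.exponent P (\<lambda>s. W\<^sub>0 (s + h)) \<infinity> J x = V.exponent \<infinity> J x"
          using inv unfolding 2(1)
          by (intro power_exponents_determine_max_exponents[OF D.shifted_spectral_process V.spectral_process_axioms
                \<open>prob_space M\<close> Uq[of 0] Um 2(2)]) auto
      qed
    next
      assume inv: ?invmax
      show ?invp
      proof (intro allI impI)
        fix h :: int and J :: "int set" and x :: "int \<Rightarrow> real" assume "finite J" "\<forall>s\<in>J. 0 < x s"
        then show "spectral_process.exponent P (\<lambda>s. W\<^sub>0 (s + h)) p J x = V.exponent p J x"
          using inv unfolding 2(1)
          by (intro max_exponents_determine_power_exponents[OF D.shifted_spectral_process V.spectral_process_axioms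
                \<open>prob_space M\<close> U_indep Uq 2(2)]) auto
      qed
    qed
  qed simp
  have stationary: "stationary_process Q X \<longleftrightarrow> stationary_process M (denoised A W)"
    unfolding X.stationary_iff D.stationary_iff by (rule same_invariance)
  have "(mixing_process Q X \<longleftrightarrow> mixing_process M (denoised A W)) \<and>
      (ergodic_process Q X \<longleftrightarrow> ergodic_process M (denoised A W))"
    if stX: "stationary_process Q X"
  proof -
    have stD: "stationary_process M (denoised A W)" using stX stationary by simp
    then have shift: "D.overlap (s + h) (t + h) = D.overlap s t" for s t h
      unfolding D.stationary_iff by (intro D.overlap_shift) auto
    show ?thesis
      using X.mixing_iff[OF stX shift] D.mixing_iff[OF stD shift]
        X.ergodic_iff[OF stX shift] D.ergodic_iff[OF stD shift] by simp
  qed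
  with stationary show ?thesis by blast
qed

end
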